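(* Let $f_\bullet : X_\bullet \to Y_\bullet$ be a map of semi-simplicial spaces such that $f_p : X_p \to Y_p$ is a weak homotopy equivalence for every $p \geq 0$. Then the induced map on geometric realisations $\|f_\bullet\| : \|X_\bullet\| \to \|Y_\bullet\|$ is a weak homotopy equivalence.
   Context: All spaces are compactly generated (no Hausdorff condition), and products are formed in that category. A semi-simplicial space $X_\bullet$ is a functor $\Delta_{\mathrm{inj}}^{op} \to \mathrm{Top}$, where $\Delta_{\mathrm{inj}}$ has objects $[p]=\{0<1<\cdots<p\}$, $p\ge 0$, and morphisms the injective monotone maps; equivalently, spaces $X_p$ with face maps $d_i : X_p \to X_{p-1}$, $0\le i\le p$, satisfying $d_i d_j = d_{j-1} d_i$ for $i<j$. Maps of semi-simplicial spaces are natural transformations. The geometric realisation is $\|X_\bullet\| = \left(\coprod_p X_p \times \Delta^p\right)/\sim$ where $(x, d^i t) \sim (d_i x, t)$ and $d^i : \Delta^{p-1} \to \Delta^p$ is the $i$-th coface inclusion of topological simplices. *)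

theory Defs
  imports "HOL-Analysis.Analysis" "HOL-Algebra.Group" "HOL-Homology.Simplices"
begin

section \<open>Compactly generated spaces\<close>

text \<open>
  A set is k-open in \<open>X\<close> if its preimage under every continuous map from a compact Hausdorff space
  is open.  No separation condition is imposed on \<open>X\<close>.  HOL cannot quantify over all types
  inside a definition, so the test spaces are carried by the type \<open>'a list set set\<close>;
  \<open>k_openin_compact_Hausdorff\<close> below shows that this type is large enough: the preimage is then
  open for compact Hausdorff test spaces on any type whatsoever.
  (The library's \<open>k_space\<close> and \<open>kification\<close> are different for non-Hausdorff spaces: they test
  on compact subspaces, which need not be Hausdorff.)
\<close>

definition k_openin :: "'a topology \<Rightarrow> 'a set \<Rightarrow> bool" where
  "k_openin X U \<longleftrightarrow> U \<subseteq> topspace X \<and>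
     (\<forall>(K :: 'a list set set topology) u.
        compact_space K \<and> Hausdorff_space K \<and> continuous_map K X u
        \<longrightarrow> openin K {z \<in> topspace K. u z \<in> U})"

definition cg_coreflection :: "'a topology \<Rightarrow> 'a topology" where
  "cg_coreflection X = topology (k_openin X)"

definition compactly_generated :: "'a topology \<Rightarrow> bool" where
  "compactly_generated X \<longleftrightarrow> (\<forall>U. k_openin X U \<longrightarrow> openin X U)"

definition kprod_topology :: "'a topology \<Rightarrow> 'b topology \<Rightarrow> ('a \<times> 'b) topology" where
  "kprod_topology X Y = cg_coreflection (prod_topology X Y)"

lemma istopology_k_openin: "istopology (k_openin X)"
  unfolding istopology_def
proof (intro conjI allI impI)
  fix S T assume ST: "k_openin X S" "k_openin X T"
  show "k_openin X (S \<inter> T)"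
    unfolding k_openin_def
  proof (intro conjI allI impI)
    show "S \<inter> T \<subseteq> topspace X" using ST by (auto simp: k_openin_def)
    fix K :: "'a list set set topology" and u
    assume "compact_space K \<and> Hausdorff_space K \<and> continuous_map K X u"
    then have "openin K ({z \<in> topspace K. u z \<in> S} \<inter> {z \<in> topspace K. u z \<in> T})"
      using ST unfolding k_openin_def by blast
    moreover have "{z \<in> topspace K. u z \<in> S} \<inter> {z \<in> topspace K. u z \<in> T}
        = {z \<in> topspace K. u z \<in> S \<inter> T}" by auto
    ultimately show "openin K {z \<in> topspace K. u z \<in> S \<inter> T}" by simp
  qed
next
  fix \<U> assume \<U>: "\<forall>S\<in>\<U>. k_openin X S"
  show "k_openin X (\<Union>\<U>)"
    unfolding k_openin_def
  proof (intro conjI allI impI)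
    show "\<Union>\<U> \<subseteq> topspace X" using \<U> by (auto simp: k_openin_def)
    fix K :: "'a list set set topology" and u
    assume "compact_space K \<and> Hausdorff_space K \<and> continuous_map K X u"
    then have "openin K (\<Union>S\<in>\<U>. {z \<in> topspace K. u z \<in> S})"
      using \<U> unfolding k_openin_def by blast
    moreover have "(\<Union>S\<in>\<U>. {z \<in> topspace K. u z \<in> S}) = {z \<in> topspace K. u z \<in> \<Union>\<U>}"
      by auto
    ultimately show "openin K {z \<in> topspace K. u z \<in> \<Union>\<U>}" by simp
  qed
qed

lemma openin_cg_coreflection: "openin (cg_coreflection X) U \<longleftrightarrow> k_openin X U"
  by (simp add: cg_coreflection_def istopology_k_openin)

lemma openin_imp_k_openin:
  assumes "openin X U"
  shows "k_openin X U"
  unfolding k_openin_def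
proof (intro conjI allI impI)
  show "U \<subseteq> topspace X" using assms by (rule openin_subset)
  fix K :: "'a list set set topology" and u
  assume "compact_space K \<and> Hausdorff_space K \<and> continuous_map K X u"
  then have "continuous_map K X u" by blast
  then show "openin K {z \<in> topspace K. u z \<in> U}"
    using assms by (rule openin_continuous_map_preimage)
qed

lemma topspace_cg_coreflection [simp]: "topspace (cg_coreflection X) = topspace X"
proof (rule antisym)
  show "topspace (cg_coreflection X) \<subseteq> topspace X"
    using openin_topspace[of "cg_coreflection X"] unfolding openin_cg_coreflection k_openin_def
    by (rule conjunct1)
  show "topspace X \<subseteq> topspace (cg_coreflection X)"
    by (simp add: openin_cg_coreflection openin_imp_k_openin openin_subset)
qed

lemma compactly_generated_iff: "compactly_generated X \<longleftrightarrow> cg_coreflection X = X"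
  unfolding compactly_generated_def topology_eq openin_cg_coreflection
  by (auto intro: openin_imp_k_openin)

lemma k_openin_embedded_test:
  fixes X :: "'a topology" and e :: "'k \<Rightarrow> 'a list set set"
  assumes U: "k_openin X U" and K: "compact_space K" "Hausdorff_space K"
    and u: "continuous_map K X u" and e: "inj_on e (topspace K)"
  shows "openin K {z \<in> topspace K. u z \<in> U}"
proof -
  define g where "g = inv_into (topspace K) e"
  define K' where "K' = pullback_topology (e ` topspace K) g K"
  have ge: "g (e z) = z" if "z \<in> topspace K" for z
    using that e by (simp add: g_def)
  have ts: "topspace K' = e ` topspace K"
    using ge by (auto simp: K'_def topspace_pullback_topology)
  have cg: "continuous_map K' K g"
    using continuous_map_pullback[OF continuous_map_id, of "e ` topspace K" g K]
    by (simp add: K'_def)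
  have "continuous_map K K (g \<circ> e)"
    by (rule continuous_map_eq[OF continuous_map_id]) (simp add: ge)
  then have ce: "continuous_map K K' e"
    unfolding K'_def by (rule continuous_map_pullback') auto
  have "homeomorphic_maps K K' e g"
    using cg ce ge ts by (auto simp: homeomorphic_maps_def)
  then have "K homeomorphic_space K'"
    by (auto simp: homeomorphic_space_def)
  then have "compact_space K'" "Hausdorff_space K'"
    using K homeomorphic_compact_space homeomorphic_Hausdorff_space by blast+
  moreover have "continuous_map K' X (u \<circ> g)"
    using cg u by (rule continuous_map_compose)
  ultimately have "openin K' {z \<in> topspace K'. (u \<circ> g) z \<in> U}"
    using U unfolding k_openin_def by blast
  then have "openin K {z \<in> topspace K. e z \<in> {z \<in> topspace K'. (u \<circ> g) z \<in> U}}"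
    using ce openin_continuous_map_preimage by blast
  moreover have "{z \<in> topspace K. e z \<in> {z \<in> topspace K'. (u \<circ> g) z \<in> U}}
      = {z \<in> topspace K. u z \<in> U}"
    using ge ts by auto
  ultimately show ?thesis by simp
qed

lemma k_openin_specialization:
  fixes X :: "'a topology"
  assumes U: "k_openin X U" and x: "x \<in> U" and a: "a \<in> topspace X"
    and xa: "\<And>V. openin X V \<Longrightarrow> x \<in> V \<Longrightarrow> a \<in> V"
  shows "a \<in> U"
proof (rule ccontr)
  assume "a \<notin> U"
  define f :: "nat \<Rightarrow> real" where "f n = 1 / real (Suc n)" for n
  define S where "S = insert 0 (range f)"
  have f: "f \<longlonglongrightarrow> 0"
    unfolding f_def by (rule LIMSEQ_Suc[OF lim_1_over_n])
  have f0: "f n \<noteq> 0" for n by (simp add: f_def)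
  have S: "compact S" "countable S"
    using f compact_sequence_with_limit by (auto simp: S_def)
  define e :: "real \<Rightarrow> 'a list set set"
    where "e r = {{replicate (to_nat_on S r) undefined}}" for r
  have e: "inj_on e S"
    using inj_on_to_nat_on[OF S(2)] unfolding e_def inj_on_def
    by (metis length_replicate singleton_inject)
  define u where "u z = (if z = (0::real) then x else a)" for z
  have u: "continuous_map (top_of_set S) X u"
    unfolding continuous_map_def
  proof (intro conjI allI impI)
    show "u \<in> topspace (top_of_set S) \<rightarrow> topspace X"
      using x a U by (auto simp: u_def k_openin_def)
    fix V assume V: "openin X V"
    have "openin (top_of_set S) (S \<inter> (- {0}))" by (intro openin_open_Int) auto
    moreover have "{z \<in> topspace (top_of_set S). u z \<in> V} = S"
      if "x \<in> V" using that xa[OF V] by (auto simp: u_def)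
    moreover have "{z \<in> topspace (top_of_set S). u z \<in> V} = S \<inter> (- {0})"
      if "x \<notin> V" "a \<in> V" using that by (auto simp: u_def)
    moreover have "{z \<in> topspace (top_of_set S). u z \<in> V} = {}"
      if "x \<notin> V" "a \<notin> V" using that by (auto simp: u_def)
    ultimately show "openin (top_of_set S) {z \<in> topspace (top_of_set S). u z \<in> V}"
      by (metis openin_empty openin_subtopology_self)
  qed
  have "openin (top_of_set S) {z \<in> topspace (top_of_set S). u z \<in> U}"
    using k_openin_embedded_test[OF U _ _ u] S e
    by (simp add: Hausdorff_space_subtopology compact_space_subtopology)
  moreover have "{z \<in> topspace (top_of_set S). u z \<in> U} = {0}"
    using x \<open>a \<notin> U\<close> by (auto simp: u_def S_def)
  ultimately have "openin (top_of_set S) {0}" by simp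
  then obtain W where W: "open W" "{0} = S \<inter> W"
    by (auto simp: openin_open)
  then have "eventually (\<lambda>n. f n \<in> W) sequentially"
    using f topological_tendstoD by blast
  then obtain n where "f n \<in> W"
    using eventually_sequentially by auto
  then have "f n \<in> S \<inter> W" by (auto simp: S_def)
  then show False using W(2) f0[of n] by auto
qed

lemma k_openin_compact_Hausdorff:
  fixes X :: "'a topology" and K :: "'k topology"
  assumes U: "k_openin X U" and K: "compact_space K" "Hausdorff_space K"
    and u: "continuous_map K X u"
  shows "openin K {z \<in> topspace K. u z \<in> U}"
proof (subst openin_subopen, intro ballI)
  fix b assume "b \<in> {z \<in> topspace K. u z \<in> U}"
  then have b: "b \<in> topspace K" "u b \<in> U" by auto
  define A where "A = topspace X - U"
  have utop: "u z \<in> topspace X" if "z \<in> topspace K" for z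
    using u that by (auto simp: continuous_map_def)
  have reg: "regular_space K" using K by (rule compact_Hausdorff_imp_regular_space)
  have "\<exists>W C. openin K W \<and> closedin K C \<and> b \<in> W \<and> W \<subseteq> C \<and> (\<forall>z\<in>C. u z \<noteq> a)"
    if a: "a \<in> A" for a
  proof -
    obtain V where V: "openin X V" "u b \<in> V" "a \<notin> V"
      using k_openin_specialization[OF U b(2), of a] a unfolding A_def by blast
    have bV: "openin K {z \<in> topspace K. u z \<in> V} \<and> b \<in> {z \<in> topspace K. u z \<in> V}"
      using V b u openin_continuous_map_preimage by auto
    have "\<forall>T z. openin K T \<and> z \<in> T \<longrightarrow>
        (\<exists>W C. openin K W \<and> closedin K C \<and> z \<in> W \<and> W \<subseteq> C \<and> C \<subseteq> T)"
      using reg unfolding neighbourhood_base_of_closedin[symmetric] neighbourhood_base_of .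
    from this[rule_format, OF bV]
    obtain W C where WC: "openin K W" "closedin K C" "b \<in> W" "W \<subseteq> C"
        "C \<subseteq> {z \<in> topspace K. u z \<in> V}"
      by (elim exE conjE)
    have "\<forall>z\<in>C. u z \<noteq> a" using WC(5) V(3) by auto
    with WC(1-4) show ?thesis by auto
  qed
  then have "\<forall>a\<in>A. \<exists>W C. openin K W \<and> closedin K C \<and> b \<in> W \<and> W \<subseteq> C \<and> (\<forall>z\<in>C. u z \<noteq> a)"
    by blast
  then obtain W where "\<forall>a\<in>A. \<exists>C. openin K (W a) \<and> closedin K C \<and> b \<in> W a \<and> W a \<subseteq> C \<and>
      (\<forall>z\<in>C. u z \<noteq> a)"
    unfolding bchoice_iff by blast
  then obtain C where WC: "\<forall>a\<in>A. openin K (W a) \<and> closedin K (C a) \<and> b \<in> W a \<and> W a \<subseteq> C a \<and>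
      (\<forall>z\<in>C a. u z \<noteq> a)"
    unfolding bchoice_iff by blast
  then have W: "\<And>a. a \<in> A \<Longrightarrow> openin K (W a)" "\<And>a. a \<in> A \<Longrightarrow> b \<in> W a"
    and C: "\<And>a. a \<in> A \<Longrightarrow> closedin K (C a)" "\<And>a. a \<in> A \<Longrightarrow> W a \<subseteq> C a"
      "\<And>a z. a \<in> A \<Longrightarrow> z \<in> C a \<Longrightarrow> u z \<noteq> a"
    by blast+
  show "\<exists>T. openin K T \<and> b \<in> T \<and> T \<subseteq> {z \<in> topspace K. u z \<in> U}"
  proof (rule ccontr)
    assume no: "\<not> ?thesis"
    have "\<exists>z. z \<in> topspace K \<and> u z \<in> A \<and> (\<forall>a\<in>set l. z \<in> W a)" if l: "set l \<subseteq> A" for l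
    proof -
      have "openin K (topspace K \<inter> \<Inter>(W ` set l))"
        using l W by (cases "l = []") (auto intro!: openin_Int openin_INT)
      moreover have "b \<in> topspace K \<inter> \<Inter>(W ` set l)"
        using l W b by auto
      ultimately obtain z where "z \<in> topspace K \<inter> \<Inter>(W ` set l)"
          "z \<notin> {z \<in> topspace K. u z \<in> U}"
        using no by blast
      with utop show ?thesis unfolding A_def by blast
    qed
    then obtain s where s: "\<And>l. set l \<subseteq> A \<Longrightarrow> s l \<in> topspace K"
        "\<And>l. set l \<subseteq> A \<Longrightarrow> u (s l) \<in> A" "\<And>l a. set l \<subseteq> A \<Longrightarrow> a \<in> set l \<Longrightarrow> s l \<in> W a"
      by metis
    define D where "D = s ` {l. set l \<subseteq> A}"
    define L where "L = K closure_of D"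
    have "D \<subseteq> topspace K" using s(1) by (auto simp: D_def)
    then have D: "D \<subseteq> topspace K" "D \<subseteq> L"
      using closure_of_subset[of D K] by (simp_all add: L_def)
    have L: "closedin K L" "L \<subseteq> topspace K"
      by (auto simp: L_def closure_of_subset_topspace)
    define KL where "KL = subtopology K L"
    have tKL: "topspace KL = L" using L by (auto simp: KL_def)
    have KL: "compact_space KL" "Hausdorff_space KL"
      unfolding KL_def using K L
      by (auto simp: closedin_compact_space compact_space_subtopology Hausdorff_space_subtopology)
    define e where "e y = {{l. set l \<subseteq> A \<and> s l \<in> N} | N. openin K N \<and> y \<in> N}" for y
    have "inj_on e L"
    proof (rule inj_onI, rule ccontr)
      fix y y' assume y: "y \<in> L" "y' \<in> L" "e y = e y'" "y \<noteq> y'"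
      from y L(2) have "y \<in> topspace K" "y' \<in> topspace K" by auto
      with y(4) K(2) obtain N N' where N: "openin K N" "openin K N'" "y \<in> N" "y' \<in> N'" "disjnt N N'"
        unfolding Hausdorff_space_def by blast
      then have "{l. set l \<subseteq> A \<and> s l \<in> N} \<in> e y'" using y(3) unfolding e_def by blast
      then obtain M where M: "openin K M" "y' \<in> M"
          "{l. set l \<subseteq> A \<and> s l \<in> N} = {l. set l \<subseteq> A \<and> s l \<in> M}"
        unfolding e_def by auto
      have "openin K (M \<inter> N')" "y' \<in> M \<inter> N'" using M N by auto
      then obtain z where "z \<in> D" "z \<in> M \<inter> N'"
        using y(2) unfolding L_def in_closure_of by blast
      with M(3) N(5) show False unfolding D_def disjnt_def by blast
    qed
    then have "inj_on e (topspace KL)" using tKL by simp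
    moreover have "continuous_map KL X u"
      unfolding KL_def using u by (rule continuous_map_from_subtopology)
    ultimately have "openin KL {z \<in> topspace KL. u z \<in> U}"
      using k_openin_embedded_test[OF U KL] by blast
    then have cl: "closedin KL (topspace KL - {z \<in> topspace KL. u z \<in> U})"
      by (rule closedin_diff[OF closedin_topspace])
    have LA: "topspace KL - {z \<in> topspace KL. u z \<in> U} = {z \<in> L. u z \<in> A}"
      using tKL utop L(2) by (auto simp: A_def)
    have "closedin K {z \<in> L. u z \<in> A}"
      by (rule closedin_trans_full[OF _ L(1)]) (use cl in \<open>simp add: LA KL_def[symmetric]\<close>)
    moreover have "D \<subseteq> {z \<in> L. u z \<in> A}"
      using s(2) D(2) by (auto simp: D_def)
    ultimately have "K closure_of D \<subseteq> {z \<in> L. u z \<in> A}"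
      by (rule closure_of_minimal[rotated])
    then have LuA: "\<And>z. z \<in> L \<Longrightarrow> u z \<in> A" by (auto simp: L_def)
    have "compactin K L" using K(1) L(1) by (simp add: closedin_compact_space)
    moreover have "\<forall>V\<in>(\<lambda>a. topspace K - C a) ` A. openin K V" using C(1) by auto
    moreover have "L \<subseteq> \<Union>((\<lambda>a. topspace K - C a) ` A)"
      using LuA C(3) L(2) by blast
    ultimately obtain \<F> where \<F>: "finite \<F>" "\<F> \<subseteq> (\<lambda>a. topspace K - C a) ` A" "L \<subseteq> \<Union>\<F>"
      unfolding compactin_def by blast
    then obtain F where F: "finite F" "F \<subseteq> A" "\<F> = (\<lambda>a. topspace K - C a) ` F"
      by (meson finite_subset_image)
    then obtain l where l: "set l = F" using finite_list by blast
    then have "s l \<in> L" using F D(2) by (auto simp: D_def)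
    then obtain a where "a \<in> F" "s l \<notin> C a" using \<F>(3) F(3) by blast
    with s(3)[of l a] l F(2) C(2)[of a] show False by blast
  qed
qed

section \<open>Semi-simplicial spaces\<close>

text \<open>
  The levels \<open>X 0, X 1, \<dots>\<close> are topologies on one common type, which is no restriction (a sequence of
  spaces embeds in its disjoint union); \<open>d p i\<close> is the face map \<open>d\<^sub>i : X\<^sub>p \<rightarrow> X\<^sub>p\<^sub>-\<^sub>1\<close>, relevant only
  on \<open>topspace (X p)\<close> and for \<open>1 \<le> p\<close>, \<open>i \<le> p\<close>.
\<close>

definition semisimplicial_space :: "(nat \<Rightarrow> 'a topology) \<Rightarrow> (nat \<Rightarrow> nat \<Rightarrow> 'a \<Rightarrow> 'a) \<Rightarrow> bool" where
  "semisimplicial_space X d \<longleftrightarrow>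
     (\<forall>p. compactly_generated (X p)) \<and>
     (\<forall>p. \<forall>i\<le>Suc p. continuous_map (X (Suc p)) (X p) (d (Suc p) i)) \<and>
     (\<forall>p i j. i < j \<and> j \<le> Suc (Suc p) \<longrightarrow>
        (\<forall>x\<in>topspace (X (Suc (Suc p))).
           d (Suc p) i (d (Suc (Suc p)) j x) = d (Suc p) (j - 1) (d (Suc (Suc p)) i x)))"

definition semisimplicial_map ::
  "(nat \<Rightarrow> 'a topology) \<Rightarrow> (nat \<Rightarrow> nat \<Rightarrow> 'a \<Rightarrow> 'a) \<Rightarrow>
   (nat \<Rightarrow> 'b topology) \<Rightarrow> (nat \<Rightarrow> nat \<Rightarrow> 'b \<Rightarrow> 'b) \<Rightarrow> (nat \<Rightarrow> 'a \<Rightarrow> 'b) \<Rightarrow> bool" where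
  "semisimplicial_map X dX Y dY f \<longleftrightarrow>
     (\<forall>p. continuous_map (X p) (Y p) (f p)) \<and>
     (\<forall>p. \<forall>i\<le>Suc p. \<forall>x\<in>topspace (X (Suc p)).
        f p (dX (Suc p) i x) = dY (Suc p) i (f (Suc p) x))"

section \<open>Geometric realisation\<close>

definition simplex_topology :: "nat \<Rightarrow> (nat \<Rightarrow> real) topology" where
  "simplex_topology p = subtopology (powertop_real UNIV) (standard_simplex p)"

definition prerealisation :: "(nat \<Rightarrow> 'a topology) \<Rightarrow> (nat \<times> 'a \<times> (nat \<Rightarrow> real)) topology" where
  "prerealisation X = sum_topology (\<lambda>p. kprod_topology (X p) (simplex_topology p)) UNIV"

definition face_gluing :: "(nat \<Rightarrow> 'a topology) \<Rightarrow> (nat \<Rightarrow> nat \<Rightarrow> 'a \<Rightarrow> 'a) \<Rightarrow>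
    (nat \<times> 'a \<times> (nat \<Rightarrow> real)) rel" where
  "face_gluing X d = {((Suc p, x, simplical_face i t), (p, d (Suc p) i x, t)) | p i x t.
     i \<le> Suc p \<and> x \<in> topspace (X (Suc p)) \<and> t \<in> standard_simplex p}"

definition realisation_rel :: "(nat \<Rightarrow> 'a topology) \<Rightarrow> (nat \<Rightarrow> nat \<Rightarrow> 'a \<Rightarrow> 'a) \<Rightarrow>
    (nat \<times> 'a \<times> (nat \<Rightarrow> real)) rel" where
  "realisation_rel X d =
     Restr ((face_gluing X d \<union> (face_gluing X d)\<inverse>)\<^sup>*) (topspace (prerealisation X))"

definition quotient_topology :: "'a topology \<Rightarrow> 'a rel \<Rightarrow> 'a set topology" where
  "quotient_topology Z r = topology (\<lambda>U. U \<subseteq> topspace Z // r \<and> openin Z (\<Union>U))"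

definition realisation :: "(nat \<Rightarrow> 'a topology) \<Rightarrow> (nat \<Rightarrow> nat \<Rightarrow> 'a \<Rightarrow> 'a) \<Rightarrow>
    (nat \<times> 'a \<times> (nat \<Rightarrow> real)) set topology" where
  "realisation X d = quotient_topology (prerealisation X) (realisation_rel X d)"

text \<open>
  The map of quotients induced by \<open>(p, x, t) \<mapsto> (p, f p x, t)\<close>; the union is over equal sets, see
  \<open>realisation_map_class\<close>.
\<close>

definition realisation_map :: "(nat \<Rightarrow> 'b topology) \<Rightarrow> (nat \<Rightarrow> nat \<Rightarrow> 'b \<Rightarrow> 'b) \<Rightarrow>
    (nat \<Rightarrow> 'a \<Rightarrow> 'b) \<Rightarrow> (nat \<times> 'a \<times> (nat \<Rightarrow> real)) set \<Rightarrow> (nat \<times> 'b \<times> (nat \<Rightarrow> real)) set" where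
  "realisation_map Y dY f C = (\<Union>(p, x, t)\<in>C. realisation_rel Y dY `` {(p, f p x, t)})"

lemma topspace_prerealisation:
  "topspace (prerealisation X) = {(p, x, t). x \<in> topspace (X p) \<and> t \<in> standard_simplex p}"
  by (auto simp: prerealisation_def kprod_topology_def simplex_topology_def)

lemma equiv_realisation_rel: "equiv (topspace (prerealisation X)) (realisation_rel X d)"
proof (rule equivI)
  have "sym ((face_gluing X d \<union> (face_gluing X d)\<inverse>)\<^sup>*)"
    by (rule sym_rtrancl) (auto simp: sym_def)
  then show "sym (realisation_rel X d)"
    unfolding realisation_rel_def sym_def by blast
  show "trans (realisation_rel X d)"
    unfolding realisation_rel_def trans_def by (auto intro: rtrancl_trans)
qed (auto simp: realisation_rel_def refl_on_def)

lemma face_gluing_subset: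
  assumes "semisimplicial_space X d"
  shows "face_gluing X d \<subseteq> topspace (prerealisation X) \<times> topspace (prerealisation X)"
  using assms
  by (fastforce simp: face_gluing_def topspace_prerealisation semisimplicial_space_def
      continuous_map_def intro: simplical_face_in_standard_simplex)

lemma istopology_quotient:
  assumes "equiv (topspace Z) r"
  shows "istopology (\<lambda>U. U \<subseteq> topspace Z // r \<and> openin Z (\<Union>U))"
  unfolding istopology_def
proof (intro conjI allI impI)
  fix S T assume ST: "S \<subseteq> topspace Z // r \<and> openin Z (\<Union>S)" "T \<subseteq> topspace Z // r \<and> openin Z (\<Union>T)"
  then show "S \<inter> T \<subseteq> topspace Z // r" by blast
  have "\<Union>(S \<inter> T) = \<Union>S \<inter> \<Union>T"
  proof (rule antisym)
    show "\<Union>S \<inter> \<Union>T \<subseteq> \<Union>(S \<inter> T)"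
      using ST quotient_disj[OF assms] by blast
  qed blast
  with ST show "openin Z (\<Union>(S \<inter> T))" by auto
next
  fix \<U> assume \<U>: "\<forall>U\<in>\<U>. U \<subseteq> topspace Z // r \<and> openin Z (\<Union>U)"
  then show "\<Union>\<U> \<subseteq> topspace Z // r" by blast
  have "\<Union>(\<Union>\<U>) = (\<Union>U\<in>\<U>. \<Union>U)" by blast
  with \<U> show "openin Z (\<Union>(\<Union>\<U>))" by (metis (no_types, lifting) imageE openin_Union)
qed

lemma openin_quotient_topology:
  assumes "equiv (topspace Z) r"
  shows "openin (quotient_topology Z r) U \<longleftrightarrow> U \<subseteq> topspace Z // r \<and> openin Z (\<Union>U)"
  by (simp add: quotient_topology_def istopology_quotient[OF assms])

lemma topspace_quotient_topology:
  assumes "equiv (topspace Z) r"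
  shows "topspace (quotient_topology Z r) = topspace Z // r"
proof (rule antisym)
  show "topspace (quotient_topology Z r) \<subseteq> topspace Z // r"
    using openin_topspace[of "quotient_topology Z r"] openin_quotient_topology[OF assms] by blast
  have "openin (quotient_topology Z r) (topspace Z // r)"
    by (simp add: openin_quotient_topology[OF assms] Union_quotient[OF assms])
  then show "topspace Z // r \<subseteq> topspace (quotient_topology Z r)"
    by (rule openin_subset)
qed

lemma quotient_map_quotient_topology:
  assumes "equiv (topspace Z) r"
  shows "quotient_map Z (quotient_topology Z r) (\<lambda>z. r `` {z})"
  unfolding quotient_map_def topspace_quotient_topology[OF assms]
proof (intro conjI allI impI)
  show "(\<lambda>z. r `` {z}) ` topspace Z = topspace Z // r" by (auto simp: quotient_def)
  fix U assume U: "U \<subseteq> topspace Z // r"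
  have "{z \<in> topspace Z. r `` {z} \<in> U} = \<Union>U"
  proof (intro Set.set_eqI iffI)
    fix z assume "z \<in> {z \<in> topspace Z. r `` {z} \<in> U}"
    then show "z \<in> \<Union>U" using equiv_class_self[OF assms] by blast
  next
    fix z assume "z \<in> \<Union>U"
    then obtain C where C: "C \<in> U" "z \<in> C" by blast
    with U have C': "C \<in> topspace Z // r" by blast
    then have z: "z \<in> topspace Z" using C(2) Union_quotient[OF assms] by blast
    obtain y where y: "y \<in> topspace Z" "C = r `` {y}" using C' by (auto simp: quotient_def)
    then have "r `` {z} = C" using C(2) equiv_class_eq[OF assms, of y z] by auto
    with z C show "z \<in> {z \<in> topspace Z. r `` {z} \<in> U}" by simp
  qed
  then show "openin Z {z \<in> topspace Z. r `` {z} \<in> U} = openin (quotient_topology Z r) U"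
    using U by (simp add: openin_quotient_topology[OF assms])
qed

lemma realisation_map_class:
  assumes Y: "semisimplicial_space Y dY" and f: "semisimplicial_map X dX Y dY f"
    and x: "x \<in> topspace (X p)" and t: "t \<in> standard_simplex p"
  shows "realisation_map Y dY f (realisation_rel X dX `` {(p, x, t)})
       = realisation_rel Y dY `` {(p, f p x, t)}"
proof -
  define F where "F = (\<lambda>(p, x, t::nat \<Rightarrow> real). (p::nat, f p x, t))"
  have eqY: "equiv (topspace (prerealisation Y)) (realisation_rel Y dY)"
    by (rule equiv_realisation_rel)
  have Ftop: "F z \<in> topspace (prerealisation Y)" if "z \<in> topspace (prerealisation X)" for z
    using that f
    by (auto simp: F_def topspace_prerealisation semisimplicial_map_def continuous_map_def)
  have glue: "(F z, F w) \<in> face_gluing Y dY" if zw: "(z, w) \<in> face_gluing X dX" for z w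
  proof -
    obtain p i x t where *: "z = (Suc p, x, simplical_face i t)" "w = (p, dX (Suc p) i x, t)"
        "i \<le> Suc p" "x \<in> topspace (X (Suc p))" "t \<in> standard_simplex p"
      using zw by (auto simp: face_gluing_def)
    then have "f p (dX (Suc p) i x) = dY (Suc p) i (f (Suc p) x)"
        "f (Suc p) x \<in> topspace (Y (Suc p))"
      using f by (auto simp: semisimplicial_map_def continuous_map_def)
    with * show ?thesis by (auto simp: face_gluing_def F_def)
  qed
  have star: "(F z, F w) \<in> (face_gluing Y dY \<union> (face_gluing Y dY)\<inverse>)\<^sup>*"
    if "(z, w) \<in> (face_gluing X dX \<union> (face_gluing X dX)\<inverse>)\<^sup>*" for z w
    using that
  proof (induction rule: rtrancl_induct)
    case (step v w)
    then have "(F v, F w) \<in> face_gluing Y dY \<union> (face_gluing Y dY)\<inverse>" using glue by blast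
    with step.IH show ?case by (rule rtrancl_into_rtrancl)
  qed simp
  have cong: "realisation_rel Y dY `` {F w} = realisation_rel Y dY `` {F z}"
    if "(z, w) \<in> realisation_rel X dX" for z w
  proof -
    have "(F z, F w) \<in> realisation_rel Y dY"
      using that star[of z w] Ftop by (auto simp: realisation_rel_def)
    then show ?thesis using equiv_class_eq[OF eqY] by blast
  qed
  have self: "(p, x, t) \<in> realisation_rel X dX `` {(p, x, t)}"
    using x t by (intro equiv_class_self[OF equiv_realisation_rel]) (simp add: topspace_prerealisation)
  have "realisation_map Y dY f (realisation_rel X dX `` {(p, x, t)})
      = (\<Union>w\<in>realisation_rel X dX `` {(p, x, t)}. realisation_rel Y dY `` {F w})"
    by (simp add: realisation_map_def F_def case_prod_unfold)
  also have "\<dots> = realisation_rel Y dY `` {F (p, x, t)}"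
    using cong self by blast
  finally show ?thesis by (simp add: F_def)
qed

section \<open>Weak homotopy equivalences\<close>

definition cube :: "nat \<Rightarrow> (nat \<Rightarrow> real) topology" where
  "cube n = product_topology (\<lambda>_. top_of_set {0..1}) {..<n}"

definition cube_boundary :: "nat \<Rightarrow> (nat \<Rightarrow> real) set" where
  "cube_boundary n = {s \<in> topspace (cube n). \<exists>i<n. s i = 0 \<or> s i = 1}"

definition based_cubes :: "nat \<Rightarrow> 'a topology \<Rightarrow> 'a \<Rightarrow> ((nat \<Rightarrow> real) \<Rightarrow> 'a) set" where
  "based_cubes n X x = {g. continuous_map (cube n) X g \<and> g ` cube_boundary n \<subseteq> {x}}"

definition based_homotopy :: "nat \<Rightarrow> 'a topology \<Rightarrow> 'a \<Rightarrow> ((nat \<Rightarrow> real) \<Rightarrow> 'a) rel" where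
  "based_homotopy n X x =
     {(g, h). homotopic_with (\<lambda>k. k ` cube_boundary n \<subseteq> {x}) (cube n) X g h}"

definition cube_concat ::
    "((nat \<Rightarrow> real) \<Rightarrow> 'a) \<Rightarrow> ((nat \<Rightarrow> real) \<Rightarrow> 'a) \<Rightarrow> (nat \<Rightarrow> real) \<Rightarrow> 'a" where
  "cube_concat g h s = (if s 0 \<le> 1/2 then g (s(0 := 2 * s 0)) else h (s(0 := 2 * s 0 - 1)))"

text \<open>
  Concatenation is along coordinate 0, so this is meaningful for \<open>n \<ge> 1\<close> only.  Since
  \<open>homotopic_with\<close> ignores values off the cube, the equivalence classes do too.
\<close>

definition homotopy_group :: "nat \<Rightarrow> 'a topology \<Rightarrow> 'a \<Rightarrow> ((nat \<Rightarrow> real) \<Rightarrow> 'a) set monoid" where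
  "homotopy_group n X x =
     \<lparr>carrier = based_cubes n X x // based_homotopy n X x,
      mult = (\<lambda>C D. \<Union>g\<in>C. \<Union>h\<in>D. based_homotopy n X x `` {cube_concat g h}),
      one = based_homotopy n X x `` {\<lambda>_. x}\<rparr>"

definition homotopy_group_map :: "nat \<Rightarrow> 'b topology \<Rightarrow> ('a \<Rightarrow> 'b) \<Rightarrow> 'a \<Rightarrow>
    ((nat \<Rightarrow> real) \<Rightarrow> 'a) set \<Rightarrow> ((nat \<Rightarrow> real) \<Rightarrow> 'b) set" where
  "homotopy_group_map n Y f x C = (\<Union>g\<in>C. based_homotopy n Y (f x) `` {f \<circ> g})"

definition path_components_map :: "'b topology \<Rightarrow> ('a \<Rightarrow> 'b) \<Rightarrow> 'a set \<Rightarrow> 'b set" where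
  "path_components_map Y f C = (\<Union>x\<in>C. path_component_of_set Y (f x))"

definition weak_homotopy_equivalence :: "'a topology \<Rightarrow> 'b topology \<Rightarrow> ('a \<Rightarrow> 'b) \<Rightarrow> bool" where
  "weak_homotopy_equivalence X Y f \<longleftrightarrow>
     continuous_map X Y f \<and>
     bij_betw (path_components_map Y f) (path_components_of X) (path_components_of Y) \<and>
     (\<forall>n\<ge>1. \<forall>x\<in>topspace X.
        homotopy_group_map n Y f x \<in> iso (homotopy_group n X x) (homotopy_group n Y (f x)))"

end

theory Submission
  imports Defs
begin

text \<open>
  Call a map a cube lifting map if every square from the pair \<open>(I\<^sup>n, boundary)\<close> to it has a lift that
  extends the given one on the boundary and commutes up to a homotopy rel boundary; these are exactly
  the weak homotopy equivalences.  Cutting a cube into a fine grid and lifting cell by cell shows that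
  the lifting property is local: it suffices to have it over all finite intersections of members of
  an open cover of the target.

  The realisation is covered by the open sets \<open>U\<^sub>c\<close>, \<open>0 < c < 1\<close>, of points none of whose barycentric
  coordinates equals \<open>c\<close> times the largest one.  Over a finite intersection of these, with \<open>c\<close> the least
  index involved, the coordinates below \<open>c\<close> times the largest one can be shrunk to \<open>0\<close> by a
  straight-line homotopy that does not leave the intersection.  Deleting the vanishing coordinates
  and applying the corresponding face maps then lifts the points continuously to the coproduct of the
  spaces \<open>X\<^sub>p \<times> \<Delta>\<^sup>p\<close>.  Hence the realisation of \<open>f\<close> over the intersection is a homotopy retract of a
  restriction of the coproduct of the maps \<open>f\<^sub>p \<times> id\<close>, which has the lifting property.
\<close>

section \<open>Cubes\<close>

text \<open>The obstacle is discontinuity. Passing to a representative without zero coordinates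
  jumps when a coordinate tends to 0, and cutting off small coordinates jumps when one of them
  crosses the bound. Where no coordinate lies on the bound, the set of coordinates above it is
  locally constant: cutting off is continuous there, and so is the passage to representatives that
  follows it, because the pattern of zeros has become locally constant too. The bound is a fraction
  of the largest coordinate, and not a constant, for two reasons: some coordinate always survives,
  so that the rest can be renormalised, and a common rescaling of the survivors does not move them
  across the bound. Inserting zeros does not matter either, so the condition makes sense in the
  quotient. The least fraction is used on an intersection because coordinates below it are below
  every other bound as well, and diminishing them cannot close another gap. Open covers replace an
  induction over skeleta because a cube can be cut into pieces subordinate to an open cover without
  any separation property of the levels.\<close>

definition cube_set :: "nat \<Rightarrow> (nat \<Rightarrow> real) set" where
  "cube_set n = PiE {..<n} (\<lambda>_. {0..1})"

lemma in_cube_set: "x \<in> cube_set n \<longleftrightarrow> (\<forall>i<n. 0 \<le> x i \<and> x i \<le> 1) \<and> (\<forall>i\<ge>n. x i = undefined)"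
  by (auto simp: cube_set_def PiE_iff extensional_def)

lemma continuous_map_top_of_set_compose:
  assumes "continuous_map (top_of_set T) X g" "continuous_on S \<phi>" "\<And>s. s \<in> S \<Longrightarrow> \<phi> s \<in> T"
  shows "continuous_map (top_of_set S) X (\<lambda>s. g (\<phi> s))"
proof -
  have "continuous_map (top_of_set S) (top_of_set T) \<phi>"
    using assms by (auto simp: continuous_map_subtopology_eu)
  from continuous_map_compose[OF this assms(1)] show ?thesis by (simp add: o_def)
qed

lemma continuous_map_top_of_set_paste:
  assumes "closedin (top_of_set S) S1" "closedin (top_of_set S) S2" "S \<subseteq> S1 \<union> S2"
    and "continuous_map (top_of_set S1) X g" "continuous_map (top_of_set S2) X g"
  shows "continuous_map (top_of_set S) X g"
proof (rule pasting_lemma_closed[where I = "{True,False}" and T = "\<lambda>b. if b then S1 else S2"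
      and f = "\<lambda>_. g"])
  have "S1 \<subseteq> S" "S2 \<subseteq> S" using assms(1,2) closedin_imp_subset by auto
  then show "continuous_map (subtopology (top_of_set S) (if i then S1 else S2)) X g" for i
    using assms(4,5) by (cases i) (simp_all add: subtopology_subtopology inf_absorb2)
  show "closedin (top_of_set S) (if i then S1 else S2)" for i
    using assms(1,2) by (cases i) simp_all
  show "\<exists>j. j \<in> {True, False} \<and> x \<in> (if j then S1 else S2) \<and> g x = g x"
    if "x \<in> topspace (top_of_set S)" for x
    using that assms(3) by auto
qed simp_all

text \<open>The coordinates beyond \<open>n\<close> are constant on extensional functions, so the
  product topology over \<open>{..<n}\<close> and the topology inherited from all functions
  \<open>nat \<Rightarrow> real\<close> coincide. From here on, cubes are closed subsets of one
  metric space, in which compactness and distances are available.\<close>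

lemma cube_eq: "cube n = top_of_set (cube_set n)"
proof -
  have 1: "continuous_map (cube n) (top_of_set (cube_set n)) id"
    unfolding continuous_map_in_subtopology
  proof
    have "continuous_map (cube n) (euclidean :: real topology) (\<lambda>x. x i)" for i
    proof (cases "i < n")
      case True
      have "continuous_map (cube n) (top_of_set {0..1::real}) (\<lambda>x. x i)"
        unfolding cube_def by (rule continuous_map_product_projection) (use True in simp)
      then show ?thesis by (rule continuous_map_into_fulltopology)
    next
      case False
      have "continuous_map (cube n) euclideanreal (\<lambda>x. undefined)" by simp
      then show ?thesis
        by (rule continuous_map_eq) (use False in \<open>auto simp: cube_def PiE_iff extensional_def\<close>)
    qed
    then have "continuous_map (cube n) (powertop_real UNIV) (\<lambda>x. x)"
      by (intro continuous_map_coordinatewise_then_product) auto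
    then show "continuous_map (cube n) euclidean id"
      by (simp add: euclidean_product_topology id_def)
    show "id \<in> topspace (cube n) \<rightarrow> cube_set n" by (auto simp: cube_def cube_set_def)
  qed
  have 2: "continuous_map (top_of_set (cube_set n)) (cube n) id"
    unfolding cube_def
  proof (rule iffD2[OF continuous_map_componentwise], intro conjI ballI)
    show "id ` topspace (top_of_set (cube_set n)) \<subseteq> extensional {..<n}"
      by (simp add: cube_set_def PiE_iff subset_iff)
    fix k assume k: "k \<in> {..<n}"
    have "continuous_on (cube_set n) (\<lambda>x. x k)"
      by (rule continuous_on_subset[OF continuous_on_product_coordinates]) simp
    then show "continuous_map (top_of_set (cube_set n)) (top_of_set {0..1}) (\<lambda>x. id x k)"
      using k by (simp add: in_cube_set)
  qed
  have ts: "topspace (cube n) = topspace (top_of_set (cube_set n))"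
    by (simp add: cube_def cube_set_def)
  show ?thesis
    using 1 2 topology_finer_continuous_id[OF ts] topology_finer_continuous_id[OF ts[symmetric]]
    unfolding topology_eq by metis
qed
lemma topspace_cube: "topspace (cube n) = cube_set n"
  by (simp add: cube_eq)

lemma cube_boundary_iff: "x \<in> cube_boundary n \<longleftrightarrow> x \<in> cube_set n \<and> (\<exists>i<n. x i = 0 \<or> x i = 1)"
  by (simp add: cube_boundary_def topspace_cube)

lemma cube_boundary_subset: "cube_boundary n \<subseteq> cube_set n"
  by (auto simp: cube_boundary_iff)

lemma continuous_on_coordinate:
  fixes f :: "'a::topological_space \<Rightarrow> 'b \<Rightarrow> 'c::topological_space"
  assumes "continuous_on S f"
  shows "continuous_on S (\<lambda>x. f x i)"
  using assms by (rule continuous_on_product_then_coordinatewise)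

declare continuous_on_coordinatewise_then_product [continuous_intros del]

lemma closed_cube_set: "closed (cube_set n)"
proof -
  have "cube_set n = (\<Inter>i\<in>{..<n}. {x. 0 \<le> x i} \<inter> {x. x i \<le> 1}) \<inter> (\<Inter>i\<in>{n..}. {x. x i = undefined})"
    by (auto simp: in_cube_set)
  moreover have "closed \<dots>"
    by (intro closed_Int closed_INT ballI closed_Collect_le closed_Collect_eq continuous_intros
        continuous_on_product_coordinates)
  ultimately show ?thesis by simp
qed

lemma compact_cube_set: "compact (cube_set n)"
proof -
  have "compact_space (cube n)"
    unfolding cube_def by (rule compact_space_product_topology[THEN iffD2]) (simp add: compact_space_subtopology)
  then show ?thesis
    by (simp add: cube_eq compactin_subspace flip: compactin_euclidean_iff)
qed

lemma closed_cube_boundary: "closed (cube_boundary n)"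
proof -
  have "cube_boundary n = cube_set n \<inter> (\<Union>i\<in>{..<n}. {x. x i = 0} \<union> {x. x i = 1})"
    by (auto simp: cube_boundary_iff)
  moreover have "closed \<dots>"
    by (intro closed_Int closed_UN closed_Un ballI closed_Collect_eq continuous_intros closed_cube_set
        continuous_on_product_coordinates) auto
  ultimately show ?thesis by simp
qed

section \<open>Straight lines, scaling about the centre, and homotopy extension\<close>

definition lerp :: "real \<Rightarrow> (nat \<Rightarrow> real) \<Rightarrow> (nat \<Rightarrow> real) \<Rightarrow> nat \<Rightarrow> real" where
  "lerp s x y = (\<lambda>i. (1 - s) * x i + s * y i)"

lemma lerp_0 [simp]: "lerp 0 x y = x" and lerp_1 [simp]: "lerp 1 x y = y"
  and lerp_same [simp]: "lerp s x x = x"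
  by (auto simp: lerp_def algebra_simps)

lemma continuous_on_lerp [continuous_intros]:
  assumes "continuous_on S s" "continuous_on S x" "continuous_on S y"
  shows "continuous_on S (\<lambda>z. lerp (s z) (x z) (y z))"
  unfolding lerp_def
  by (intro continuous_on_coordinatewise_then_product continuous_intros assms continuous_on_coordinate[OF assms(2)] continuous_on_coordinate[OF assms(3)])

text \<open>Beyond \<open>n\<close> both points have the value \<open>undefined\<close>, a fixed
  real number, and an affine combination of equal numbers returns that number.\<close>

lemma lerp_in_cube_set:
  assumes "0 \<le> s" "s \<le> 1" "x \<in> cube_set n" "y \<in> cube_set n"
  shows "lerp s x y \<in> cube_set n"
  using assms by (auto simp: in_cube_set lerp_def intro!: convex_bound_le) (simp add: algebra_simps)

text \<open>The value \<open>undefined\<close> beyond \<open>n\<close> makes the displacement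
  \<open>x i - cube_center n i\<close> vanish there for points of the cube, so that scaling keeps
  them extensional.\<close>

definition cube_center :: "nat \<Rightarrow> nat \<Rightarrow> real" where
  "cube_center n i = (if i < n then 1/2 else undefined)"

lemma cube_center_in: "cube_center n \<in> cube_set n"
  by (auto simp: in_cube_set cube_center_def)

definition scale_cube :: "nat \<Rightarrow> real \<Rightarrow> (nat \<Rightarrow> real) \<Rightarrow> nat \<Rightarrow> real" where
  "scale_cube n r x = (\<lambda>i. cube_center n i + r * (x i - cube_center n i))"

lemma scale_cube_1 [simp]: "scale_cube n 1 x = x"
  by (simp add: scale_cube_def)

lemma continuous_on_scale_cube [continuous_intros]:
  assumes "continuous_on S r" "continuous_on S x"
  shows "continuous_on S (\<lambda>z. scale_cube n (r z) (x z))"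
  unfolding scale_cube_def by (intro continuous_on_coordinatewise_then_product continuous_intros assms continuous_on_coordinate[OF assms(2)])

text \<open>Twice the sup-norm distance from the centre, so that the boundary of the cube is the
  level 1. In dimension 0 the value is 0, in accordance with the empty boundary.\<close>

primrec cube_radius :: "nat \<Rightarrow> (nat \<Rightarrow> real) \<Rightarrow> real" where
  "cube_radius 0 x = 0"
| "cube_radius (Suc n) x = max (cube_radius n x) \<bar>2 * x n - 1\<bar>"

lemma continuous_on_cube_radius [continuous_intros]:
  "continuous_on S x \<Longrightarrow> continuous_on S (\<lambda>z. cube_radius n (x z))"
  by (induction n)
    (auto intro!: continuous_on_max continuous_on_rabs continuous_on_diff continuous_on_mult
      continuous_on_const intro: continuous_on_coordinate)

lemma cube_radius_nonneg: "0 \<le> cube_radius n x"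
  by (induction n) auto

lemma cube_radius_ge: "i < n \<Longrightarrow> \<bar>2 * x i - 1\<bar> \<le> cube_radius n x"
  by (induction n) (auto simp: less_Suc_eq)

lemma cube_radius_attained: "n > 0 \<Longrightarrow> \<exists>i<n. cube_radius n x = \<bar>2 * x i - 1\<bar>"
proof (induction n)
  case (Suc n)
  show ?case
  proof (cases "n = 0 \<or> cube_radius n x \<le> \<bar>2 * x n - 1\<bar>")
    case True
    then have "cube_radius (Suc n) x = \<bar>2 * x n - 1\<bar>" by auto
    then show ?thesis by blast
  next
    case False
    then obtain i where "i < n" "cube_radius n x = \<bar>2 * x i - 1\<bar>" using Suc.IH by auto
    with False have "i < Suc n" "cube_radius (Suc n) x = \<bar>2 * x i - 1\<bar>" by auto
    then show ?thesis by blast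
  qed
qed simp

lemma cube_radius_le_1:
  assumes "x \<in> cube_set n" shows "cube_radius n x \<le> 1"
proof (cases "n = 0")
  case False
  then obtain i where "i < n" "cube_radius n x = \<bar>2 * x i - 1\<bar>" using cube_radius_attained by blast
  then show ?thesis using assms by (auto simp: in_cube_set abs_le_iff)
qed simp

lemma cube_radius_eq_1:
  assumes "x \<in> cube_set n" shows "cube_radius n x = 1 \<longleftrightarrow> x \<in> cube_boundary n"
proof
  assume r: "cube_radius n x = 1"
  then have "n > 0" by (cases n) auto
  then obtain i where i: "i < n" "\<bar>2 * x i - 1\<bar> = 1" using cube_radius_attained r by metis
  then have "x i = 0 \<or> x i = 1" by linarith
  with i assms show "x \<in> cube_boundary n" by (auto simp: cube_boundary_iff)
next
  assume "x \<in> cube_boundary n"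
  then obtain i where i: "i < n" "x i = 0 \<or> x i = 1" by (auto simp: cube_boundary_iff)
  then have "\<bar>2 * x i - 1\<bar> = 1" by auto
  then show "cube_radius n x = 1"
    using cube_radius_ge[OF i(1), of x] cube_radius_le_1[OF assms] by simp
qed

lemma cube_radius_scale:
  assumes "0 \<le> r" shows "cube_radius n (scale_cube n r x) = r * cube_radius n x"
proof -
  have "cube_radius m (scale_cube n r x) = r * cube_radius m x" if "m \<le> n" for m
    using that
  proof (induction m)
    case (Suc m)
    have "2 * scale_cube n r x m - 1 = r * (2 * x m - 1)"
      using Suc.prems by (simp add: scale_cube_def cube_center_def algebra_simps)
    then have "\<bar>2 * scale_cube n r x m - 1\<bar> = r * \<bar>2 * x m - 1\<bar>"
      using assms by (simp add: abs_mult)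
    then show ?case using Suc assms by (simp add: max_mult_distrib_left)
  qed simp
  then show ?thesis by simp
qed

lemma scale_cube_in:
  assumes "x \<in> cube_set n" "0 \<le> r" "r * cube_radius n x \<le> 1"
  shows "scale_cube n r x \<in> cube_set n"
  unfolding in_cube_set
proof (intro conjI allI impI)
  fix i assume i: "i < n"
  have "\<bar>2 * scale_cube n r x i - 1\<bar> \<le> 1"
    using cube_radius_ge[OF i, of "scale_cube n r x"] assms by (simp add: cube_radius_scale)
  then show "0 \<le> scale_cube n r x i" "scale_cube n r x i \<le> 1" by linarith+
next
  fix i assume "n \<le> i"
  then show "scale_cube n r x i = undefined"
    using assms by (simp add: scale_cube_def cube_center_def in_cube_set)
qed

text \<open>The projection of the prism \<open>[0,1] \<times> cube\<close> from the point over its centre at height 2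
  onto the bottom and the sides.\<close>

definition prism_scale :: "nat \<Rightarrow> real \<times> (nat \<Rightarrow> real) \<Rightarrow> real" where
  "prism_scale n p = 1 / max (cube_radius n (snd p)) (1 - fst p / 2)"

definition prism_retract :: "nat \<Rightarrow> real \<times> (nat \<Rightarrow> real) \<Rightarrow> real \<times> (nat \<Rightarrow> real)" where
  "prism_retract n p = (2 - (2 - fst p) * prism_scale n p, scale_cube n (prism_scale n p) (snd p))"

lemma continuous_on_prism_retract: "continuous_on ({0..1} \<times> S) (prism_retract n)"
  unfolding prism_retract_def prism_scale_def
  by (intro continuous_intros continuous_on_max) (auto simp: max_def)

text \<open>The ray from the apex through \<open>(t, x)\<close> is, at parameter \<open>s\<close>,
  at height \<open>2 - (2 - t) * s\<close> and at \<open>s\<close> times the radius of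
  \<open>x\<close>. It meets the bottom at \<open>s = 1 / (1 - t / 2)\<close> and the sides at the
  reciprocal of the radius; \<open>prism_scale\<close> is the smaller of the two, the first exit.
  Since \<open>t \<le> 1\<close>, the maximum in its denominator is at least 1/2.\<close>

lemma prism_retract:
  assumes t: "0 \<le> t" "t \<le> 1" and x: "x \<in> cube_set n"
  shows "0 \<le> fst (prism_retract n (t, x))" "fst (prism_retract n (t, x)) \<le> 1"
    "snd (prism_retract n (t, x)) \<in> cube_set n"
    "fst (prism_retract n (t, x)) = 0 \<or> snd (prism_retract n (t, x)) \<in> cube_boundary n"
    "t = 0 \<or> x \<in> cube_boundary n \<Longrightarrow> prism_retract n (t, x) = (t, x)"
proof -
  define \<rho> where "\<rho> = cube_radius n x"
  define m where "m = max \<rho> (1 - t / 2)"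
  have \<rho>: "0 \<le> \<rho>" "\<rho> \<le> 1" using cube_radius_nonneg cube_radius_le_1[OF x] by (simp_all add: \<rho>_def)
  have m: "m > 0" "\<rho> \<le> m" "1 - t/2 \<le> m" "m \<le> 1" using t \<rho> unfolding m_def by linarith+
  have R: "prism_retract n (t, x) = (2 - (2 - t) / m, scale_cube n (1 / m) x)"
    by (simp add: prism_retract_def prism_scale_def m_def \<rho>_def)
  show s: "snd (prism_retract n (t, x)) \<in> cube_set n"
    unfolding R using m by (simp add: scale_cube_in[OF x] \<rho>_def[symmetric])
  show "0 \<le> fst (prism_retract n (t, x))"
    unfolding R using m by (simp add: field_simps)
  have "2 - t \<le> (2 - t) / m" using m(1,4) t by (simp only: pos_le_divide_eq) (rule mult_left_le, auto)
  then show "fst (prism_retract n (t, x)) \<le> 1" using t unfolding R by simp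
  show "fst (prism_retract n (t, x)) = 0 \<or> snd (prism_retract n (t, x)) \<in> cube_boundary n"
  proof (cases "\<rho> \<le> 1 - t / 2")
    case True
    then have "m = 1 - t / 2" by (simp add: m_def)
    then show ?thesis using t unfolding R by (simp add: field_simps)
  next
    case False
    then have "m = \<rho>" by (simp add: m_def)
    then have "cube_radius n (snd (prism_retract n (t, x))) = 1"
      using m unfolding R by (simp add: cube_radius_scale \<rho>_def)
    then show ?thesis using cube_radius_eq_1[OF s] by blast
  qed
  assume "t = 0 \<or> x \<in> cube_boundary n"
  then have "m = 1"
    using t \<rho> cube_radius_eq_1[OF x] by (auto simp: m_def \<rho>_def max_def)
  then show "prism_retract n (t, x) = (t, x)" unfolding R by simp
qed

lemma closedin_TimesI:
  "closed S \<Longrightarrow> closed T \<Longrightarrow> S \<times> T \<subseteq> U \<Longrightarrow> closedin (top_of_set U) (S \<times> T)"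
  by (simp add: closed_subset closed_Times)

text \<open>\<open>b\<close> on the bottom and \<open>H\<close> on the sides glue to a map on the
  box without lid, and \<open>prism_retract\<close> extends it over the prism.\<close>

lemma homotopy_extension:
  fixes H :: "real \<times> (nat \<Rightarrow> real) \<Rightarrow> 'a"
  assumes b: "continuous_map (top_of_set (cube_set n)) X b"
    and H: "continuous_map (top_of_set ({0..1} \<times> cube_boundary n)) X H"
    and Hb: "\<And>z. z \<in> cube_boundary n \<Longrightarrow> H (0, z) = b z"
  obtains K where "continuous_map (top_of_set ({0..1} \<times> cube_set n)) X K"
    "\<And>x. x \<in> cube_set n \<Longrightarrow> K (0, x) = b x"
    "\<And>t z. 0 \<le> t \<Longrightarrow> t \<le> 1 \<Longrightarrow> z \<in> cube_boundary n \<Longrightarrow> K (t, z) = H (t, z)"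
proof
  define T where "T = {0::real} \<times> cube_set n \<union> {0..1} \<times> cube_boundary n"
  define g where "g = (\<lambda>(t, x). if t = (0::real) then b x else H (t, x))"
  have "continuous_map (top_of_set T) X g"
  proof (rule continuous_map_top_of_set_paste)
    show "closedin (top_of_set T) ({0} \<times> cube_set n)" "closedin (top_of_set T) ({0..1} \<times> cube_boundary n)"
      by (intro closedin_TimesI closed_cube_set closed_cube_boundary; auto simp: T_def)+
    show "T \<subseteq> {0} \<times> cube_set n \<union> {0..1} \<times> cube_boundary n" by (simp add: T_def)
    have "continuous_map (top_of_set ({0} \<times> cube_set n)) X (\<lambda>p. b (snd p))"
      by (rule continuous_map_top_of_set_compose[OF b]) (auto intro!: continuous_intros)
    then show "continuous_map (top_of_set ({0} \<times> cube_set n)) X g"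
      by (rule continuous_map_eq) (auto simp: g_def)
    show "continuous_map (top_of_set ({0..1} \<times> cube_boundary n)) X g"
      by (rule continuous_map_eq[OF H]) (auto simp: g_def Hb)
  qed
  then show "continuous_map (top_of_set ({0..1} \<times> cube_set n)) X (\<lambda>p. g (prism_retract n p))"
  proof (rule continuous_map_top_of_set_compose)
    fix p :: "real \<times> (nat \<Rightarrow> real)" assume "p \<in> {0..1} \<times> cube_set n"
    then obtain t x where p: "p = (t, x)" "0 \<le> t" "t \<le> 1" "x \<in> cube_set n" by auto
    show "prism_retract n p \<in> T"
      using prism_retract(1-4)[OF p(2-4)] unfolding p(1) T_def
      by (cases "prism_retract n (t, x)") auto
  qed (rule continuous_on_prism_retract)
  show "g (prism_retract n (0, x)) = b x" if "x \<in> cube_set n" for x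
    using prism_retract(5)[of 0 x n] that by (simp add: g_def)
  show "g (prism_retract n (t, z)) = H (t, z)" if "0 \<le> t" "t \<le> 1" "z \<in> cube_boundary n" for t z
    using prism_retract(5)[of t z n] that cube_boundary_subset[of n] Hb by (auto simp: g_def)
qed

section \<open>Lifting squares of maps\<close>

definition lift_square :: "nat \<Rightarrow> 'a topology \<Rightarrow> 'b topology \<Rightarrow> ('a \<Rightarrow> 'b) \<Rightarrow>
    ((nat \<Rightarrow> real) \<Rightarrow> 'a) \<Rightarrow> ((nat \<Rightarrow> real) \<Rightarrow> 'b) \<Rightarrow> bool" where
  "lift_square n X Y f a b \<longleftrightarrow>
     continuous_map (top_of_set (cube_boundary n)) X a \<and>
     continuous_map (top_of_set (cube_set n)) Y b \<and> (\<forall>z\<in>cube_boundary n. f (a z) = b z)"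

text \<open>The boundary data may move here, in contrast to \<open>lifts_cubes\<close>, but the
  square has to commute strictly at every time.\<close>

definition homotopic_squares :: "nat \<Rightarrow> 'a topology \<Rightarrow> 'b topology \<Rightarrow> ('a \<Rightarrow> 'b) \<Rightarrow>
    ((nat \<Rightarrow> real) \<Rightarrow> 'a) \<Rightarrow> ((nat \<Rightarrow> real) \<Rightarrow> 'b) \<Rightarrow>
    ((nat \<Rightarrow> real) \<Rightarrow> 'a) \<Rightarrow> ((nat \<Rightarrow> real) \<Rightarrow> 'b) \<Rightarrow> bool" where
  "homotopic_squares n X Y f a b a' b' \<longleftrightarrow>
     (\<exists>\<alpha> \<beta>. continuous_map (top_of_set ({0..1::real} \<times> cube_boundary n)) X \<alpha> \<and>
        continuous_map (top_of_set ({0..1::real} \<times> cube_set n)) Y \<beta> \<and>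
        (\<forall>t\<in>{0..1::real}. \<forall>z\<in>cube_boundary n. f (\<alpha> (t, z)) = \<beta> (t, z)) \<and>
        (\<forall>z\<in>cube_boundary n. \<alpha> (0, z) = a z \<and> \<alpha> (1, z) = a' z) \<and>
        (\<forall>x\<in>cube_set n. \<beta> (0, x) = b x \<and> \<beta> (1, x) = b' x))"

definition liftable_square :: "nat \<Rightarrow> 'a topology \<Rightarrow> 'b topology \<Rightarrow> ('a \<Rightarrow> 'b) \<Rightarrow>
    ((nat \<Rightarrow> real) \<Rightarrow> 'a) \<Rightarrow> ((nat \<Rightarrow> real) \<Rightarrow> 'b) \<Rightarrow> bool" where
  "liftable_square n X Y f a b \<longleftrightarrow>
     (\<exists>A. continuous_map (top_of_set (cube_set n)) X A \<and>
        (\<forall>z\<in>cube_boundary n. A z = a z) \<and> (\<forall>x\<in>cube_set n. f (A x) = b x))"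

text \<open>Dimension 0 is surjectivity on path components. A square of dimension
  \<open>m + 1\<close> whose boundary map is constant on all faces but two opposite ones is a
  homotopy in \<open>Y\<close> between images of \<open>m\<close>-cubes, so injectivity in dimension
  \<open>m\<close> is encoded as well.\<close>

definition lifts_cubes :: "nat \<Rightarrow> 'a topology \<Rightarrow> 'b topology \<Rightarrow> ('a \<Rightarrow> 'b) \<Rightarrow> bool" where
  "lifts_cubes n X Y f \<longleftrightarrow> (\<forall>a b. lift_square n X Y f a b \<longrightarrow>
     (\<exists>A L. continuous_map (top_of_set (cube_set n)) X A \<and>
        continuous_map (top_of_set ({0..1::real} \<times> cube_set n)) Y L \<and>
        (\<forall>z\<in>cube_boundary n. A z = a z) \<and>
        (\<forall>x\<in>cube_set n. L (0, x) = f (A x) \<and> L (1, x) = b x) \<and>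
        (\<forall>t\<in>{0..1::real}. \<forall>z\<in>cube_boundary n. L (t, z) = b z)))"

lemma continuous_map_time_concat:
  fixes H K :: "real \<times> 'c::t2_space \<Rightarrow> 'a"
  assumes H: "continuous_map (top_of_set ({0..1::real} \<times> S)) X H"
    and K: "continuous_map (top_of_set ({0..1::real} \<times> S)) X K"
    and HK: "\<And>x. x \<in> S \<Longrightarrow> H (1, x) = K (0, x)"
  shows "continuous_map (top_of_set ({0..1::real} \<times> S)) X
    (\<lambda>p. if fst p \<le> 1/2 then H (2 * fst p, snd p) else K (2 * fst p - 1, snd p))"
proof (rule continuous_map_cases_le)
  have e1: "{p \<in> topspace (top_of_set ({0..1::real} \<times> S)). fst p \<le> 1/2} = {0..1/2::real} \<times> S"
    by auto
  have e2: "{p \<in> topspace (top_of_set ({0..1::real} \<times> S)). 1/2 \<le> fst p} = {1/2..1::real} \<times> S"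
    by auto
  have s: "({0..1::real} \<times> S) \<inter> {0..1/2::real} \<times> S = {0..1/2::real} \<times> S"
    "({0..1::real} \<times> S) \<inter> {1/2..1::real} \<times> S = {1/2..1::real} \<times> S" by auto
  show "continuous_map (subtopology (top_of_set ({0..1::real} \<times> S))
      {p \<in> topspace (top_of_set ({0..1::real} \<times> S)). fst p \<le> 1/2}) X (\<lambda>p. H (2 * fst p, snd p))"
    unfolding e1 subtopology_subtopology s
    by (rule continuous_map_top_of_set_compose[OF H]) (auto intro!: continuous_intros)
  show "continuous_map (subtopology (top_of_set ({0..1::real} \<times> S))
      {p \<in> topspace (top_of_set ({0..1::real} \<times> S)). 1/2 \<le> fst p}) X (\<lambda>p. K (2 * fst p - 1, snd p))"
    unfolding e2 subtopology_subtopology s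
    by (rule continuous_map_top_of_set_compose[OF K]) (auto intro!: continuous_intros)
  show "continuous_map (top_of_set ({0..1::real} \<times> S)) euclideanreal fst"
    by (simp add: continuous_on_fst)
  show "H (2 * fst p, snd p) = K (2 * fst p - 1, snd p)"
    if "p \<in> topspace (top_of_set ({0..1} \<times> S))" "fst p = 1/2" for p
  proof -
    have "2 * fst p = 1" using that(2) by simp
    with that(1) HK[of "snd p"] show ?thesis by (simp add: mem_Times_iff)
  qed
qed simp

lemma homotopic_squares_trans:
  assumes "homotopic_squares n X Y f a b a' b'" "homotopic_squares n X Y f a' b' a'' b''"
  shows "homotopic_squares n X Y f a b a'' b''"
proof -
  obtain \<alpha> \<beta> where 1: "continuous_map (top_of_set ({0..1::real} \<times> cube_boundary n)) X \<alpha>"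
        "continuous_map (top_of_set ({0..1::real} \<times> cube_set n)) Y \<beta>"
        "\<forall>t\<in>{0..1::real}. \<forall>z\<in>cube_boundary n. f (\<alpha> (t, z)) = \<beta> (t, z)"
        "\<forall>z\<in>cube_boundary n. \<alpha> (0, z) = a z \<and> \<alpha> (1, z) = a' z"
        "\<forall>x\<in>cube_set n. \<beta> (0, x) = b x \<and> \<beta> (1, x) = b' x"
    using assms(1) unfolding homotopic_squares_def by blast
  obtain \<gamma> \<delta> where 2: "continuous_map (top_of_set ({0..1::real} \<times> cube_boundary n)) X \<gamma>"
        "continuous_map (top_of_set ({0..1::real} \<times> cube_set n)) Y \<delta>"
        "\<forall>t\<in>{0..1::real}. \<forall>z\<in>cube_boundary n. f (\<gamma> (t, z)) = \<delta> (t, z)"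
        "\<forall>z\<in>cube_boundary n. \<gamma> (0, z) = a' z \<and> \<gamma> (1, z) = a'' z"
        "\<forall>x\<in>cube_set n. \<delta> (0, x) = b' x \<and> \<delta> (1, x) = b'' x"
    using assms(2) unfolding homotopic_squares_def by blast
  let ?A = "\<lambda>p. if fst p \<le> 1/2 then \<alpha> (2 * fst p, snd p) else \<gamma> (2 * fst p - 1, snd p)"
  let ?B = "\<lambda>p. if fst p \<le> 1/2 then \<beta> (2 * fst p, snd p) else \<delta> (2 * fst p - 1, snd p)"
  have "continuous_map (top_of_set ({0..1::real} \<times> cube_boundary n)) X ?A"
    by (rule continuous_map_time_concat) (use 1 2 in auto)
  moreover have "continuous_map (top_of_set ({0..1::real} \<times> cube_set n)) Y ?B"
    by (rule continuous_map_time_concat) (use 1 2 in auto)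
  moreover have "\<forall>t\<in>{0..1}. \<forall>z\<in>cube_boundary n. f (?A (t, z)) = ?B (t, z)"
    using 1(3) 2(3) by auto
  ultimately show ?thesis
    unfolding homotopic_squares_def using 1(4,5) 2(4,5)
    by (intro exI[of _ ?A] exI[of _ ?B]) simp
qed

text \<open>To deform a square it is enough to deform its upper map: composed with \<open>f\<close>
  this is a homotopy on the boundary of the cube, which extends over the cube.\<close>

lemma homotopic_squares_extend:
  assumes sq: "lift_square n X Y f a b" and f: "continuous_map X Y f"
    and \<alpha>: "continuous_map (top_of_set ({0..1::real} \<times> cube_boundary n)) X \<alpha>"
    and a: "\<And>z. z \<in> cube_boundary n \<Longrightarrow> \<alpha> (0, z) = a z"
  obtains b' where "lift_square n X Y f (\<lambda>z. \<alpha> (1, z)) b'"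
    "homotopic_squares n X Y f a b (\<lambda>z. \<alpha> (1, z)) b'"
proof -
  have f\<alpha>: "continuous_map (top_of_set ({0..1::real} \<times> cube_boundary n)) Y (\<lambda>p. f (\<alpha> p))"
    using continuous_map_compose[OF \<alpha> f] by (simp add: o_def)
  have b: "continuous_map (top_of_set (cube_set n)) Y b"
    and fb: "\<And>z. z \<in> cube_boundary n \<Longrightarrow> f (\<alpha> (0, z)) = b z"
    using sq a by (simp_all add: lift_square_def)
  obtain \<beta> where \<beta>: "continuous_map (top_of_set ({0..1::real} \<times> cube_set n)) Y \<beta>"
      "\<And>x. x \<in> cube_set n \<Longrightarrow> \<beta> (0, x) = b x"
      "\<And>t z. 0 \<le> t \<Longrightarrow> t \<le> 1 \<Longrightarrow> z \<in> cube_boundary n \<Longrightarrow> \<beta> (t, z) = f (\<alpha> (t, z))"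
    using homotopy_extension[OF b f\<alpha> fb] by blast
  show thesis
  proof
    show "lift_square n X Y f (\<lambda>z. \<alpha> (1, z)) (\<lambda>x. \<beta> (1, x))"
      unfolding lift_square_def
      by (intro conjI continuous_map_top_of_set_compose[OF \<alpha>] continuous_map_top_of_set_compose[OF \<beta>(1)])
        (auto intro!: continuous_intros simp: \<beta>(3))
    show "homotopic_squares n X Y f a b (\<lambda>z. \<alpha> (1, z)) (\<lambda>x. \<beta> (1, x))"
      unfolding homotopic_squares_def
      by (intro exI[of _ \<alpha>] exI[of _ \<beta>]) (simp add: \<alpha> \<beta> a)
  qed
qed

text \<open>A lift of the end of a homotopy of squares is pulled back along the homotopy extension
  \<open>prism_retract\<close> of the end 1; that retraction is homotopic to the identity by a straight line.\<close>

lemma homotopic_square_lift: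
  assumes sq: "lift_square n X Y f a b"
    and hom: "homotopic_squares n X Y f a b a' b'" and lift: "liftable_square n X Y f a' b'"
  obtains A L where "continuous_map (top_of_set (cube_set n)) X A"
    "continuous_map (top_of_set ({0..1::real} \<times> cube_set n)) Y L"
    "\<And>z. z \<in> cube_boundary n \<Longrightarrow> A z = a z"
    "\<And>x. x \<in> cube_set n \<Longrightarrow> L (0, x) = f (A x)" "\<And>x. x \<in> cube_set n \<Longrightarrow> L (1, x) = b x"
    "\<And>t z. t \<in> {0..1} \<Longrightarrow> z \<in> cube_boundary n \<Longrightarrow> L (t, z) = b z"
proof -
  obtain \<alpha> \<beta> where 1: "continuous_map (top_of_set ({0..1::real} \<times> cube_boundary n)) X \<alpha>"
        "continuous_map (top_of_set ({0..1::real} \<times> cube_set n)) Y \<beta>"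
        "\<And>t z. t \<in> {0..1} \<Longrightarrow> z \<in> cube_boundary n \<Longrightarrow> f (\<alpha> (t, z)) = \<beta> (t, z)"
        "\<And>z. z \<in> cube_boundary n \<Longrightarrow> \<alpha> (0, z) = a z"
        "\<And>z. z \<in> cube_boundary n \<Longrightarrow> \<alpha> (1, z) = a' z"
        "\<And>x. x \<in> cube_set n \<Longrightarrow> \<beta> (0, x) = b x" "\<And>x. x \<in> cube_set n \<Longrightarrow> \<beta> (1, x) = b' x"
    using hom unfolding homotopic_squares_def by blast
  obtain A' where A': "continuous_map (top_of_set (cube_set n)) X A'"
      "\<And>z. z \<in> cube_boundary n \<Longrightarrow> A' z = a' z" "\<And>x. x \<in> cube_set n \<Longrightarrow> f (A' x) = b' x"
    using lift unfolding liftable_square_def by blast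
  have \<alpha>': "continuous_map (top_of_set ({0..1::real} \<times> cube_boundary n)) X (\<lambda>p. \<alpha> (1 - fst p, snd p))"
    by (rule continuous_map_top_of_set_compose[OF 1(1)]) (auto intro!: continuous_intros)
  \<comment> \<open>Time is reversed: the bottom carries the strict lift at the end of the homotopy,
    and the sides run back to \<open>a\<close> at height 1.\<close>
  define g where "g = (\<lambda>(t, x). if t = (0::real) then A' x else \<alpha> (1 - t, x))"
  define R where "R = (\<lambda>x. prism_retract n (1, x))"
  define T where "T = {0::real} \<times> cube_set n \<union> {0..1::real} \<times> cube_boundary n"
  have g: "continuous_map (top_of_set T) X g"
  proof (rule continuous_map_top_of_set_paste)
    show "closedin (top_of_set T) ({0} \<times> cube_set n)" "closedin (top_of_set T) ({0..1::real} \<times> cube_boundary n)"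
      by (intro closedin_TimesI closed_cube_set closed_cube_boundary; auto simp: T_def)+
    show "T \<subseteq> {0} \<times> cube_set n \<union> {0..1::real} \<times> cube_boundary n" by (simp add: T_def)
    have "continuous_map (top_of_set ({0} \<times> cube_set n)) X (\<lambda>p. A' (snd p))"
      by (rule continuous_map_top_of_set_compose[OF A'(1)]) (auto intro!: continuous_intros)
    then show "continuous_map (top_of_set ({0} \<times> cube_set n)) X g"
      by (rule continuous_map_eq) (auto simp: g_def)
    show "continuous_map (top_of_set ({0..1::real} \<times> cube_boundary n)) X g"
      by (rule continuous_map_eq[OF \<alpha>']) (auto simp: g_def A' 1)
  qed
  have fg: "f (g (t, x)) = \<beta> (1 - t, x)" if "(t, x) \<in> T" for t x
    using that 1(3)[of "1 - t" x] 1(7)[of x] A'(3)[of x] cube_boundary_subset[of n]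
    by (auto simp: T_def g_def)
  have R: "R x \<in> T" "R x \<in> {0..1::real} \<times> cube_set n" if "x \<in> cube_set n" for x
    using prism_retract(1-4)[of 1 x n] that
    by (cases "prism_retract n (1, x)"; force simp: R_def T_def)+
  have R1: "R z = (1, z)" if "z \<in> cube_boundary n" for z
    using prism_retract(5)[of 1 z n] that cube_boundary_subset by (auto simp: R_def)
  have cR: "continuous_on (cube_set n) R"
    unfolding R_def
    by (rule continuous_on_compose2[OF continuous_on_prism_retract]) (auto intro!: continuous_intros)
  \<comment> \<open>The straight line from \<open>R x\<close> to \<open>(1, x)\<close>, composed
    with \<open>\<beta>\<close> after the same reversal of time. Over the boundary
    \<open>R z = (1, z)\<close>, so the line is constant there.\<close>
  define L where "L = (\<lambda>(s, x). \<beta> ((1 - s) * (1 - fst (R x)), lerp s (snd (R x)) x))"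
  show thesis
  proof
    show "continuous_map (top_of_set (cube_set n)) X (\<lambda>x. g (R x))"
      by (rule continuous_map_top_of_set_compose[OF g cR]) (rule R)
    have c2: "continuous_on ({0..1::real} \<times> cube_set n) (\<lambda>p. R (snd p))"
      by (rule continuous_on_compose2[OF cR]) (auto intro!: continuous_intros)
    have "continuous_map (top_of_set ({0..1::real} \<times> cube_set n)) Y
        (\<lambda>p. \<beta> ((1 - fst p) * (1 - fst (R (snd p))), lerp (fst p) (snd (R (snd p))) (snd p)))"
    proof (rule continuous_map_top_of_set_compose[OF 1(2)])
      fix p :: "real \<times> (nat \<Rightarrow> real)" assume "p \<in> {0..1::real} \<times> cube_set n"
      moreover from this have "fst (R (snd p)) \<in> {0..1}" "snd (R (snd p)) \<in> cube_set n"
        using R(2)[of "snd p"] by (auto simp: mem_Times_iff)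
      ultimately show "((1 - fst p) * (1 - fst (R (snd p))), lerp (fst p) (snd (R (snd p))) (snd p))
          \<in> {0..1::real} \<times> cube_set n"
        by (auto intro!: lerp_in_cube_set mult_le_one)
    qed (intro continuous_intros c2)
    then show "continuous_map (top_of_set ({0..1::real} \<times> cube_set n)) Y L"
      by (simp add: L_def case_prod_unfold)
    show "g (R z) = a z" if "z \<in> cube_boundary n" for z
      using that 1(4) by (simp add: R1 g_def)
    show "L (0, x) = f (g (R x))" if "x \<in> cube_set n" for x
      using fg[of "fst (R x)" "snd (R x)"] R(1)[OF that] by (simp add: L_def)
    show "L (1, x) = b x" if "x \<in> cube_set n" for x
      using that 1(6) by (simp add: L_def)
    show "L (t, z) = b z" if "t \<in> {0..1}" "z \<in> cube_boundary n" for t z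
      using that 1(6) cube_boundary_subset by (auto simp: L_def R1)
  qed
qed

text \<open>The working criterion: the square may be deformed, boundary included, until it has a
  strict lift; homotopy extension then undoes the motion of the boundary.\<close>

lemma lifts_cubesI:
  assumes "\<And>a b. lift_square n X Y f a b \<Longrightarrow>
    \<exists>a' b'. homotopic_squares n X Y f a b a' b' \<and> liftable_square n X Y f a' b'"
  shows "lifts_cubes n X Y f"
  unfolding lifts_cubes_def
proof (intro allI impI)
  fix a b assume sq: "lift_square n X Y f a b"
  then obtain a' b' where "homotopic_squares n X Y f a b a' b'" "liftable_square n X Y f a' b'"
    using assms by blast
  from homotopic_square_lift[OF sq this] show "\<exists>A L. continuous_map (top_of_set (cube_set n)) X A \<and>
        continuous_map (top_of_set ({0..1::real} \<times> cube_set n)) Y L \<and>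
        (\<forall>z\<in>cube_boundary n. A z = a z) \<and>
        (\<forall>x\<in>cube_set n. L (0, x) = f (A x) \<and> L (1, x) = b x) \<and>
        (\<forall>t\<in>{0..1::real}. \<forall>z\<in>cube_boundary n. L (t, z) = b z)"
    by metis
qed

lemma lifts_cubesD:
  assumes "lifts_cubes n X Y f" "lift_square n X Y f a b"
  obtains A L where "continuous_map (top_of_set (cube_set n)) X A"
    "continuous_map (top_of_set ({0..1::real} \<times> cube_set n)) Y L"
    "\<And>z. z \<in> cube_boundary n \<Longrightarrow> A z = a z"
    "\<And>x. x \<in> cube_set n \<Longrightarrow> L (0, x) = f (A x)" "\<And>x. x \<in> cube_set n \<Longrightarrow> L (1, x) = b x"
    "\<And>t z. t \<in> {0..1::real} \<Longrightarrow> z \<in> cube_boundary n \<Longrightarrow> L (t, z) = b z"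
  by (insert assms(1)[unfolded lifts_cubes_def, rule_format, OF assms(2)])
    (elim exE conjE, rule that, assumption, assumption, auto)

text \<open>On the boundary of a grid cell the square commutes only up to the homotopy constructed
  over earlier cells. Here \<open>H\<close> is first absorbed into \<open>b\<close> by homotopy
  extension, which makes the square strict; the homotopy obtained is then reparametrised so that it
  induces exactly \<open>H\<close> on the boundary.\<close>

lemma lifts_cubes_homotopy:
  assumes lc: "lifts_cubes n X Y f" and f: "continuous_map X Y f"
    and a: "continuous_map (top_of_set (cube_boundary n)) X a"
    and b: "continuous_map (top_of_set (cube_set n)) Y b"
    and H: "continuous_map (top_of_set ({0..1::real} \<times> cube_boundary n)) Y H"
    and H0: "\<And>z. z \<in> cube_boundary n \<Longrightarrow> H (0, z) = f (a z)"
    and H1: "\<And>z. z \<in> cube_boundary n \<Longrightarrow> H (1, z) = b z"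
  obtains A G where "continuous_map (top_of_set (cube_set n)) X A"
    "continuous_map (top_of_set ({0..1::real} \<times> cube_set n)) Y G"
    "\<And>z. z \<in> cube_boundary n \<Longrightarrow> A z = a z"
    "\<And>x. x \<in> cube_set n \<Longrightarrow> G (0, x) = f (A x)" "\<And>x. x \<in> cube_set n \<Longrightarrow> G (1, x) = b x"
    "\<And>t z. t \<in> {0..1} \<Longrightarrow> z \<in> cube_boundary n \<Longrightarrow> G (t, z) = H (t, z)"
proof -
  have H': "continuous_map (top_of_set ({0..1::real} \<times> cube_boundary n)) Y (\<lambda>p. H (1 - fst p, snd p))"
    by (rule continuous_map_top_of_set_compose[OF H]) (auto intro!: continuous_intros)
  obtain K where K: "continuous_map (top_of_set ({0..1::real} \<times> cube_set n)) Y K"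
      "\<And>x. x \<in> cube_set n \<Longrightarrow> K (0, x) = b x"
      "\<And>t z. 0 \<le> t \<Longrightarrow> t \<le> 1 \<Longrightarrow> z \<in> cube_boundary n \<Longrightarrow> K (t, z) = H (1 - t, z)"
    using homotopy_extension[OF b H'] H1 by auto
  have "lift_square n X Y f a (\<lambda>x. K (1, x))"
    unfolding lift_square_def
  proof (intro conjI a ballI)
    show "continuous_map (top_of_set (cube_set n)) Y (\<lambda>x. K (1, x))"
      by (rule continuous_map_top_of_set_compose[OF K(1)]) (auto intro!: continuous_intros)
  qed (use H0 K(3)[of 1] in auto)
  from lifts_cubesD[OF lc this] obtain A L where A: "continuous_map (top_of_set (cube_set n)) X A"
    "continuous_map (top_of_set ({0..1::real} \<times> cube_set n)) Y L"
    "\<And>z. z \<in> cube_boundary n \<Longrightarrow> A z = a z"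
    "\<And>x. x \<in> cube_set n \<Longrightarrow> L (0, x) = f (A x)" "\<And>x. x \<in> cube_set n \<Longrightarrow> L (1, x) = K (1, x)"
    "\<And>t z. t \<in> {0..1::real} \<Longrightarrow> z \<in> cube_boundary n \<Longrightarrow> L (t, z) = K (1, z)"
    by metis
  \<comment> \<open>It leads from \<open>f \<circ> A\<close> to \<open>b\<close>, but on the
    boundary it rests at \<open>H (0, z)\<close> until time 1/2 and runs through \<open>H\<close>
    only afterwards.\<close>
  define M where "M = (\<lambda>p. if fst p \<le> 1/2 then L (2 * fst p, snd p) else K (1 - (2 * fst p - 1), snd p))"
  have K': "continuous_map (top_of_set ({0..1::real} \<times> cube_set n)) Y (\<lambda>p. K (1 - fst p, snd p))"
    by (rule continuous_map_top_of_set_compose[OF K(1)]) (auto intro!: continuous_intros)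
  have M: "continuous_map (top_of_set ({0..1::real} \<times> cube_set n)) Y M"
    unfolding M_def using continuous_map_time_concat[OF A(2) K'] A(5)
    by (simp only: fst_conv snd_conv) (simp add: A(5))
  define R where "R = (\<lambda>x. prism_retract n (1, x))"
  have R: "fst (R x) \<in> {0..1}" "snd (R x) \<in> cube_set n"
      "fst (R x) = 0 \<or> snd (R x) \<in> cube_boundary n" if "x \<in> cube_set n" for x
    using prism_retract(1-4)[of 1 x n] that by (auto simp: R_def)
  have R1: "R z = (1, z)" if "z \<in> cube_boundary n" for z
    using prism_retract(5)[of 1 z n] that cube_boundary_subset by (auto simp: R_def)
  have cR: "continuous_on (cube_set n) R"
    unfolding R_def
    by (rule continuous_on_compose2[OF continuous_on_prism_retract]) (auto intro!: continuous_intros)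
  \<comment> \<open>The path starts at height \<open>fst (R x) / 2\<close>. On the boundary this is
    1/2, so the resting half of \<open>M\<close> is skipped and \<open>H\<close> runs at its own
    speed. In general the start has height 0 or lies over the boundary, where \<open>L\<close> is
    independent of time; in both cases its value is \<open>f (A (snd (R x)))\<close>, so the lift
    becomes \<open>A\<close> after \<open>snd \<circ> R\<close>.\<close>
  define G where "G = (\<lambda>(t, x). M ((1 - t) * (fst (R x) / 2) + t * 1, lerp t (snd (R x)) x))"
  show thesis
  proof
    show "continuous_map (top_of_set (cube_set n)) X (\<lambda>x. A (snd (R x)))"
      by (rule continuous_map_top_of_set_compose[OF A(1)]) (auto intro!: continuous_intros cR R)
    have c2: "continuous_on ({0..1::real} \<times> cube_set n) (\<lambda>p. R (snd p))"
      by (rule continuous_on_compose2[OF cR]) (auto intro!: continuous_intros)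
    have "continuous_map (top_of_set ({0..1::real} \<times> cube_set n)) Y
        (\<lambda>p. M ((1 - fst p) * (fst (R (snd p)) / 2) + fst p * 1, lerp (fst p) (snd (R (snd p))) (snd p)))"
    proof (rule continuous_map_top_of_set_compose[OF M])
      fix p :: "real \<times> (nat \<Rightarrow> real)" assume p: "p \<in> {0..1::real} \<times> cube_set n"
      then have "fst (R (snd p)) \<in> {0..1}" "snd (R (snd p)) \<in> cube_set n"
        using R[of "snd p"] by (auto simp: mem_Times_iff)
      moreover from this p have "(1 - fst p) * (fst (R (snd p)) / 2) + fst p * 1 \<le> 1"
        by (intro convex_bound_le) auto
      ultimately show "((1 - fst p) * (fst (R (snd p)) / 2) + fst p * 1, lerp (fst p) (snd (R (snd p))) (snd p))
          \<in> {0..1::real} \<times> cube_set n"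
        using p by (auto intro!: lerp_in_cube_set)
    qed (auto intro!: continuous_intros c2)
    then show "continuous_map (top_of_set ({0..1::real} \<times> cube_set n)) Y G"
      by (simp add: G_def case_prod_unfold)
    show "A (snd (R z)) = a z" if "z \<in> cube_boundary n" for z
      using that A(3) by (simp add: R1)
    show "G (0, x) = f (A (snd (R x)))" if "x \<in> cube_set n" for x
    proof (cases "fst (R x) = 0")
      case True
      then show ?thesis using A(4) R(2)[OF that] by (simp add: G_def M_def)
    next
      case False
      then have z: "snd (R x) \<in> cube_boundary n" using R(3)[OF that] by simp
      have "G (0, x) = L (fst (R x), snd (R x))"
        using R(1)[OF that] by (simp add: G_def M_def)
      also have "\<dots> = K (1, snd (R x))" by (rule A(6)[OF R(1)[OF that] z])
      also have "\<dots> = f (A (snd (R x)))" using A(4)[OF R(2)[OF that]] A(6)[OF _ z, of 0] by simp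
      finally show ?thesis .
    qed
    show "G (1, x) = b x" if "x \<in> cube_set n" for x
      using that K(2) by (simp add: G_def M_def)
    show "G (t, z) = H (t, z)" if "t \<in> {0..1}" "z \<in> cube_boundary n" for t z
    proof (cases "t = 0")
      case True
      then show ?thesis using that A(6)[of 1 z] K(3)[of 1 z] by (simp add: G_def M_def R1)
    next
      case False
      have "G (t, z) = M ((1 - t) * (1 / 2) + t * 1, z)" using that by (simp add: G_def R1)
      also have "(1 - t) * (1 / 2) + t * 1 = (1 + t) / 2" by (simp add: field_simps)
      also have "M ((1 + t) / 2, z) = K (1 - t, z)" using that False by (simp add: M_def add_divide_distrib)
      finally have "G (t, z) = K (1 - t, z)" .
      then show ?thesis using that K(3)[of "1 - t" z] by simp
    qed
  qed
qed

lemma continuous_map_time_pair: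
  assumes "continuous_map (top_of_set S) W a"
  shows "continuous_map (top_of_set ({0..1::real} \<times> S)) (prod_topology (top_of_set {0..1}) W)
    (\<lambda>p. (fst p, a (snd p)))"
  unfolding continuous_map_paired
proof
  show "continuous_map (top_of_set ({0..1::real} \<times> S)) (top_of_set {0..1}) fst"
    by (auto intro!: continuous_intros)
  show "continuous_map (top_of_set ({0..1::real} \<times> S)) W (\<lambda>p. a (snd p))"
    by (rule continuous_map_top_of_set_compose[OF assms]) (auto intro!: continuous_intros)
qed

text \<open>\<open>r\<close> and \<open>r'\<close> carry a square for \<open>f\<close> to one for
  \<open>g\<close>, and \<open>s\<close> brings its lift back. The homotopies \<open>h\<close> and
  \<open>h'\<close> connect the given square with the one that has gone through \<open>g\<close>,
  and the homotopy belonging to the lift, carried over by \<open>s'\<close>, makes the latter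
  strictly liftable.\<close>

lemma lifts_cubes_homotopy_retract:
  assumes lc: "lifts_cubes n Z Z' g"
    and f: "continuous_map W W' f"
    and s: "continuous_map Z W s" "continuous_map Z' W' s'"
    and r: "continuous_map W Z r" "continuous_map W' Z' r'"
    and h: "continuous_map (prod_topology (top_of_set {0..1::real}) W) W h"
      "continuous_map (prod_topology (top_of_set {0..1::real}) W') W' h'"
    and fs: "\<And>z. z \<in> topspace Z \<Longrightarrow> f (s z) = s' (g z)"
    and gr: "\<And>w. w \<in> topspace W \<Longrightarrow> g (r w) = r' (f w)"
    and fh: "\<And>t w. t \<in> {0..1} \<Longrightarrow> w \<in> topspace W \<Longrightarrow> f (h (t, w)) = h' (t, f w)"
    and h0: "\<And>w. w \<in> topspace W \<Longrightarrow> h (0, w) = w" "\<And>w. w \<in> topspace W' \<Longrightarrow> h' (0, w) = w"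
    and h1: "\<And>w. w \<in> topspace W \<Longrightarrow> h (1, w) = s (r w)" "\<And>w. w \<in> topspace W' \<Longrightarrow> h' (1, w) = s' (r' w)"
  shows "lifts_cubes n W W' f"
proof (rule lifts_cubesI)
  fix a b assume "lift_square n W W' f a b"
  then have a: "continuous_map (top_of_set (cube_boundary n)) W a"
    and b: "continuous_map (top_of_set (cube_set n)) W' b"
    and ab: "\<And>z. z \<in> cube_boundary n \<Longrightarrow> f (a z) = b z"
    by (auto simp: lift_square_def)
  have aW: "a z \<in> topspace W" if "z \<in> cube_boundary n" for z
    using a that by (auto simp: continuous_map_def)
  have bW: "b z \<in> topspace W'" if "z \<in> cube_set n" for z
    using b that by (auto simp: continuous_map_def)
  have "lift_square n Z Z' g (\<lambda>z. r (a z)) (\<lambda>x. r' (b x))"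
    unfolding lift_square_def
    using continuous_map_compose[OF a r(1)] continuous_map_compose[OF b r(2)]
    by (auto simp: o_def gr aW ab)
  from lifts_cubesD[OF lc this] obtain A L where A: "continuous_map (top_of_set (cube_set n)) Z A"
    "continuous_map (top_of_set ({0..1::real} \<times> cube_set n)) Z' L"
    "\<And>z. z \<in> cube_boundary n \<Longrightarrow> A z = r (a z)"
    "\<And>x. x \<in> cube_set n \<Longrightarrow> L (0, x) = g (A x)" "\<And>x. x \<in> cube_set n \<Longrightarrow> L (1, x) = r' (b x)"
    "\<And>t z. t \<in> {0..1::real} \<Longrightarrow> z \<in> cube_boundary n \<Longrightarrow> L (t, z) = r' (b z)"
    by metis
  have AZ: "A x \<in> topspace Z" if "x \<in> cube_set n" for x
    using A(1) that by (auto simp: continuous_map_def)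
  let ?a = "\<lambda>z. s (r (a z))" and ?b = "\<lambda>x. s' (r' (b x))"
  have 1: "homotopic_squares n W W' f a b ?a ?b"
    unfolding homotopic_squares_def
  proof (intro exI conjI)
    from continuous_map_compose[OF continuous_map_time_pair[OF a] h(1)]
    show "continuous_map (top_of_set ({0..1::real} \<times> cube_boundary n)) W (\<lambda>p. h (fst p, a (snd p)))"
      by (simp add: o_def)
    from continuous_map_compose[OF continuous_map_time_pair[OF b] h(2)]
    show "continuous_map (top_of_set ({0..1::real} \<times> cube_set n)) W' (\<lambda>p. h' (fst p, b (snd p)))"
      by (simp add: o_def)
  qed (auto simp: fh aW bW ab h0 h1)
  have 2: "homotopic_squares n W W' f ?a ?b ?a (\<lambda>x. s' (g (A x)))"
    unfolding homotopic_squares_def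
  proof (intro exI conjI)
    have sra: "continuous_map (top_of_set (cube_boundary n)) W ?a"
      using continuous_map_compose[OF continuous_map_compose[OF a r(1)] s(1)] by (simp add: o_def)
    show "continuous_map (top_of_set ({0..1::real} \<times> cube_boundary n)) W (\<lambda>p. ?a (snd p))"
      by (rule continuous_map_top_of_set_compose[OF sra]) (auto intro!: continuous_intros)
    have "continuous_map (top_of_set ({0..1::real} \<times> cube_set n)) Z' (\<lambda>p. L (1 - fst p, snd p))"
      by (rule continuous_map_top_of_set_compose[OF A(2)]) (auto intro!: continuous_intros)
    from continuous_map_compose[OF this s(2)]
    show "continuous_map (top_of_set ({0..1::real} \<times> cube_set n)) W' (\<lambda>p. s' (L (1 - fst p, snd p)))"
      by (simp add: o_def)
    have "r (a z) \<in> topspace Z" if "z \<in> cube_boundary n" for z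
      using aW[OF that] r(1) by (auto simp: continuous_map_def)
    then show "\<forall>t\<in>{0..1}. \<forall>z\<in>cube_boundary n. f (?a (snd (t, z))) = s' (L (1 - fst (t, z), snd (t, z)))"
      by (auto simp: fs gr aW A(6) ab)
  qed (auto simp: A(4,5))
  have "liftable_square n W W' f ?a (\<lambda>x. s' (g (A x)))"
    unfolding liftable_square_def using continuous_map_compose[OF A(1) s(1)]
    by (intro exI[of _ "\<lambda>x. s (A x)"]) (auto simp: o_def A(3) fs AZ)
  then show "\<exists>a' b'. homotopic_squares n W W' f a b a' b' \<and> liftable_square n W W' f a' b'"
    using homotopic_squares_trans[OF 1 2] by blast
qed

section \<open>Grid cells of a cube\<close>

text \<open>The pair \<open>(v, S)\<close> stands for the cell of the grid of mesh \<open>1/N\<close> with lowest corner \<open>v / N\<close> that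
  extends in the directions in \<open>S\<close>.\<close>

definition grid_cells :: "nat \<Rightarrow> nat \<Rightarrow> ((nat \<Rightarrow> nat) \<times> nat set) set" where
  "grid_cells n N = {(v, S). S \<subseteq> {..<n} \<and> (\<forall>i<n. v i \<le> N) \<and> (\<forall>i\<in>S. v i < N) \<and> (\<forall>i\<ge>n. v i = 0)}"

definition grid_cell :: "nat \<Rightarrow> nat \<Rightarrow> (nat \<Rightarrow> nat) \<times> nat set \<Rightarrow> (nat \<Rightarrow> real) set" where
  "grid_cell n N e = {x \<in> cube_set n. \<forall>i<n. real (fst e i) \<le> real N * x i \<and>
     real N * x i \<le> real (fst e i) + (if i \<in> snd e then 1 else 0)}"

text \<open>The boundary relative to the dimension of the cell itself; it is empty for a vertex,
  where \<open>snd e\<close> is empty.\<close>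

definition grid_cell_boundary :: "nat \<Rightarrow> nat \<Rightarrow> (nat \<Rightarrow> nat) \<times> nat set \<Rightarrow> (nat \<Rightarrow> real) set" where
  "grid_cell_boundary n N e = {x \<in> grid_cell n N e. \<exists>i\<in>snd e.
     real N * x i = real (fst e i) \<or> real N * x i = real (fst e i) + 1}"

lemma finite_grid_cells: "finite (grid_cells n N)"
proof (rule finite_subset)
  show "grid_cells n N \<subseteq> {v. \<forall>i. (i \<in> {..<n} \<longrightarrow> v i \<in> {..N}) \<and> (i \<notin> {..<n} \<longrightarrow> v i = 0)} \<times> Pow {..<n}"
    by (auto simp: grid_cells_def)
  show "finite ({v. \<forall>i. (i \<in> {..<n} \<longrightarrow> v i \<in> {..N}) \<and> (i \<notin> {..<n} \<longrightarrow> v i = 0)} \<times> Pow {..<n})"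
    by (intro finite_cartesian_product finite_set_of_finite_funs) auto
qed

lemma grid_cell_subset: "grid_cell n N e \<subseteq> cube_set n"
  by (auto simp: grid_cell_def)

lemma closed_grid_cell: "closed (grid_cell n N e)"
proof -
  have "grid_cell n N e = cube_set n \<inter> (\<Inter>i\<in>{..<n}. {x. real (fst e i) \<le> real N * x i} \<inter>
     {x. real N * x i \<le> real (fst e i) + (if i \<in> snd e then 1 else 0)})"
    unfolding set_eq_iff grid_cell_def INT_iff Int_iff mem_Collect_eq lessThan_iff Ball_def by blast
  moreover have "closed \<dots>"
    by (intro closed_Int closed_INT ballI closed_Collect_le closed_cube_set continuous_on_mult
        continuous_on_const continuous_on_product_coordinates)
  ultimately show ?thesis by simp
qed

text \<open>In a direction in which the cell does not extend, the coordinate is constant on it; were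
  it 0 or 1, the whole cell would lie in the boundary of the cube. So a boundary point has its
  extreme coordinate in a direction of the cell, where 0 and 1 can only be ends of the cell's
  interval.\<close>

lemma grid_cell_Int_cube_boundary:
  assumes e: "e \<in> grid_cells n N" and N: "N \<ge> 1" and nb: "\<not> grid_cell n N e \<subseteq> cube_boundary n"
  shows "grid_cell n N e \<inter> cube_boundary n \<subseteq> grid_cell_boundary n N e"
proof
  fix x assume x: "x \<in> grid_cell n N e \<inter> cube_boundary n"
  then obtain i where i: "i < n" "x i = 0 \<or> x i = 1" by (auto simp: cube_boundary_iff)
  obtain v S where e': "e = (v, S)" by (cases e)
  have vx: "real (v i) \<le> real N * x i" "real N * x i \<le> real (v i) + (if i \<in> S then 1 else 0)"
    using x i by (auto simp: grid_cell_def e')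
  have iS: "i \<in> S"
  proof (rule ccontr)
    assume "i \<notin> S"
    with vx have "real (v i) = real N * x i" by simp
    then have v: "v i = 0 \<or> v i = N" using i by auto
    have "y i = 0 \<or> y i = 1" if "y \<in> grid_cell n N e" for y
    proof -
      have "real N * y i = real (v i)" using that i \<open>i \<notin> S\<close> by (force simp: grid_cell_def e')
      with v N show ?thesis by auto
    qed
    then have "grid_cell n N e \<subseteq> cube_boundary n"
      using i grid_cell_subset[of n N e] unfolding cube_boundary_iff subset_iff by blast
    with nb show False by blast
  qed
  then have "v i < N" using e by (auto simp: grid_cells_def e')
  then have "real (v i) + 1 \<le> real N" by simp
  with i vx iS have "real N * x i = real (v i) \<or> real N * x i = real (v i) + 1" by auto
  then show "x \<in> grid_cell_boundary n N e"
    using x iS by (auto simp: grid_cell_boundary_def e')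
qed

text \<open>A point of \<open>e\<close> off its relative boundary lies strictly between consecutive
  grid values in all directions of \<open>e\<close>. Any cell through it must extend in these
  directions from the same corner, and the bound on the dimension leaves no further
  direction.\<close>

lemma grid_cell_Int_grid_cell:
  assumes e: "e \<in> grid_cells n N" "e' \<in> grid_cells n N" and ne: "e \<noteq> e'"
    and card: "card (snd e') \<le> card (snd e)"
  shows "grid_cell n N e \<inter> grid_cell n N e' \<subseteq> grid_cell_boundary n N e"
proof
  fix x assume x: "x \<in> grid_cell n N e \<inter> grid_cell n N e'"
  obtain v S w T where vw: "e = (v, S)" "e' = (w, T)" by (cases e, cases e')
  have S: "S \<subseteq> {..<n}" "T \<subseteq> {..<n}" using e by (auto simp: grid_cells_def vw)
  have xv: "real (v i) \<le> real N * x i" "real N * x i \<le> real (v i) + (if i \<in> S then 1 else 0)" if "i < n" for i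
    using x that by (auto simp: grid_cell_def vw)
  have xw: "real (w i) \<le> real N * x i" "real N * x i \<le> real (w i) + (if i \<in> T then 1 else 0)" if "i < n" for i
    using x that by (auto simp: grid_cell_def vw)
  show "x \<in> grid_cell_boundary n N e"
  proof (rule ccontr)
    assume nb: "x \<notin> grid_cell_boundary n N e"
    have st: "real (v i) < real N * x i" "real N * x i < real (v i) + 1" if "i \<in> S" for i
      using nb x that xv[of i] S by (force simp: grid_cell_boundary_def vw less_le)+
    have vwS: "w i = v i \<and> i \<in> T" if "i \<in> S" for i
    proof -
      have i: "i < n" using that S by auto
      have "real (w i) < real (v i + 1)" using st[OF that] xw[OF i] by simp
      then have 1: "w i \<le> v i" by simp
      have "real (v i) < real (w i) + (if i \<in> T then 1 else 0)" using st[OF that] xw[OF i] by linarith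
      then have "v i < w i + (if i \<in> T then 1 else 0)" by (auto split: if_splits)
      with 1 show ?thesis by (auto split: if_splits)
    qed
    then have "S \<subseteq> T" by blast
    with card S have "S = T" by (metis card_seteq finite_lessThan finite_subset snd_conv vw)
    have "v i = w i" for i
    proof (cases "i < n \<and> i \<notin> S")
      case True
      then show ?thesis using xv[of i] xw[of i] \<open>S = T\<close> by auto
    next
      case False
      then show ?thesis using vwS[of i] e by (cases "i < n") (auto simp: grid_cells_def vw)
    qed
    then have "v = w" by blast
    with \<open>S = T\<close> ne show False by (simp add: vw)
  qed
qed

lemma grid_cell_face:
  assumes e: "e \<in> grid_cells n N" and x: "x \<in> grid_cell_boundary n N e"
  shows "\<exists>e'\<in>grid_cells n N. card (snd e') < card (snd e) \<and> x \<in> grid_cell n N e' \<and>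
    grid_cell n N e' \<subseteq> grid_cell n N e"
proof -
  obtain v S where vS: "e = (v, S)" by (cases e)
  have S: "S \<subseteq> {..<n}" "finite S" using e by (auto simp: grid_cells_def vS intro: finite_subset)
  obtain i where i: "i \<in> S" "real N * x i = real (v i) \<or> real N * x i = real (v i) + 1"
    using x by (auto simp: grid_cell_boundary_def vS)
  \<comment> \<open>The facet at the lower or at the upper end of direction \<open>i\<close>,
    whichever contains \<open>x\<close>. Its corner is still a grid point because
    \<open>v i < N\<close> in the directions of a cell.\<close>
  define w where "w = (if real N * x i = real (v i) then v else v(i := v i + 1))"
  have wi: "real N * x i = real (w i)" "w j = v j \<or> j = i" "v i \<le> w i" "w i \<le> v i + 1" for j
    using i by (auto simp: w_def)
  have "(w, S - {i}) \<in> grid_cells n N"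
  proof -
    have v: "\<forall>j<n. v j \<le> N" "\<forall>j\<in>S. v j < N" "\<forall>j\<ge>n. v j = 0"
      using e by (auto simp: grid_cells_def vS)
    have "w j \<le> N" if "j < n" for j
      using v(1,2) that wi(2)[of j] wi(4) i(1) by (metis Suc_eq_plus1 Suc_leI le_trans)
    moreover have "w j < N" if "j \<in> S - {i}" for j using v(2) that wi(2)[of j] by auto
    moreover have "w j = 0" if "j \<ge> n" for j using v(3) that wi(2)[of j] i(1) S(1) by auto
    ultimately show ?thesis using S(1) by (auto simp add: grid_cells_def)
  qed
  moreover have "card (S - {i}) < card S" by (rule card_Diff1_less[OF S(2) i(1)])
  moreover have "x \<in> grid_cell n N (w, S - {i})"
  proof -
    have "real (w j) \<le> real N * x j \<and> real N * x j \<le> real (w j) + (if j \<in> S - {i} then 1 else 0)"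
      if "j < n" for j
    proof (cases "j = i")
      case False
      then have "w j = v j" using wi(2)[of j] by simp
      then show ?thesis using x that False by (simp add: grid_cell_boundary_def grid_cell_def vS)
    qed (simp add: wi(1))
    then show ?thesis using x by (simp add: grid_cell_boundary_def grid_cell_def)
  qed
  moreover have "grid_cell n N (w, S - {i}) \<subseteq> grid_cell n N (v, S)"
  proof
    fix y assume y: "y \<in> grid_cell n N (w, S - {i})"
    have yw: "real (w j) \<le> real N * y j \<and> real N * y j \<le> real (w j) + (if j \<in> S - {i} then 1 else 0)"
      if "j < n" for j
      using y that unfolding grid_cell_def by (simp only: mem_Collect_eq fst_conv snd_conv)
    have "real (v j) \<le> real N * y j \<and> real N * y j \<le> real (v j) + (if j \<in> S then 1 else 0)" if "j < n" for j
      using yw[OF that] wi(2)[of j] wi(3,4) i(1) by (cases "j = i") auto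
    then show "y \<in> grid_cell n N (v, S)" using y by (auto simp: grid_cell_def)
  qed
  ultimately show ?thesis unfolding vS by (intro bexI[of _ "(w, S - {i})"]) auto
qed

lemma grid_cell_subset_top:
  assumes e: "e \<in> grid_cells n N" and N: "N \<ge> 1"
  shows "\<exists>v. (v, {..<n}) \<in> grid_cells n N \<and> grid_cell n N e \<subseteq> grid_cell n N (v, {..<n})"
proof -
  obtain v S where vS: "e = (v, S)" by (cases e)
  \<comment> \<open>A corner coordinate equal to \<open>N\<close> has no interval above it; the
    interval starting at \<open>N - 1\<close> contains it as its upper end.\<close>
  define w where "w = (\<lambda>i. if i < n then min (v i) (N - 1) else 0)"
  have "(w, {..<n}) \<in> grid_cells n N" using N by (auto simp: grid_cells_def w_def)
  moreover have "x \<in> grid_cell n N (w, {..<n})" if x: "x \<in> grid_cell n N e" for x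
  proof -
    have "real (w i) \<le> real N * x i \<and> real N * x i \<le> real (w i) + 1" if i: "i < n" for i
    proof (cases "v i < N")
      case True
      then have "w i = v i" using i by (auto simp: w_def)
      then show ?thesis using x i by (auto simp: grid_cell_def vS split: if_splits)
    next
      case False
      then have v: "v i = N" "i \<notin> S" using e i by (auto simp: grid_cells_def vS)
      then have "real N * x i = real N" using x i by (force simp: grid_cell_def vS)
      moreover have "real (w i) + 1 = real N" using v i N by (simp add: w_def)
      ultimately show ?thesis by simp
    qed
    with x show ?thesis by (auto simp: grid_cell_def)
  qed
  ultimately show ?thesis by blast
qed

lemma Union_grid_cells:
  assumes N: "N \<ge> 1" shows "\<Union>(grid_cell n N ` grid_cells n N) = cube_set n"
proof
  show "\<Union>(grid_cell n N ` grid_cells n N) \<subseteq> cube_set n" using grid_cell_subset by blast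
  show "cube_set n \<subseteq> \<Union>(grid_cell n N ` grid_cells n N)"
  proof
    fix x assume x: "x \<in> cube_set n"
    define v where "v = (\<lambda>i. if i < n then nat \<lfloor>real N * x i\<rfloor> else 0)"
    \<comment> \<open>The directions in which \<open>x\<close> is off the grid, so that
      \<open>x\<close> is interior to the cell found. A coordinate equal to 1 has floor
      \<open>N\<close> and is not among them.\<close>
    define S where "S = {i. i < n \<and> real (v i) < real N * x i}"
    have v: "real (v i) \<le> real N * x i" "real N * x i < real (v i) + 1" "real N * x i \<le> real N" if "i < n" for i
      using x that N by (auto simp: v_def in_cube_set mult_left_le of_nat_nat)
    have "v i \<le> N" if "i < n" for i using v[OF that] by linarith
    moreover have "v i < N" if "i \<in> S" for i using v[of i] that by (auto simp: S_def)
    ultimately have "(v, S) \<in> grid_cells n N" by (auto simp: grid_cells_def S_def v_def)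
    moreover have "x \<in> grid_cell n N (v, S)"
      using x v by (fastforce simp: grid_cell_def S_def)
    ultimately show "x \<in> \<Union>(grid_cell n N ` grid_cells n N)" by blast
  qed
qed

lemma continuous_on_eval: "continuous_on T (\<lambda>x :: 'a \<Rightarrow> 'b::topological_space. x i)"
  by (rule continuous_on_subset[OF continuous_on_product_coordinates]) simp

lemma grid_cell_homeomorphism:
  assumes e: "e \<in> grid_cells n N" and N: "N \<ge> 1"
  obtains \<phi> \<psi> where "continuous_on (cube_set (card (snd e))) \<phi>" "continuous_on (grid_cell n N e) \<psi>"
    "\<And>s. s \<in> cube_set (card (snd e)) \<Longrightarrow> \<phi> s \<in> grid_cell n N e"
    "\<And>x. x \<in> grid_cell n N e \<Longrightarrow> \<psi> x \<in> cube_set (card (snd e))"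
    "\<And>s. s \<in> cube_set (card (snd e)) \<Longrightarrow> \<psi> (\<phi> s) = s"
    "\<And>x. x \<in> grid_cell n N e \<Longrightarrow> \<phi> (\<psi> x) = x"
    "\<And>x. x \<in> grid_cell n N e \<Longrightarrow> \<psi> x \<in> cube_boundary (card (snd e)) \<longleftrightarrow> x \<in> grid_cell_boundary n N e"
proof -
  obtain v S where vS: "e = (v, S)" by (cases e)
  define k where "k = card S"
  have S: "S \<subseteq> {..<n}" "finite S" using e by (auto simp: grid_cells_def vS intro: finite_subset)
  have vN: "v i \<le> N" "i \<in> S \<Longrightarrow> v i + 1 \<le> N" if "i < n" for i
    using e that by (auto simp: grid_cells_def vS Suc_le_eq)
  \<comment> \<open>An enumeration of the directions of the cell identifies it with the standard
    cube of that dimension; the other coordinates are constantly \<open>v i / N\<close>.\<close>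
  obtain \<sigma> where \<sigma>: "bij_betw \<sigma> {..<k} S"
    using S(2) ex_bij_betw_nat_finite unfolding k_def atLeast0LessThan by blast
  define \<tau> where "\<tau> = inv_into {..<k} \<sigma>"
  have \<sigma>S: "\<sigma> j \<in> S" "\<tau> (\<sigma> j) = j" if "j < k" for j
    using \<sigma> that by (auto simp: \<tau>_def bij_betw_def)
  have \<tau>k: "\<tau> i < k" "\<sigma> (\<tau> i) = i" if "i \<in> S" for i
    using \<sigma> that unfolding \<tau>_def
    by (metis bij_betw_def inv_into_into lessThan_iff, metis bij_betw_inv_into_right)
  define \<phi> where "\<phi> s = (\<lambda>i. if i \<in> S then (real (v i) + s (\<tau> i)) / real N
      else if i < n then real (v i) / real N else undefined)" for s :: "nat \<Rightarrow> real"
  define \<psi> where "\<psi> x = (\<lambda>j. if j < k then real N * x (\<sigma> j) - real (v (\<sigma> j)) else undefined)"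
    for x :: "nat \<Rightarrow> real"
  have N0: "real N > 0" using N by simp
  have cell: "x \<in> grid_cell n N e \<longleftrightarrow> x \<in> cube_set n \<and> (\<forall>i<n. real (v i) \<le> real N * x i \<and>
     real N * x i \<le> real (v i) + (if i \<in> S then 1 else 0))" for x
    by (simp add: grid_cell_def vS)
  have \<phi>c: "\<phi> s \<in> grid_cell n N e" if s: "s \<in> cube_set k" for s
    unfolding cell in_cube_set
  proof (intro conjI allI impI)
    fix i assume i: "i < n"
    have s01: "0 \<le> s (\<tau> i)" "s (\<tau> i) \<le> 1" if "i \<in> S" using s \<tau>k[OF that] by (auto simp: in_cube_set)
    have le: "real (v i) \<le> real N" "i \<in> S \<Longrightarrow> real (v i) + 1 \<le> real N" using vN[OF i] by linarith+
    show "0 \<le> \<phi> s i" "\<phi> s i \<le> 1" "real (v i) \<le> real N * \<phi> s i"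
      "real N * \<phi> s i \<le> real (v i) + (if i \<in> S then 1 else 0)"
      using i N0 s01 le by (auto simp: \<phi>_def divide_simps)
  qed (use S in \<open>auto simp: \<phi>_def\<close>)
  have \<psi>c: "\<psi> x \<in> cube_set k" if x: "x \<in> grid_cell n N e" for x
    unfolding in_cube_set
  proof (intro conjI allI impI)
    fix j assume j: "j < k"
    then have "\<sigma> j < n" using \<sigma>S S by auto
    then show "0 \<le> \<psi> x j" "\<psi> x j \<le> 1"
      using x \<sigma>S(1)[OF j] j unfolding cell by (auto simp: \<psi>_def)
  qed (auto simp: \<psi>_def)
  have \<psi>\<phi>: "\<psi> (\<phi> s) = s" if s: "s \<in> cube_set k" for s
    using s \<sigma>S N0 by (auto simp: \<psi>_def \<phi>_def in_cube_set)
  have \<phi>\<psi>: "\<phi> (\<psi> x) = x" if x: "x \<in> grid_cell n N e" for x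
  proof
    fix i
    consider "i \<in> S" | "i \<notin> S" "i < n" | "i \<ge> n" by linarith
    then show "\<phi> (\<psi> x) i = x i"
    proof cases
      case 1
      then show ?thesis using \<tau>k[OF 1] N0 by (simp add: \<phi>_def \<psi>_def)
    next
      case 2
      then have "real N * x i = real (v i)" using x unfolding cell by force
      then show ?thesis using 2 N0 by (simp add: \<phi>_def field_simps)
    next
      case 3
      then show ?thesis using S x unfolding cell by (auto simp: \<phi>_def in_cube_set)
    qed
  qed
  have bd: "\<psi> x \<in> cube_boundary k \<longleftrightarrow> x \<in> grid_cell_boundary n N e" if x: "x \<in> grid_cell n N e" for x
  proof -
    have "(\<exists>j<k. \<psi> x j = 0 \<or> \<psi> x j = 1) \<longleftrightarrow>
        (\<exists>j<k. real N * x (\<sigma> j) = real (v (\<sigma> j)) \<or> real N * x (\<sigma> j) = real (v (\<sigma> j)) + 1)"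
      by (auto simp: \<psi>_def algebra_simps)
    also have "\<dots> \<longleftrightarrow> (\<exists>i\<in>S. real N * x i = real (v i) \<or> real N * x i = real (v i) + 1)"
      using \<sigma>S \<tau>k by metis
    finally show ?thesis using x \<psi>c[OF x] by (simp add: cube_boundary_iff grid_cell_boundary_def vS)
  qed
  have "continuous_on T \<phi>" for T
  proof (rule continuous_on_coordinatewise_then_product)
    show "continuous_on T (\<lambda>s. \<phi> s i)" for i
      unfolding \<phi>_def using N0
      by (cases "i \<in> S"; cases "i < n") (auto intro!: continuous_intros continuous_on_eval)
  qed
  moreover have "continuous_on T \<psi>" for T
  proof (rule continuous_on_coordinatewise_then_product)
    show "continuous_on T (\<lambda>x. \<psi> x j)" for j
      unfolding \<psi>_def by (cases "j < k") (auto intro!: continuous_intros continuous_on_eval)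
  qed
  ultimately show thesis
    using that[of \<phi> \<psi>] \<phi>c \<psi>c \<psi>\<phi> \<phi>\<psi> bd by (simp add: vS k_def)
qed

text \<open>The distance in \<open>nat \<Rightarrow> real\<close> is the sum of the coordinate
  distances, capped at 1, with weights \<open>(1 / 2) ^ m\<close>. Each coordinate contributes at
  most its weight divided by \<open>N\<close>, and the weights add up to 2, whatever
  \<open>n\<close> is.\<close>

lemma dist_grid_cell:
  assumes "x \<in> grid_cell n N e" "y \<in> grid_cell n N e" and N: "N \<ge> 1"
  shows "dist x y \<le> 2 / real N"
proof -
  have c: "dist (x i) (y i) \<le> 1 / real N" for i
  proof (cases "i < n")
    case True
    then have "real (fst e i) \<le> real N * x i" "real N * x i \<le> real (fst e i) + 1"
        "real (fst e i) \<le> real N * y i" "real N * y i \<le> real (fst e i) + 1"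
      using assms(1,2) by (auto simp: grid_cell_def split: if_splits)
    then have "real N * x i - real N * y i \<le> 1" "real N * y i - real N * x i \<le> 1" by linarith+
    then have "real N * dist (x i) (y i) \<le> 1" by (auto simp: dist_real_def abs_if algebra_simps)
    then show ?thesis using N by (simp add: field_simps)
  next
    case False
    then show ?thesis using assms by (simp add: grid_cell_def in_cube_set)
  qed
  have s2: "summable (\<lambda>m. (1 / 2) ^ m * (1 / real N) :: real)"
    by (intro summable_mult2 summable_geometric) simp
  have le: "(1 / 2) ^ m * min (dist (x (from_nat m)) (y (from_nat m))) 1 \<le> (1 / 2) ^ m * (1 / real N)" for m
    using c[of "from_nat m"] by (intro mult_left_mono) auto
  have s1: "summable (\<lambda>m. (1 / 2) ^ m * min (dist (x (from_nat m)) (y (from_nat m))) 1 :: real)"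
    by (rule summable_comparison_test'[OF s2, of 0]) (use le in auto)
  have "dist x y \<le> suminf (\<lambda>m. (1 / 2) ^ m * (1 / real N))"
    unfolding dist_fun_def by (rule suminf_le[OF le s1 s2])
  also have "\<dots> = 2 / real N"
    by (subst suminf_mult2[symmetric]) (auto simp: suminf_geometric)
  finally show ?thesis .
qed

section \<open>Lifting along an open cover\<close>

text \<open>Transports \<open>lifts_cubes_homotopy\<close> along a homeomorphism of pairs, so that
  it applies to a grid cell and its relative boundary in place.\<close>

lemma lifts_cubes_pair:
  fixes \<phi> :: "(nat \<Rightarrow> real) \<Rightarrow> (nat \<Rightarrow> real)"
  assumes lc: "lifts_cubes k X Y f" and f: "continuous_map X Y f"
    and \<phi>: "continuous_on (cube_set k) \<phi>" "\<And>s. s \<in> cube_set k \<Longrightarrow> \<phi> s \<in> K"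
    and \<psi>: "continuous_on K \<psi>" "\<And>x. x \<in> K \<Longrightarrow> \<psi> x \<in> cube_set k"
    and \<psi>\<phi>: "\<And>s. s \<in> cube_set k \<Longrightarrow> \<psi> (\<phi> s) = s" and \<phi>\<psi>: "\<And>x. x \<in> K \<Longrightarrow> \<phi> (\<psi> x) = x"
    and bd: "\<And>x. x \<in> K \<Longrightarrow> \<psi> x \<in> cube_boundary k \<longleftrightarrow> x \<in> L" and LK: "L \<subseteq> K"
    and a: "continuous_map (top_of_set L) X a" and b: "continuous_map (top_of_set K) Y b"
    and H: "continuous_map (top_of_set ({0..1::real} \<times> L)) Y H"
    and H0: "\<And>z. z \<in> L \<Longrightarrow> H (0, z) = f (a z)" and H1: "\<And>z. z \<in> L \<Longrightarrow> H (1, z) = b z"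
  obtains A G where "continuous_map (top_of_set K) X A"
    "continuous_map (top_of_set ({0..1::real} \<times> K)) Y G"
    "\<And>z. z \<in> L \<Longrightarrow> A z = a z"
    "\<And>x. x \<in> K \<Longrightarrow> G (0, x) = f (A x)" "\<And>x. x \<in> K \<Longrightarrow> G (1, x) = b x"
    "\<And>t z. t \<in> {0..1} \<Longrightarrow> z \<in> L \<Longrightarrow> G (t, z) = H (t, z)"
proof -
  have \<phi>L: "\<phi> s \<in> L" if "s \<in> cube_boundary k" for s
  proof -
    have "s \<in> cube_set k" using that cube_boundary_subset by blast
    then show ?thesis using bd[OF \<phi>(2)] \<psi>\<phi> that by simp
  qed
  have \<psi>L: "\<psi> x \<in> cube_boundary k" "x \<in> K" if "x \<in> L" for x using that bd LK by auto
  have c\<phi>: "continuous_on (cube_boundary k) \<phi>"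
    using \<phi>(1) cube_boundary_subset by (rule continuous_on_subset)
  have c\<phi>': "continuous_on ({0..1::real} \<times> cube_boundary k) (\<lambda>p. (fst p, \<phi> (snd p)))"
    by (intro continuous_on_Pair continuous_on_fst continuous_on_id continuous_on_compose2[OF c\<phi>]
        continuous_on_snd) auto
  have c\<psi>': "continuous_on ({0..1::real} \<times> K) (\<lambda>p. (fst p, \<psi> (snd p)))"
    by (intro continuous_on_Pair continuous_on_fst continuous_on_id continuous_on_compose2[OF \<psi>(1)]
        continuous_on_snd) auto
  obtain A G where AG: "continuous_map (top_of_set (cube_set k)) X A"
    "continuous_map (top_of_set ({0..1::real} \<times> cube_set k)) Y G"
    "\<And>z. z \<in> cube_boundary k \<Longrightarrow> A z = a (\<phi> z)"
    "\<And>x. x \<in> cube_set k \<Longrightarrow> G (0, x) = f (A x)" "\<And>x. x \<in> cube_set k \<Longrightarrow> G (1, x) = b (\<phi> x)"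
    "\<And>t z. t \<in> {0..1} \<Longrightarrow> z \<in> cube_boundary k \<Longrightarrow> G (t, z) = H (t, \<phi> z)"
  proof (rule lifts_cubes_homotopy[OF lc f, of "\<lambda>s. a (\<phi> s)" "\<lambda>s. b (\<phi> s)" "\<lambda>p. H (fst p, \<phi> (snd p))"])
    show "continuous_map (top_of_set (cube_boundary k)) X (\<lambda>s. a (\<phi> s))"
      by (rule continuous_map_top_of_set_compose[OF a c\<phi> \<phi>L])
    show "continuous_map (top_of_set (cube_set k)) Y (\<lambda>s. b (\<phi> s))"
      by (rule continuous_map_top_of_set_compose[OF b \<phi>])
    show "continuous_map (top_of_set ({0..1::real} \<times> cube_boundary k)) Y (\<lambda>p. H (fst p, \<phi> (snd p)))"
      by (rule continuous_map_top_of_set_compose[OF H c\<phi>']) (auto simp: \<phi>L)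
  qed (use H0 H1 \<phi>L in auto)
  show thesis
  proof
    show "continuous_map (top_of_set K) X (\<lambda>x. A (\<psi> x))"
      by (rule continuous_map_top_of_set_compose[OF AG(1) \<psi>])
    show "continuous_map (top_of_set ({0..1::real} \<times> K)) Y (\<lambda>p. G (fst p, \<psi> (snd p)))"
      by (rule continuous_map_top_of_set_compose[OF AG(2) c\<psi>']) (auto simp: \<psi>)
  qed (use AG \<psi> \<psi>L \<phi>\<psi> LK in auto)
qed

text \<open>A lift up to homotopy over the part of the grid treated so far. The last clause keeps
  the homotopy over a face in the open set of that face, hence in that of every larger cell when
  \<open>V\<close> shrinks on faces; otherwise the data on the boundary of the next cell could leave
  the set over which that cell is to be lifted.\<close>

definition grid_lift :: "nat \<Rightarrow> nat \<Rightarrow> 'a topology \<Rightarrow> 'b topology \<Rightarrow> ('a \<Rightarrow> 'b) \<Rightarrow>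
    ((nat \<Rightarrow> real) \<Rightarrow> 'a) \<Rightarrow> ((nat \<Rightarrow> real) \<Rightarrow> 'b) \<Rightarrow> ((nat \<Rightarrow> nat) \<times> nat set \<Rightarrow> 'b set) \<Rightarrow>
    ((nat \<Rightarrow> nat) \<times> nat set) set \<Rightarrow>
    ((nat \<Rightarrow> real) \<Rightarrow> 'a) \<Rightarrow> (real \<times> (nat \<Rightarrow> real) \<Rightarrow> 'b) \<Rightarrow> bool" where
  "grid_lift n N X Y f a b V C A G \<longleftrightarrow>
     continuous_map (top_of_set (cube_boundary n \<union> \<Union>(grid_cell n N ` C))) X A \<and>
     continuous_map (top_of_set ({0..1::real} \<times> (cube_boundary n \<union> \<Union>(grid_cell n N ` C)))) Y G \<and>
     (\<forall>x\<in>cube_boundary n \<union> \<Union>(grid_cell n N ` C). G (0, x) = f (A x) \<and> G (1, x) = b x) \<and>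
     (\<forall>z\<in>cube_boundary n. A z = a z \<and> (\<forall>t\<in>{0..1}. G (t, z) = b z)) \<and>
     (\<forall>e\<in>C. \<forall>x\<in>grid_cell n N e. \<forall>t\<in>{0..1}. G (t, x) \<in> V e)"

text \<open>Unless it lies in the boundary of the cube, a new cell of largest dimension meets the
  part already treated exactly in its relative boundary. There \<open>A\<close> and \<open>G\<close>
  are data as in \<open>lifts_cubes_homotopy\<close>, and the extension over the cell agrees with
  them, so everything pastes along closed sets.\<close>

lemma grid_lift_insert:
  assumes f: "continuous_map X Y f" and b: "continuous_map (top_of_set (cube_set n)) Y b"
    and N: "N \<ge> 1" and C: "C \<subseteq> grid_cells n N" and e: "e \<in> grid_cells n N"
    and bV: "\<And>x. x \<in> grid_cell n N e \<Longrightarrow> b x \<in> V e"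
    and mono: "\<And>e'. e' \<in> C \<Longrightarrow> grid_cell n N e' \<subseteq> grid_cell n N e \<Longrightarrow> V e' \<subseteq> V e"
    and lc: "\<And>k. lifts_cubes k (subtopology X {x. f x \<in> V e}) (subtopology Y (V e)) f"
    and e_max: "e \<notin> C" "\<And>e'. e' \<in> C \<Longrightarrow> card (snd e') \<le> card (snd e)"
    and face: "\<And>x. x \<in> grid_cell_boundary n N e \<Longrightarrow>
      \<exists>e'\<in>C. x \<in> grid_cell n N e' \<and> grid_cell n N e' \<subseteq> grid_cell n N e"
    and AG: "grid_lift n N X Y f a b V C A G"
  shows "\<exists>A G. grid_lift n N X Y f a b V (insert e C) A G"
proof (cases "grid_cell n N e \<subseteq> cube_boundary n")
  \<comment> \<open>Nothing has to be lifted: on the boundary of the cube \<open>G\<close> rests at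
    \<open>b\<close>, which maps the cell to \<open>V e\<close>.\<close>
  case True
  then have "cube_boundary n \<union> \<Union>(grid_cell n N ` insert e C) = cube_boundary n \<union> \<Union>(grid_cell n N ` C)"
    by auto
  moreover have "G (t, x) \<in> V e" if "t \<in> {0..1}" "x \<in> grid_cell n N e" for t x
    using AG True that bV unfolding grid_lift_def by (metis subsetD)
  ultimately show ?thesis
    using AG unfolding grid_lift_def by (intro exI[of _ A] exI[of _ G]) simp
next
  case nb: False
  define K where "K = cube_boundary n \<union> \<Union>(grid_cell n N ` C)"
  define B where "B = grid_cell_boundary n N e"
  define E where "E = grid_cell n N e"
  have A: "continuous_map (top_of_set K) X A" "continuous_map (top_of_set ({0..1::real} \<times> K)) Y G"
      "\<And>x. x \<in> K \<Longrightarrow> G (0, x) = f (A x)" "\<And>x. x \<in> K \<Longrightarrow> G (1, x) = b x"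
      "\<And>z. z \<in> cube_boundary n \<Longrightarrow> A z = a z"
      "\<And>t z. t \<in> {0..1} \<Longrightarrow> z \<in> cube_boundary n \<Longrightarrow> G (t, z) = b z"
      "\<And>e t x. e \<in> C \<Longrightarrow> x \<in> grid_cell n N e \<Longrightarrow> t \<in> {0..1} \<Longrightarrow> G (t, x) \<in> V e"
    using AG unfolding grid_lift_def K_def[symmetric] by blast+
  have BE: "B \<subseteq> E" by (auto simp: B_def E_def grid_cell_boundary_def)
  have BK: "B \<subseteq> K" using face by (force simp: B_def K_def)
  have EK: "E \<inter> K \<subseteq> B"
  proof -
    have "E \<inter> grid_cell n N e' \<subseteq> B" if "e' \<in> C" for e'
      unfolding E_def B_def
      by (rule grid_cell_Int_grid_cell[OF e]) (use that C e_max in auto)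
    then show ?thesis
      using grid_cell_Int_cube_boundary[OF e N nb] unfolding K_def E_def B_def by blast
  qed
  have En: "E \<subseteq> cube_set n" by (simp add: E_def grid_cell_subset)
  have GB: "G (t, x) \<in> V e" if "t \<in> {0..1}" "x \<in> B" for t x
    using face[of x] that A(7) mono unfolding B_def by blast
  let ?X = "subtopology X {x. f x \<in> V e}" and ?Y = "subtopology Y (V e)"
  have f': "continuous_map ?X ?Y f"
    using f by (auto simp: continuous_map_in_subtopology continuous_map_from_subtopology)
  have a': "continuous_map (top_of_set B) ?X A"
    unfolding continuous_map_in_subtopology
  proof
    show "continuous_map (top_of_set B) X A"
      using continuous_map_top_of_set_compose[OF A(1), of B "\<lambda>x. x"] BK by auto
    show "A \<in> topspace (top_of_set B) \<rightarrow> {x. f x \<in> V e}"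
    proof
      fix x assume "x \<in> topspace (top_of_set B)"
      then have x: "x \<in> B" by simp
      with BK have "x \<in> K" by blast
      with GB[of 0 x] x A(3)[of x] show "A x \<in> {x. f x \<in> V e}" by simp
    qed
  qed
  have b': "continuous_map (top_of_set E) ?Y b"
    unfolding continuous_map_in_subtopology
    using continuous_map_top_of_set_compose[OF b, of E "\<lambda>x. x"] En bV by (auto simp: E_def)
  have H': "continuous_map (top_of_set ({0..1::real} \<times> B)) ?Y G"
    unfolding continuous_map_in_subtopology
  proof
    show "continuous_map (top_of_set ({0..1::real} \<times> B)) Y G"
      by (rule continuous_map_top_of_set_compose[OF A(2) continuous_on_id]) (use BK in auto)
    show "G \<in> topspace (top_of_set ({0..1::real} \<times> B)) \<rightarrow> V e"
      using GB by auto
  qed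
  obtain \<phi> \<psi> where *: "continuous_on (cube_set (card (snd e))) \<phi>" "continuous_on E \<psi>"
    "\<And>s. s \<in> cube_set (card (snd e)) \<Longrightarrow> \<phi> s \<in> E"
    "\<And>x. x \<in> E \<Longrightarrow> \<psi> x \<in> cube_set (card (snd e))"
    "\<And>s. s \<in> cube_set (card (snd e)) \<Longrightarrow> \<psi> (\<phi> s) = s"
    "\<And>x. x \<in> E \<Longrightarrow> \<phi> (\<psi> x) = x"
    "\<And>x. x \<in> E \<Longrightarrow> \<psi> x \<in> cube_boundary (card (snd e)) \<longleftrightarrow> x \<in> B"
    using grid_cell_homeomorphism[OF e N] unfolding E_def B_def by blast
  obtain A' G' where A': "continuous_map (top_of_set E) ?X A'"
    "continuous_map (top_of_set ({0..1::real} \<times> E)) ?Y G'"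
    "\<And>z. z \<in> B \<Longrightarrow> A' z = A z"
    "\<And>x. x \<in> E \<Longrightarrow> G' (0, x) = f (A' x)" "\<And>x. x \<in> E \<Longrightarrow> G' (1, x) = b x"
    "\<And>t z. t \<in> {0..1} \<Longrightarrow> z \<in> B \<Longrightarrow> G' (t, z) = G (t, z)"
  proof (rule lifts_cubes_pair[OF lc f' *(1,3,2,4-7) BE a' b' H'])
    show "G (0, z) = f (A z)" "G (1, z) = b z" if "z \<in> B" for z using that BK A(3,4) by auto
  qed auto
  define A'' where "A'' x = (if x \<in> E then A' x else A x)" for x
  define G'' where "G'' p = (if snd p \<in> E then G' p else G p)" for p
  have A''K: "A'' x = A x" if "x \<in> K" for x
    using that EK A'(3) by (auto simp: A''_def)
  have G''K: "G'' (t, x) = G (t, x)" if "x \<in> K" "t \<in> {0..1}" for x t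
    using that EK A'(6) by (auto simp: G''_def)
  have cE: "closed E" and cK: "closed K"
    using finite_subset[OF C finite_grid_cells]
    unfolding E_def K_def
    by (auto intro!: closed_Un closed_UN closed_grid_cell closed_cube_boundary)
  have KE: "cube_boundary n \<union> \<Union>(grid_cell n N ` insert e C) = K \<union> E"
    by (auto simp: K_def E_def)
  have "continuous_map (top_of_set (K \<union> E)) X A''"
  proof (rule continuous_map_top_of_set_paste)
    show "closedin (top_of_set (K \<union> E)) K" "closedin (top_of_set (K \<union> E)) E"
      using cE cK by (auto intro: closed_subset)
    show "continuous_map (top_of_set K) X A''"
      by (rule continuous_map_eq[OF A(1)]) (simp add: A''K)
    have "continuous_map (top_of_set E) X A'"
      using A'(1) by (simp add: continuous_map_in_subtopology)
    then show "continuous_map (top_of_set E) X A''"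
      by (rule continuous_map_eq) (simp add: A''_def)
  qed simp
  moreover have "continuous_map (top_of_set ({0..1::real} \<times> (K \<union> E))) Y G''"
  proof (rule continuous_map_top_of_set_paste)
    show "closedin (top_of_set ({0..1::real} \<times> (K \<union> E))) ({0..1::real} \<times> K)"
      "closedin (top_of_set ({0..1::real} \<times> (K \<union> E))) ({0..1::real} \<times> E)"
      using cE cK by (auto intro!: closedin_TimesI)
    show "continuous_map (top_of_set ({0..1::real} \<times> K)) Y G''"
      by (rule continuous_map_eq[OF A(2)]) (auto simp: G''K)
    have "continuous_map (top_of_set ({0..1::real} \<times> E)) Y G'"
      using A'(2) by (simp add: continuous_map_in_subtopology)
    then show "continuous_map (top_of_set ({0..1::real} \<times> E)) Y G''"
      by (rule continuous_map_eq) (auto simp: G''_def)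
  qed auto
  moreover have "\<forall>x\<in>K \<union> E. G'' (0, x) = f (A'' x) \<and> G'' (1, x) = b x"
    using A(3,4) A'(4,5) by (auto simp: A''_def G''_def)
  moreover have "\<forall>z\<in>cube_boundary n. A'' z = a z \<and> (\<forall>t\<in>{0..1}. G'' (t, z) = b z)"
    using A(5,6) A''K G''K by (auto simp: K_def)
  moreover have "G'' (t, x) \<in> V e'" if "e' \<in> insert e C" "x \<in> grid_cell n N e'" "t \<in> {0..1}" for e' x t
  proof (cases "e' = e")
    case True
    have "G' \<in> {0..1::real} \<times> E \<rightarrow> V e"
      using A'(2) by (simp add: continuous_map_in_subtopology)
    then show ?thesis using True that by (auto simp: G''_def E_def)
  next
    case False
    then have "x \<in> K" using that by (auto simp: K_def)
    then show ?thesis using False that A(7) G''K by auto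
  qed
  ultimately show ?thesis
    unfolding grid_lift_def KE by (intro exI[of _ A''] exI[of _ G'']) blast
qed

text \<open>Faces have smaller dimension, so removing a cell of maximal dimension leaves a set that
  is still closed under faces; this makes an induction on the set of cells possible.\<close>

lemma grid_lift_exists:
  assumes f: "continuous_map X Y f" and sq: "lift_square n X Y f a b"
    and N: "N \<ge> 1"
    and bV: "\<And>e x. e \<in> grid_cells n N \<Longrightarrow> x \<in> grid_cell n N e \<Longrightarrow> b x \<in> V e"
    and mono: "\<And>e e'. e \<in> grid_cells n N \<Longrightarrow> e' \<in> grid_cells n N \<Longrightarrow>
      grid_cell n N e' \<subseteq> grid_cell n N e \<Longrightarrow> V e' \<subseteq> V e"
    and lc: "\<And>e k. e \<in> grid_cells n N \<Longrightarrow>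
      lifts_cubes k (subtopology X {x. f x \<in> V e}) (subtopology Y (V e)) f"
    and C: "C \<subseteq> grid_cells n N"
    and faces: "\<And>e x. e \<in> C \<Longrightarrow> x \<in> grid_cell_boundary n N e \<Longrightarrow>
      \<exists>e'\<in>C. card (snd e') < card (snd e) \<and> x \<in> grid_cell n N e' \<and> grid_cell n N e' \<subseteq> grid_cell n N e"
  shows "\<exists>A G. grid_lift n N X Y f a b V C A G"
  using finite_subset[OF C finite_grid_cells] C faces
proof (induction C rule: finite_psubset_induct)
  case (psubset C)
  show ?case
  proof (cases "C = {}")
    case True
    have "continuous_map (top_of_set ({0..1::real} \<times> cube_boundary n)) Y (\<lambda>p. b (snd p))"
    proof (rule continuous_map_top_of_set_compose[of "cube_set n" Y b])
      show "continuous_map (top_of_set (cube_set n)) Y b" using sq by (simp add: lift_square_def)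
      show "continuous_on ({0..1::real} \<times> cube_boundary n) snd"
        by (rule continuous_on_snd[OF continuous_on_id])
    qed (use cube_boundary_subset[of n] in auto)
    then show ?thesis
      using sq unfolding True grid_lift_def lift_square_def
      by (intro exI[of _ a] exI[of _ "\<lambda>p. b (snd p)"]) simp
  next
    case False
    then obtain e where e: "e \<in> C" "\<And>e'. e' \<in> C \<Longrightarrow> card (snd e') \<le> card (snd e)"
      using psubset.hyps(1) obtains_MAX[of C "\<lambda>e. card (snd e)"]
      by (metis Max_ge finite_imageI imageI)
    have face: "\<exists>e''\<in>C - {e}. card (snd e'') < card (snd e') \<and> x \<in> grid_cell n N e'' \<and>
        grid_cell n N e'' \<subseteq> grid_cell n N e'" if "e' \<in> C" "x \<in> grid_cell_boundary n N e'" for e' x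
      using psubset.prems(2)[OF that] e(2)[OF that(1)] by (metis DiffI leD singletonD)
    have "C - {e} \<subset> C" using e by auto
    then obtain A G where AG: "grid_lift n N X Y f a b V (C - {e}) A G"
      using psubset.IH[of "C - {e}"] psubset.prems(1) face by blast
    have eg: "e \<in> grid_cells n N" using e psubset.prems by blast
    have "\<exists>A G. grid_lift n N X Y f a b V (insert e (C - {e})) A G"
    proof (rule grid_lift_insert[OF f _ N _ eg _ _ lc[OF eg] _ _ _ AG])
      show "continuous_map (top_of_set (cube_set n)) Y b" using sq by (simp add: lift_square_def)
      show "C - {e} \<subseteq> grid_cells n N" using psubset.prems by blast
      show "b x \<in> V e" if "x \<in> grid_cell n N e" for x using bV[OF eg that] .
      show "V e' \<subseteq> V e" if "e' \<in> C - {e}" "grid_cell n N e' \<subseteq> grid_cell n N e" for e'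
        using mono[OF eg _ that(2)] that(1) psubset.prems(1) by blast
      show "\<exists>e'\<in>C - {e}. x \<in> grid_cell n N e' \<and> grid_cell n N e' \<subseteq> grid_cell n N e"
        if "x \<in> grid_cell_boundary n N e" for x using face[OF e(1) that] by blast
    qed (use e in auto)
    then show ?thesis using e(1) by (simp add: insert_absorb)
  qed
qed

text \<open>A Lebesgue number argument for the preimage of the cover in the compact cube.\<close>

lemma grid_mesh:
  fixes b :: "(nat \<Rightarrow> real) \<Rightarrow> 'b"
  assumes b: "continuous_map (top_of_set (cube_set n)) Y b"
    and \<U>: "\<And>U. U \<in> \<U> \<Longrightarrow> openin Y U" and cover: "topspace Y \<subseteq> \<Union>\<U>"
  obtains N where "N \<ge> 1" "\<And>e. \<exists>U\<in>\<U>. \<forall>x\<in>grid_cell n N e. b x \<in> U"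
proof -
  define \<G> where "\<G> = {W. open W \<and> (\<exists>U\<in>\<U>. \<forall>x\<in>W \<inter> cube_set n. b x \<in> U)}"
  have bY: "b x \<in> topspace Y" if "x \<in> cube_set n" for x
    using b that by (auto simp: continuous_map_def)
  have op: "\<And>W. W \<in> \<G> \<Longrightarrow> open W" by (simp add: \<G>_def)
  have "cube_set n \<subseteq> \<Union>\<G>"
  proof
    fix x assume x: "x \<in> cube_set n"
    then obtain U where U: "U \<in> \<U>" "b x \<in> U" using bY cover by blast
    have "openin (top_of_set (cube_set n)) {z \<in> topspace (top_of_set (cube_set n)). b z \<in> U}"
      using openin_continuous_map_preimage[OF b \<U>[OF U(1)]] .
    then obtain W where W: "open W" "{z \<in> topspace (top_of_set (cube_set n)). b z \<in> U} = cube_set n \<inter> W"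
      unfolding openin_open by blast
    then have "x \<in> W" "\<forall>z\<in>W \<inter> cube_set n. b z \<in> U" using x U by auto
    with W(1) U(1) show "x \<in> \<Union>\<G>" by (auto simp: \<G>_def)
  qed
  then obtain \<epsilon> where \<epsilon>: "0 < \<epsilon>" "\<And>x. x \<in> cube_set n \<Longrightarrow> \<exists>G \<in> \<G>. ball x \<epsilon> \<subseteq> G"
    using Heine_Borel_lemma[OF compact_cube_set _ op] by blast
  \<comment> \<open>Cells have diameter at most \<open>2 / N\<close>, which this choice makes
    smaller than the Lebesgue number.\<close>
  obtain N :: nat where N: "real N > 2 / \<epsilon>" using reals_Archimedean2 by blast
  have "2 / \<epsilon> > 0" using \<epsilon>(1) by simp
  with N have N0: "real N > 0" by linarith
  then have N1: "N \<ge> 1" by simp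
  have N2: "2 / real N < \<epsilon>" using N N0 \<epsilon>(1) by (simp add: pos_divide_less_eq mult.commute)
  have "\<exists>U\<in>\<U>. \<forall>x\<in>grid_cell n N e. b x \<in> U" for e
  proof (cases "grid_cell n N e = {}")
    case True
    \<comment> \<open>The pair \<open>e\<close> is arbitrary and its cell may be empty; the centre
      of the cube merely supplies some member of the cover.\<close>
    have "b (cube_center n) \<in> \<Union>\<U>" using bY[OF cube_center_in] cover by blast
    then show ?thesis using True by auto
  next
    case False
    then obtain x where x: "x \<in> grid_cell n N e" by blast
    then obtain G where G: "G \<in> \<G>" "ball x \<epsilon> \<subseteq> G" using \<epsilon>(2) grid_cell_subset by blast
    have "y \<in> G \<inter> cube_set n" if y: "y \<in> grid_cell n N e" for y
    proof -
      have "y \<in> ball x \<epsilon>" using dist_grid_cell[OF x y N1] N2 by simp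
      then show ?thesis using G(2) y grid_cell_subset by blast
    qed
    then show ?thesis using G(1) by (auto simp: \<G>_def)
  qed
  with N1 that show thesis by blast
qed

text \<open>The lift is built cell by cell; over a cell it stays inside all members of the cover chosen for
  the top-dimensional cells that contain it.\<close>

lemma lifts_cubes_open_cover:
  assumes f: "continuous_map X Y f"
    and \<U>: "\<And>U. U \<in> \<U> \<Longrightarrow> openin Y U" and cover: "topspace Y \<subseteq> \<Union>\<U>"
    and lc: "\<And>\<J> k. finite \<J> \<Longrightarrow> \<J> \<noteq> {} \<Longrightarrow> \<J> \<subseteq> \<U> \<Longrightarrow>
      lifts_cubes k (subtopology X {x. f x \<in> \<Inter>\<J>}) (subtopology Y (\<Inter>\<J>)) f"
  shows "lifts_cubes n X Y f"
  unfolding lifts_cubes_def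
proof (intro allI impI)
  fix a b assume sq: "lift_square n X Y f a b"
  then have b: "continuous_map (top_of_set (cube_set n)) Y b" by (simp add: lift_square_def)
  obtain N where N: "N \<ge> 1" "\<And>e. \<exists>U\<in>\<U>. \<forall>x\<in>grid_cell n N e. b x \<in> U"
    using grid_mesh[OF b \<U> cover] by blast
  from N(2) obtain U where U: "\<And>e. U e \<in> \<U>" "\<And>e x. x \<in> grid_cell n N e \<Longrightarrow> b x \<in> U e" by metis
  \<comment> \<open>A face lies in every top cell that contains the larger cell, so \<open>J\<close>
    grows and its intersection shrinks on faces, as the induction over cells demands. Sets chosen
    separately for each cell would have no such monotonicity.\<close>
  define J where "J e = U ` {e' \<in> grid_cells n N. snd e' = {..<n} \<and> grid_cell n N e \<subseteq> grid_cell n N e'}" for e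
  have "\<exists>A G. grid_lift n N X Y f a b (\<lambda>e. \<Inter>(J e)) (grid_cells n N) A G"
  proof (rule grid_lift_exists[OF f sq N(1)])
    show "b x \<in> \<Inter>(J e)" if "x \<in> grid_cell n N e" for e x using that U(2) by (auto simp: J_def)
    show "\<Inter>(J e') \<subseteq> \<Inter>(J e)" if "grid_cell n N e' \<subseteq> grid_cell n N e" for e e'
      using that by (force simp: J_def)
    show "lifts_cubes k (subtopology X {x. f x \<in> \<Inter>(J e)}) (subtopology Y (\<Inter>(J e))) f"
      if e: "e \<in> grid_cells n N" for e k
    proof (rule lc)
      show "finite (J e)" using finite_grid_cells[of n N] by (simp add: J_def)
      show "J e \<noteq> {}" using grid_cell_subset_top[OF e N(1)] by (auto simp: J_def)
      show "J e \<subseteq> \<U>" using U(1) by (auto simp: J_def)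
    qed
  qed (use grid_cell_face in auto)
  then obtain A G where AG: "grid_lift n N X Y f a b (\<lambda>e. \<Inter>(J e)) (grid_cells n N) A G" by blast
  have "cube_boundary n \<union> \<Union>(grid_cell n N ` grid_cells n N) = cube_set n"
    using Union_grid_cells[OF N(1)] cube_boundary_subset by blast
  with AG show "\<exists>A L. continuous_map (top_of_set (cube_set n)) X A \<and>
        continuous_map (top_of_set ({0..1::real} \<times> cube_set n)) Y L \<and>
        (\<forall>z\<in>cube_boundary n. A z = a z) \<and>
        (\<forall>x\<in>cube_set n. L (0, x) = f (A x) \<and> L (1, x) = b x) \<and>
        (\<forall>t\<in>{0..1::real}. \<forall>z\<in>cube_boundary n. L (t, z) = b z)"
    unfolding grid_lift_def by (intro exI[of _ A] exI[of _ G]) simp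
qed

section \<open>Weak homotopy equivalences and lifting\<close>

lemma based_cubes_iff:
  "g \<in> based_cubes n X x \<longleftrightarrow>
    continuous_map (top_of_set (cube_set n)) X g \<and> (\<forall>z\<in>cube_boundary n. g z = x)"
  by (auto simp: based_cubes_def cube_eq)

lemma based_homotopy_iff:
  "(g, h) \<in> based_homotopy n X x \<longleftrightarrow>
    (\<exists>L. continuous_map (top_of_set ({0..1::real} \<times> cube_set n)) X L \<and>
      (\<forall>s\<in>cube_set n. L (0, s) = g s \<and> L (1, s) = h s) \<and>
      (\<forall>t\<in>{0..1}. \<forall>z\<in>cube_boundary n. L (t, z) = x))"
proof -
  have cong: "(k ` cube_boundary n \<subseteq> {x}) = (k' ` cube_boundary n \<subseteq> {x})"
    if "\<And>s. s \<in> topspace (cube n) \<Longrightarrow> k s = k' s" for k k' :: "(nat \<Rightarrow> real) \<Rightarrow> 'a"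
    using that cube_boundary_subset[of n] by (force simp: topspace_cube)
  have "(g, h) \<in> based_homotopy n X x \<longleftrightarrow>
    (\<exists>L. continuous_map (prod_topology (top_of_set {0..1::real}) (cube n)) X L \<and>
      (\<forall>s\<in>topspace (cube n). L (0, s) = g s) \<and> (\<forall>s\<in>topspace (cube n). L (1, s) = h s) \<and>
      (\<forall>t\<in>{0..1}. (\<lambda>s. L (t, s)) ` cube_boundary n \<subseteq> {x}))"
    unfolding based_homotopy_def mem_Collect_eq case_prod_conv using cong by (rule homotopic_with)
  then show ?thesis
    by (simp add: cube_eq image_subset_iff ball_conj_distrib conj_assoc)
qed

lemma based_homotopyI:
  assumes "continuous_map (top_of_set ({0..1::real} \<times> cube_set n)) X L"
    "\<And>s. s \<in> cube_set n \<Longrightarrow> L (0, s) = g s" "\<And>s. s \<in> cube_set n \<Longrightarrow> L (1, s) = h s"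
    "\<And>t z. t \<in> {0..1} \<Longrightarrow> z \<in> cube_boundary n \<Longrightarrow> L (t, z) = x"
  shows "(g, h) \<in> based_homotopy n X x"
  unfolding based_homotopy_iff by (intro exI[of _ L]) (simp add: assms)

lemma based_homotopyE:
  assumes "(g, h) \<in> based_homotopy n X x"
  obtains L where "continuous_map (top_of_set ({0..1::real} \<times> cube_set n)) X L"
    "\<And>s. s \<in> cube_set n \<Longrightarrow> L (0, s) = g s" "\<And>s. s \<in> cube_set n \<Longrightarrow> L (1, s) = h s"
    "\<And>t z. t \<in> {0..1} \<Longrightarrow> z \<in> cube_boundary n \<Longrightarrow> L (t, z) = x"
  by (insert assms[unfolded based_homotopy_iff]) (elim exE conjE, rule that, assumption, auto)

lemma based_homotopy_subset: "based_homotopy n X x \<subseteq> based_cubes n X x \<times> based_cubes n X x"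
proof (rule subrelI)
  fix g h assume "(g, h) \<in> based_homotopy n X x"
  then have "homotopic_with (\<lambda>k. k ` cube_boundary n \<subseteq> {x}) (cube n) X g h"
    by (simp add: based_homotopy_def)
  from homotopic_with_imp_continuous_maps[OF this] homotopic_with_imp_property[OF this]
  show "(g, h) \<in> based_cubes n X x \<times> based_cubes n X x" by (simp add: based_cubes_def)
qed

lemma equiv_based_homotopy: "equiv (based_cubes n X x) (based_homotopy n X x)"
proof (rule equivI)
  show "based_homotopy n X x \<subseteq> based_cubes n X x \<times> based_cubes n X x"
    by (rule based_homotopy_subset)
  show "refl_on (based_cubes n X x) (based_homotopy n X x)"
    by (auto simp: refl_on_def based_homotopy_def based_cubes_def)
  show "sym (based_homotopy n X x)"
    by (auto simp: sym_def based_homotopy_def intro: homotopic_with_symD)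
  show "trans (based_homotopy n X x)"
    by (auto simp: trans_def based_homotopy_def intro: homotopic_with_trans)
qed

lemma based_cubes_compose:
  assumes "continuous_map X Y f" "g \<in> based_cubes n X x"
  shows "f \<circ> g \<in> based_cubes n Y (f x)"
proof -
  have g: "continuous_map (top_of_set (cube_set n)) X g" "\<forall>z\<in>cube_boundary n. g z = x"
    using assms(2) by (simp_all add: based_cubes_iff)
  from continuous_map_compose[OF g(1) assms(1)] g(2) show ?thesis by (simp add: based_cubes_iff)
qed

lemma based_homotopy_compose:
  assumes f: "continuous_map X Y f" and gh: "(g, h) \<in> based_homotopy n X x"
  shows "(f \<circ> g, f \<circ> h) \<in> based_homotopy n Y (f x)"
proof -
  obtain L where L: "continuous_map (top_of_set ({0..1::real} \<times> cube_set n)) X L"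
    "\<And>s. s \<in> cube_set n \<Longrightarrow> L (0, s) = g s" "\<And>s. s \<in> cube_set n \<Longrightarrow> L (1, s) = h s"
    "\<And>t z. t \<in> {0..1} \<Longrightarrow> z \<in> cube_boundary n \<Longrightarrow> L (t, z) = x"
    using gh by (rule based_homotopyE) blast
  show ?thesis
    by (rule based_homotopyI[OF continuous_map_compose[OF L(1) f]]) (auto simp: L)
qed

lemma homotopy_group_map_class:
  assumes f: "continuous_map X Y f" and g: "g \<in> based_cubes n X x"
  shows "homotopy_group_map n Y f x (based_homotopy n X x `` {g}) = based_homotopy n Y (f x) `` {f \<circ> g}"
proof -
  have "based_homotopy n Y (f x) `` {f \<circ> h} = based_homotopy n Y (f x) `` {f \<circ> g}"
    if "(g, h) \<in> based_homotopy n X x" for h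
    using equiv_class_eq[OF equiv_based_homotopy based_homotopy_compose[OF f that]] by simp
  moreover have "(g, g) \<in> based_homotopy n X x"
    using equiv_based_homotopy g by (meson equivE refl_onD)
  ultimately show ?thesis unfolding homotopy_group_map_def by blast
qed

lemma path_components_map_class:
  assumes f: "continuous_map X Y f" and x: "x \<in> topspace X"
  shows "path_components_map Y f (path_component_of_set X x) = path_component_of_set Y (f x)"
proof -
  have "path_component_of_set Y (f z) = path_component_of_set Y (f x)"
    if xz: "path_component_of X x z" for z
  proof -
    obtain p where p: "pathin X p" "p 0 = x" "p 1 = z" using xz unfolding path_component_of_def by blast
    have "path_component_of Y (f x) (f z)"
      unfolding path_component_of_def
      using pathin_compose[OF p(1) f] p by (intro exI[of _ "f \<circ> p"]) auto
    then show ?thesis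
      using path_component_of_equiv by (metis path_component_of_sym)
  qed
  moreover have "path_component_of X x x" using x by (simp add: path_component_of_refl)
  ultimately show ?thesis unfolding path_components_map_def by blast
qed

lemma cube_set_0: "cube_set 0 = {\<lambda>_. undefined}"
  by (auto simp: in_cube_set)

lemma cube_boundary_0 [simp]: "cube_boundary 0 = {}"
  by (auto simp: cube_boundary_iff)

lemma path_component_of_cube_0:
  "path_component_of X x y \<longleftrightarrow> (\<exists>L. continuous_map (top_of_set ({0..1::real} \<times> cube_set 0)) X L \<and>
     (\<forall>s\<in>cube_set 0. L (0, s) = x \<and> L (1, s) = y))"
proof
  assume "path_component_of X x y"
  then obtain p where p: "continuous_map (top_of_set {0..1::real}) X p" "p 0 = x" "p 1 = y"
    unfolding path_component_of_def pathin_def by blast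
  then show "\<exists>L. continuous_map (top_of_set ({0..1::real} \<times> cube_set 0)) X L \<and>
     (\<forall>s\<in>cube_set 0. L (0, s) = x \<and> L (1, s) = y)"
    by (intro exI[of _ "\<lambda>q. p (fst q)"] conjI continuous_map_top_of_set_compose[OF p(1)])
      (auto intro!: continuous_intros)
next
  assume "\<exists>L. continuous_map (top_of_set ({0..1::real} \<times> cube_set 0)) X L \<and>
     (\<forall>s\<in>cube_set 0. L (0, s) = x \<and> L (1, s) = y)"
  then obtain L where L: "continuous_map (top_of_set ({0..1::real} \<times> cube_set 0)) X L"
     "\<forall>s\<in>cube_set 0. L (0, s) = x \<and> L (1, s) = y" by blast
  have "continuous_map (top_of_set {0..1::real}) X (\<lambda>t. L (t, \<lambda>_. undefined))"
    by (rule continuous_map_top_of_set_compose[OF L(1)]) (auto intro!: continuous_intros simp: cube_set_0)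
  then show "path_component_of X x y"
    unfolding path_component_of_def pathin_def
    using L(2) by (intro exI[of _ "\<lambda>t. L (t, \<lambda>_. undefined)"]) (simp add: cube_set_0)
qed

text \<open>A 0-cube is a point with empty boundary, so the base point imposes no condition.
  Injectivity on path components thereby becomes the case 0 of injectivity on based cubes.\<close>

lemma path_component_of_homotopy_0:
  "path_component_of X (g (\<lambda>_. undefined)) (h (\<lambda>_. undefined)) \<longleftrightarrow> (g, h) \<in> based_homotopy 0 X x"
  unfolding path_component_of_cube_0 based_homotopy_iff by (simp add: cube_set_0)

text \<open>The two halves meet where coordinate 0 of the argument is 1 for the first map and 0 for
  the second; both arguments are then on the boundary of the cube, where both maps have the value
  \<open>x\<close>.\<close>

lemma based_homotopy_concat_continuous:
  assumes H: "continuous_map (top_of_set ({0..1::real} \<times> cube_set n)) X H"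
    and K: "continuous_map (top_of_set ({0..1::real} \<times> cube_set n)) X K"
    and Hx: "\<And>t z. t \<in> {0..1} \<Longrightarrow> z \<in> cube_boundary n \<Longrightarrow> H (t, z) = x"
    and Kx: "\<And>t z. t \<in> {0..1} \<Longrightarrow> z \<in> cube_boundary n \<Longrightarrow> K (t, z) = x"
    and n: "n \<ge> 1"
  shows "continuous_map (top_of_set ({0..1::real} \<times> cube_set n)) X
    (\<lambda>p. cube_concat (\<lambda>s. H (fst p, s)) (\<lambda>s. K (fst p, s)) (snd p))"
proof -
  let ?T = "top_of_set ({0..1::real} \<times> cube_set n)"
  have c0: "continuous_on S (\<lambda>p :: real \<times> (nat \<Rightarrow> real). snd p 0)" for S
    by (rule continuous_on_coordinate[OF continuous_on_snd[OF continuous_on_id]])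
  have upd: "continuous_on S (\<lambda>p :: real \<times> (nat \<Rightarrow> real). (fst p, (snd p)(0 := r (snd p 0))))"
    if "continuous_on UNIV r" for S and r :: "real \<Rightarrow> real"
  proof (intro continuous_on_Pair continuous_on_fst continuous_on_id continuous_on_coordinatewise_then_product)
    fix i :: nat
    show "continuous_on S (\<lambda>p :: real \<times> (nat \<Rightarrow> real). ((snd p)(0 := r (snd p 0))) i)"
    proof (cases "i = 0")
      case True
      then show ?thesis using continuous_on_compose2[OF that c0] by simp
    next
      case False
      then show ?thesis by (simp add: continuous_on_coordinate continuous_on_snd)
    qed
  qed
  have "continuous_map ?T X (\<lambda>p. if snd p 0 \<le> 1/2 then H (fst p, (snd p)(0 := 2 * snd p 0))
      else K (fst p, (snd p)(0 := 2 * snd p 0 - 1)))"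
  proof (rule continuous_map_cases_le)
    show "continuous_map ?T euclideanreal (\<lambda>p. snd p 0)" by (simp add: c0)
    show "continuous_map (subtopology ?T {p \<in> topspace ?T. snd p 0 \<le> 1/2}) X
        (\<lambda>p. H (fst p, (snd p)(0 := 2 * snd p 0)))"
      unfolding subtopology_subtopology
    proof (rule continuous_map_top_of_set_compose[OF H upd])
      fix p assume "p \<in> ({0..1} \<times> cube_set n) \<inter> {p \<in> topspace ?T. snd p 0 \<le> 1/2}"
      then show "(fst p, (snd p)(0 := 2 * snd p 0)) \<in> {0..1::real} \<times> cube_set n"
        using n by (auto simp: in_cube_set)
    qed (intro continuous_intros)
    show "continuous_map (subtopology ?T {p \<in> topspace ?T. 1/2 \<le> snd p 0}) X
        (\<lambda>p. K (fst p, (snd p)(0 := 2 * snd p 0 - 1)))"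
      unfolding subtopology_subtopology
    proof (rule continuous_map_top_of_set_compose[OF K upd])
      fix p assume "p \<in> ({0..1} \<times> cube_set n) \<inter> {p \<in> topspace ?T. 1/2 \<le> snd p 0}"
      then show "(fst p, (snd p)(0 := 2 * snd p 0 - 1)) \<in> {0..1::real} \<times> cube_set n"
        using n by (auto simp: in_cube_set)
    qed (intro continuous_intros)
    fix p assume p: "p \<in> topspace ?T" "snd p 0 = 1/2"
    then have "(snd p)(0 := 1) \<in> cube_boundary n" "(snd p)(0 := 0) \<in> cube_boundary n"
      using n by (auto simp: cube_boundary_iff in_cube_set intro: exI[of _ 0])
    moreover have "2 * snd p 0 = 1" using p(2) by simp
    ultimately show "H (fst p, (snd p)(0 := 2 * snd p 0)) = K (fst p, (snd p)(0 := 2 * snd p 0 - 1))"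
      using p(1) Hx Kx by (simp add: mem_Times_iff)
  qed simp
  then show ?thesis by (simp add: cube_concat_def)
qed

lemma cube_concat_boundary:
  assumes n: "n \<ge> 1" and z: "z \<in> cube_boundary n"
    and gh: "\<And>z. z \<in> cube_boundary n \<Longrightarrow> g z = x" "\<And>z. z \<in> cube_boundary n \<Longrightarrow> h z = x"
  shows "cube_concat g h z = x"
proof -
  obtain i where i: "i < n" "z i = 0 \<or> z i = 1" and zc: "z \<in> cube_set n"
    using z by (auto simp: cube_boundary_iff)
  \<comment> \<open>An extreme coordinate other than coordinate 0 is untouched by the update; if it
    is coordinate 0, the third assumption makes the new value extreme again.\<close>
  have upd: "z(0 := c) \<in> cube_boundary n" if "0 \<le> c" "c \<le> 1" "z 0 = 0 \<or> z 0 = 1 \<Longrightarrow> c = 0 \<or> c = 1" for c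
  proof -
    have "z(0 := c) \<in> cube_set n" using that zc n by (auto simp: in_cube_set)
    moreover have "(z(0 := c)) i = 0 \<or> (z(0 := c)) i = 1" using i that(3) by (cases "i = 0") auto
    ultimately show ?thesis using i(1) unfolding cube_boundary_iff by blast
  qed
  have z0: "0 \<le> z 0" "z 0 \<le> 1" using zc n by (auto simp: in_cube_set)
  have "z(0 := 2 * z 0) \<in> cube_boundary n" if "z 0 \<le> 1/2"
    using that z0 by (intro upd) auto
  moreover have "z(0 := 2 * z 0 - 1) \<in> cube_boundary n" if "\<not> z 0 \<le> 1/2"
    using that z0 by (intro upd) auto
  ultimately show ?thesis using gh by (auto simp: cube_concat_def)
qed

lemma based_homotopy_concat:
  assumes n: "n \<ge> 1" and g: "(g, g') \<in> based_homotopy n X x" and h: "(h, h') \<in> based_homotopy n X x"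
  shows "(cube_concat g h, cube_concat g' h') \<in> based_homotopy n X x"
proof -
  obtain H where H: "continuous_map (top_of_set ({0..1::real} \<times> cube_set n)) X H"
    "\<And>s. s \<in> cube_set n \<Longrightarrow> H (0, s) = g s" "\<And>s. s \<in> cube_set n \<Longrightarrow> H (1, s) = g' s"
    "\<And>t z. t \<in> {0..1} \<Longrightarrow> z \<in> cube_boundary n \<Longrightarrow> H (t, z) = x"
    using g by (rule based_homotopyE) blast
  obtain K where K: "continuous_map (top_of_set ({0..1::real} \<times> cube_set n)) X K"
    "\<And>s. s \<in> cube_set n \<Longrightarrow> K (0, s) = h s" "\<And>s. s \<in> cube_set n \<Longrightarrow> K (1, s) = h' s"
    "\<And>t z. t \<in> {0..1} \<Longrightarrow> z \<in> cube_boundary n \<Longrightarrow> K (t, z) = x"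
    using h by (rule based_homotopyE) blast
  have dbl: "s(0 := 2 * s 0) \<in> cube_set n" if "s \<in> cube_set n" "s 0 \<le> 1/2" for s
    using that n by (auto simp: in_cube_set)
  have dbl1: "s(0 := 2 * s 0 - 1) \<in> cube_set n" if "s \<in> cube_set n" "\<not> s 0 \<le> 1/2" for s
    using that n by (auto simp: in_cube_set)
  show ?thesis
  proof (rule based_homotopyI[OF based_homotopy_concat_continuous[OF H(1) K(1) H(4) K(4) n]])
    show "cube_concat (\<lambda>s. H (fst (t, z), s)) (\<lambda>s. K (fst (t, z), s)) (snd (t, z)) = x"
      if "t \<in> {0..1}" "z \<in> cube_boundary n" for t z
      using cube_concat_boundary[OF n that(2), of "\<lambda>s. H (t, s)" x "\<lambda>s. K (t, s)"] H(4) K(4) that(1) by simp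
  qed (use dbl dbl1 H(2,3) K(2,3) in \<open>auto simp: cube_concat_def\<close>)
qed

lemma homotopy_group_mult:
  assumes n: "n \<ge> 1" and g: "g \<in> based_cubes n X x" and h: "h \<in> based_cubes n X x"
  shows "based_homotopy n X x `` {g} \<otimes>\<^bsub>homotopy_group n X x\<^esub> based_homotopy n X x `` {h} =
    based_homotopy n X x `` {cube_concat g h}"
    and "cube_concat g h \<in> based_cubes n X x"
proof -
  note eq = equiv_based_homotopy[of n X x]
  have gg: "(g, g) \<in> based_homotopy n X x" "(h, h) \<in> based_homotopy n X x"
    using eq g h by (meson equivE refl_onD)+
  show "cube_concat g h \<in> based_cubes n X x"
    using subsetD[OF based_homotopy_subset based_homotopy_concat[OF n gg]] by simp
  have "based_homotopy n X x `` {cube_concat g' h'} = based_homotopy n X x `` {cube_concat g h}"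
    if "(g, g') \<in> based_homotopy n X x" "(h, h') \<in> based_homotopy n X x" for g' h'
    using equiv_class_eq[OF eq based_homotopy_concat[OF n that]] by simp
  then have "(\<Union>g'\<in>based_homotopy n X x `` {g}. \<Union>h'\<in>based_homotopy n X x `` {h}.
      based_homotopy n X x `` {cube_concat g' h'}) =
    (\<Union>g'\<in>based_homotopy n X x `` {g}. \<Union>h'\<in>based_homotopy n X x `` {h}.
      based_homotopy n X x `` {cube_concat g h})"
    by (intro SUP_cong refl) (simp only: Image_singleton_iff)
  also have "\<dots> = based_homotopy n X x `` {cube_concat g h}" using gg by auto
  finally show "based_homotopy n X x `` {g} \<otimes>\<^bsub>homotopy_group n X x\<^esub> based_homotopy n X x `` {h} =
    based_homotopy n X x `` {cube_concat g h}"
    by (simp add: homotopy_group_def)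
qed

lemma homotopy_group_map_hom:
  assumes n: "n \<ge> 1" and f: "continuous_map X Y f"
  shows "homotopy_group_map n Y f x \<in> hom (homotopy_group n X x) (homotopy_group n Y (f x))"
proof (rule homI)
  have car: "carrier (homotopy_group n Z z) = based_cubes n Z z // based_homotopy n Z z"
    for Z :: "'c topology" and z by (simp add: homotopy_group_def)
  show "homotopy_group_map n Y f x C \<in> carrier (homotopy_group n Y (f x))"
    if C: "C \<in> carrier (homotopy_group n X x)" for C
  proof -
    obtain g where g: "g \<in> based_cubes n X x" "C = based_homotopy n X x `` {g}"
      using C by (auto simp: homotopy_group_def quotient_def)
    then show ?thesis
      using based_cubes_compose[OF f g(1)]
      by (simp add: homotopy_group_map_class[OF f] homotopy_group_def quotientI)
  qed
  fix C D assume "C \<in> carrier (homotopy_group n X x)" "D \<in> carrier (homotopy_group n X x)"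
  then obtain g h where g: "g \<in> based_cubes n X x" "C = based_homotopy n X x `` {g}"
    and h: "h \<in> based_cubes n X x" "D = based_homotopy n X x `` {h}"
    by (auto simp: homotopy_group_def quotient_def)
  have "f \<circ> cube_concat g h = cube_concat (f \<circ> g) (f \<circ> h)"
    by (auto simp: cube_concat_def)
  then show "homotopy_group_map n Y f x (C \<otimes>\<^bsub>homotopy_group n X x\<^esub> D) =
      homotopy_group_map n Y f x C \<otimes>\<^bsub>homotopy_group n Y (f x)\<^esub> homotopy_group_map n Y f x D"
    by (simp add: g h homotopy_group_mult[OF n] homotopy_group_map_class[OF f]
        based_cubes_compose[OF f])
qed

text \<open>The induced maps are homomorphisms in any case, so being an isomorphism means
  bijectivity, which is spelled out on representatives. Injectivity on path components is the case
  \<open>n = 0\<close> of the injectivity clause. Surjectivity on them stands apart, since a case 0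
  with base points taken from \<open>X\<close> would be vacuous for empty \<open>X\<close>.\<close>

lemma weak_homotopy_equivalence_iff:
  "weak_homotopy_equivalence X Y f \<longleftrightarrow> continuous_map X Y f \<and>
    (\<forall>y\<in>topspace Y. \<exists>x\<in>topspace X. path_component_of Y (f x) y) \<and>
    (\<forall>n. \<forall>x\<in>topspace X. \<forall>g\<in>based_cubes n X x. \<forall>h\<in>based_cubes n X x.
      (f \<circ> g, f \<circ> h) \<in> based_homotopy n Y (f x) \<longrightarrow> (g, h) \<in> based_homotopy n X x) \<and>
    (\<forall>n\<ge>1. \<forall>x\<in>topspace X. \<forall>b\<in>based_cubes n Y (f x).
      \<exists>g\<in>based_cubes n X x. (f \<circ> g, b) \<in> based_homotopy n Y (f x))"
  (is "?W \<longleftrightarrow> ?c \<and> ?Sur \<and> ?I \<and> ?S")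
proof (cases ?c)
  case f: True
  have pc: "path_component_of_set Z z = path_component_of_set Z z' \<longleftrightarrow> path_component_of Z z z'"
    if "z \<in> topspace Z" "z' \<in> topspace Z" for Z :: "'c topology" and z z'
    using that by (metis mem_Collect_eq path_component_of_equiv path_component_of_refl)
  have fX: "f x \<in> topspace Y" if "x \<in> topspace X" for x using f that by (auto simp: continuous_map_def)
  have comps: "path_components_of Z = path_component_of_set Z ` topspace Z" for Z :: "'c topology"
    by (simp add: path_components_of_def)
  have 0: "bij_betw (path_components_map Y f) (path_components_of X) (path_components_of Y) \<longleftrightarrow>
      ?Sur \<and> (\<forall>x\<in>topspace X. \<forall>x'\<in>topspace X. path_component_of Y (f x) (f x') \<longrightarrow> path_component_of X x x')"
    (is "_ \<longleftrightarrow> _ \<and> ?Inj")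
  proof -
    have "inj_on (path_components_map Y f) (path_components_of X) \<longleftrightarrow> ?Inj"
      unfolding inj_on_def path_components_of_def
      by (simp add: path_components_map_class[OF f] pc fX)
    moreover have "path_components_map Y f ` path_components_of X = path_components_of Y \<longleftrightarrow> ?Sur"
    proof -
      have im: "path_components_map Y f ` path_components_of X = (\<lambda>x. path_component_of_set Y (f x)) ` topspace X"
        unfolding path_components_of_def image_image by (simp add: path_components_map_class[OF f])
      show ?thesis
        unfolding im unfolding comps
      proof
        assume eq: "(\<lambda>x. path_component_of_set Y (f x)) ` topspace X = path_component_of_set Y ` topspace Y"
        show ?Sur
        proof
          fix y assume y: "y \<in> topspace Y"
          then have "path_component_of_set Y y \<in> (\<lambda>x. path_component_of_set Y (f x)) ` topspace X"
            unfolding eq by (rule imageI)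
          then obtain x where x: "x \<in> topspace X" "path_component_of_set Y y = path_component_of_set Y (f x)"
            by (rule imageE)
          then have "path_component_of Y (f x) y" using pc[OF fX[OF x(1)] y] by simp
          with x show "\<exists>x\<in>topspace X. path_component_of Y (f x) y" by blast
        qed
      next
        assume sur: ?Sur
        show "(\<lambda>x. path_component_of_set Y (f x)) ` topspace X = path_component_of_set Y ` topspace Y"
        proof
          show "(\<lambda>x. path_component_of_set Y (f x)) ` topspace X \<subseteq> path_component_of_set Y ` topspace Y"
            using fX by blast
          show "path_component_of_set Y ` topspace Y \<subseteq> (\<lambda>x. path_component_of_set Y (f x)) ` topspace X"
          proof (rule image_subsetI)
            fix y assume y: "y \<in> topspace Y"
            then obtain x where x: "x \<in> topspace X" "path_component_of Y (f x) y" using sur by blast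
            then have "path_component_of_set Y y = path_component_of_set Y (f x)"
              using pc[OF fX[OF x(1)] y] by simp
            with x(1) show "path_component_of_set Y y \<in> (\<lambda>x. path_component_of_set Y (f x)) ` topspace X"
              by (simp add: image_eqI)
          qed
        qed
      qed
    qed
    ultimately show ?thesis unfolding bij_betw_def by blast
  qed
  have I0: "?Inj \<longleftrightarrow> (\<forall>x\<in>topspace X. \<forall>g\<in>based_cubes 0 X x. \<forall>h\<in>based_cubes 0 X x.
      (f \<circ> g, f \<circ> h) \<in> based_homotopy 0 Y (f x) \<longrightarrow> (g, h) \<in> based_homotopy 0 X x)" (is "_ \<longleftrightarrow> ?Jnj")
  proof
    assume I: ?Inj
    show ?Jnj
    proof (intro ballI impI)
      fix x g h assume *: "g \<in> based_cubes 0 X x" "h \<in> based_cubes 0 X x"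
        "(f \<circ> g, f \<circ> h) \<in> based_homotopy 0 Y (f x)"
      then have "g (\<lambda>_. undefined) \<in> topspace X" "h (\<lambda>_. undefined) \<in> topspace X"
        by (auto simp: based_cubes_iff continuous_map_def cube_set_0)
      then show "(g, h) \<in> based_homotopy 0 X x"
        using I *(3) unfolding path_component_of_homotopy_0[symmetric] by simp
    qed
  next
    assume J: ?Jnj
    show ?Inj
    proof (intro ballI impI)
      fix x x' assume *: "x \<in> topspace X" "x' \<in> topspace X" "path_component_of Y (f x) (f x')"
      then have "(f \<circ> (\<lambda>_. x), f \<circ> (\<lambda>_. x')) \<in> based_homotopy 0 Y (f x)"
        unfolding path_component_of_homotopy_0[symmetric] by simp
      then have "((\<lambda>_. x), (\<lambda>_. x')) \<in> based_homotopy 0 X x"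
        using J * by (simp add: based_cubes_iff)
      then show "path_component_of X x x'"
        unfolding path_component_of_homotopy_0[symmetric] .
    qed
  qed
  have iso: "homotopy_group_map n Y f x \<in> iso (homotopy_group n X x) (homotopy_group n Y (f x)) \<longleftrightarrow>
      (\<forall>g\<in>based_cubes n X x. \<forall>h\<in>based_cubes n X x.
        (f \<circ> g, f \<circ> h) \<in> based_homotopy n Y (f x) \<longrightarrow> (g, h) \<in> based_homotopy n X x) \<and>
      (\<forall>b\<in>based_cubes n Y (f x). \<exists>g\<in>based_cubes n X x. (f \<circ> g, b) \<in> based_homotopy n Y (f x))"
    (is "_ \<longleftrightarrow> ?In \<and> ?Sn") if n: "n \<ge> 1" for n x
  proof -
    let ?r = "based_homotopy n X x" and ?s = "based_homotopy n Y (f x)"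
    have car: "carrier (homotopy_group n X x) = (\<lambda>g. ?r `` {g}) ` based_cubes n X x"
      "carrier (homotopy_group n Y (f x)) = (\<lambda>g. ?s `` {g}) ` based_cubes n Y (f x)"
      by (auto simp: homotopy_group_def quotient_def)
    have cl: "?r `` {g} = ?r `` {h} \<longleftrightarrow> (g, h) \<in> ?r" if "g \<in> based_cubes n X x" "h \<in> based_cubes n X x" for g h
      using eq_equiv_class_iff[OF equiv_based_homotopy that] .
    have cl': "?s `` {g} = ?s `` {h} \<longleftrightarrow> (g, h) \<in> ?s"
      if "g \<in> based_cubes n Y (f x)" "h \<in> based_cubes n Y (f x)" for g h
      using eq_equiv_class_iff[OF equiv_based_homotopy that] .
    have i1: "inj_on (homotopy_group_map n Y f x) (carrier (homotopy_group n X x)) \<longleftrightarrow> ?In"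
      unfolding inj_on_def car
      by (simp add: homotopy_group_map_class[OF f] cl cl' based_cubes_compose[OF f])
    have i2: "homotopy_group_map n Y f x ` carrier (homotopy_group n X x) =
        carrier (homotopy_group n Y (f x)) \<longleftrightarrow> ?Sn"
    proof -
      have im: "homotopy_group_map n Y f x ` carrier (homotopy_group n X x) =
          (\<lambda>g. ?s `` {f \<circ> g}) ` based_cubes n X x"
        unfolding car image_image by (simp add: homotopy_group_map_class[OF f])
      have sub: "(\<lambda>g. ?s `` {f \<circ> g}) ` based_cubes n X x \<subseteq> (\<lambda>g. ?s `` {g}) ` based_cubes n Y (f x)"
        using based_cubes_compose[OF f] by auto
      have "(\<lambda>g. ?s `` {g}) ` based_cubes n Y (f x) \<subseteq> (\<lambda>g. ?s `` {f \<circ> g}) ` based_cubes n X x \<longleftrightarrow> ?Sn"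
        unfolding image_subset_iff image_iff
        using cl' based_cubes_compose[OF f] by (metis (no_types, lifting))
      with sub show ?thesis unfolding im car(2) by blast
    qed
    show ?thesis
      using homotopy_group_map_hom[OF n f, of x] i1 i2 unfolding iso_def bij_betw_def mem_Collect_eq
      by argo
  qed
  have split: "(\<forall>n. P n) \<longleftrightarrow> P 0 \<and> (\<forall>n\<ge>1. P n)" for P :: "nat \<Rightarrow> bool"
    by (metis less_one linorder_not_le)
  have iso': "(\<forall>n\<ge>1. \<forall>x\<in>topspace X.
        homotopy_group_map n Y f x \<in> iso (homotopy_group n X x) (homotopy_group n Y (f x))) \<longleftrightarrow>
      (\<forall>n\<ge>1. \<forall>x\<in>topspace X. (\<forall>g\<in>based_cubes n X x. \<forall>h\<in>based_cubes n X x.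
        (f \<circ> g, f \<circ> h) \<in> based_homotopy n Y (f x) \<longrightarrow> (g, h) \<in> based_homotopy n X x) \<and>
      (\<forall>b\<in>based_cubes n Y (f x). \<exists>g\<in>based_cubes n X x. (f \<circ> g, b) \<in> based_homotopy n Y (f x)))"
    by (rule all_cong, rule ball_cong[OF refl], rule iso)
  have "?W \<longleftrightarrow> (?Sur \<and> ?Inj) \<and> (\<forall>n\<ge>1. \<forall>x\<in>topspace X.
      (\<forall>g\<in>based_cubes n X x. \<forall>h\<in>based_cubes n X x.
        (f \<circ> g, f \<circ> h) \<in> based_homotopy n Y (f x) \<longrightarrow> (g, h) \<in> based_homotopy n X x) \<and>
      (\<forall>b\<in>based_cubes n Y (f x). \<exists>g\<in>based_cubes n X x. (f \<circ> g, b) \<in> based_homotopy n Y (f x)))"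
    unfolding weak_homotopy_equivalence_def 0 iso' using f by (simp only: simp_thms)
  also have "\<dots> \<longleftrightarrow> ?Sur \<and> ?I \<and> ?S"
    unfolding I0 split[of "\<lambda>n. \<forall>x\<in>topspace X. \<forall>g\<in>based_cubes n X x. \<forall>h\<in>based_cubes n X x.
        (f \<circ> g, f \<circ> h) \<in> based_homotopy n Y (f x) \<longrightarrow> (g, h) \<in> based_homotopy n X x"]
    by blast
  finally show ?thesis using f by simp
qed (simp add: weak_homotopy_equivalence_def)

section \<open>Cubes of dimension m + 1 as products of an m-cube with an interval\<close>

definition cube_drop :: "nat \<Rightarrow> (nat \<Rightarrow> real) \<Rightarrow> nat \<Rightarrow> real" where
  "cube_drop m s = s(m := undefined)"

lemma cube_set_Suc: "s \<in> cube_set (Suc m) \<longleftrightarrow> cube_drop m s \<in> cube_set m \<and> 0 \<le> s m \<and> s m \<le> 1"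
proof -
  have "(\<forall>i\<ge>m. cube_drop m s i = undefined) \<longleftrightarrow> (\<forall>i\<ge>Suc m. s i = undefined)"
    by (auto simp: cube_drop_def Suc_le_eq)
  then show ?thesis by (auto simp: in_cube_set less_Suc_eq cube_drop_def)
qed

lemma cube_boundary_Suc: "s \<in> cube_boundary (Suc m) \<longleftrightarrow>
    s \<in> cube_set (Suc m) \<and> (cube_drop m s \<in> cube_boundary m \<or> s m = 0 \<or> s m = 1)"
proof -
  have "(\<exists>i<Suc m. s i = 0 \<or> s i = 1) \<longleftrightarrow>
      (\<exists>i<m. cube_drop m s i = 0 \<or> cube_drop m s i = 1) \<or> s m = 0 \<or> s m = 1"
    by (auto simp: less_Suc_eq cube_drop_def)
  then show ?thesis unfolding cube_boundary_iff[of s] cube_boundary_iff[of "cube_drop m s"]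
    using cube_set_Suc by blast
qed

lemma cube_drop_upd: "y \<in> cube_set m \<Longrightarrow> cube_drop m (y(m := t)) = y"
  by (auto simp: cube_drop_def in_cube_set)

lemma cube_upd_drop [simp]: "(cube_drop m s)(m := s m) = s"
  by (simp add: cube_drop_def)

lemma cube_upd_in: "y \<in> cube_set m \<Longrightarrow> 0 \<le> t \<Longrightarrow> t \<le> 1 \<Longrightarrow> y(m := t) \<in> cube_set (Suc m)"
  by (simp add: cube_set_Suc cube_drop_upd)

lemma continuous_on_cube_drop [continuous_intros]:
  assumes "continuous_on S s" shows "continuous_on S (\<lambda>z. cube_drop m (s z))"
proof (rule continuous_on_coordinatewise_then_product)
  show "continuous_on S (\<lambda>z. cube_drop m (s z) i)" for i
    by (cases "i = m") (simp_all add: cube_drop_def continuous_on_coordinate[OF assms])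
qed

lemma continuous_on_fun_upd:
  fixes y :: "'a::topological_space \<Rightarrow> nat \<Rightarrow> real"
  assumes "continuous_on S y" "continuous_on S t" shows "continuous_on S (\<lambda>z. (y z)(m := t z))"
proof (rule continuous_on_coordinatewise_then_product)
  show "continuous_on S (\<lambda>z. ((y z)(m := t z)) i)" for i
    using assms by (cases "i = m") (simp_all add: continuous_on_coordinate)
qed

text \<open>The boundary without the interior of the face \<open>s m = 1\<close>. It is
  contractible, so maps on it can be deformed to constants.\<close>

definition open_box :: "nat \<Rightarrow> (nat \<Rightarrow> real) set" where
  "open_box m = {s \<in> cube_set (Suc m). cube_drop m s \<in> cube_boundary m \<or> s m = 0}"

lemma open_box_subset: "open_box m \<subseteq> cube_boundary (Suc m)"
  by (auto simp: open_box_def cube_boundary_Suc)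

text \<open>The open box and the top face are closed, cover the boundary and meet in the boundary of
  the top face, on which the two homotopies agree.\<close>

lemma continuous_map_box_paste:
  assumes \<kappa>: "continuous_map (top_of_set ({0..1::real} \<times> open_box m)) X \<kappa>"
    and K: "continuous_map (top_of_set ({0..1::real} \<times> cube_set m)) X K"
    and eq: "\<And>t z. t \<in> {0..1} \<Longrightarrow> z \<in> cube_boundary m \<Longrightarrow> K (t, z) = \<kappa> (t, z(m := 1))"
  obtains \<alpha> where "continuous_map (top_of_set ({0..1::real} \<times> cube_boundary (Suc m))) X \<alpha>"
    "\<And>t s. t \<in> {0..1} \<Longrightarrow> s \<in> open_box m \<Longrightarrow> \<alpha> (t, s) = \<kappa> (t, s)"
    "\<And>t s. t \<in> {0..1} \<Longrightarrow> s \<in> cube_set (Suc m) \<Longrightarrow> s m = 1 \<Longrightarrow> \<alpha> (t, s) = K (t, cube_drop m s)"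
proof
  define \<alpha> where "\<alpha> p = (if snd p \<in> open_box m then \<kappa> p else K (fst p, cube_drop m (snd p)))" for p
  define F where "F = {s \<in> cube_set (Suc m). s m = 1}"
  show F: "\<alpha> (t, s) = K (t, cube_drop m s)" if "t \<in> {0..1}" "s \<in> cube_set (Suc m)" "s m = 1" for t s
  proof (cases "s \<in> open_box m")
    case True
    then have "cube_drop m s \<in> cube_boundary m" using that by (simp add: open_box_def)
    then have "K (t, cube_drop m s) = \<kappa> (t, (cube_drop m s)(m := s m))" using eq that by simp
    then show ?thesis using True by (simp add: \<alpha>_def)
  qed (simp add: \<alpha>_def)
  show J: "\<alpha> (t, s) = \<kappa> (t, s)" if "t \<in> {0..1}" "s \<in> open_box m" for t s using that by (simp add: \<alpha>_def)
  let ?S = "{0..1::real} \<times> cube_boundary (Suc m)"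
  show "continuous_map (top_of_set ?S) X \<alpha>"
  proof (rule continuous_map_top_of_set_paste)
    have "open_box m = cube_set (Suc m) \<inter> (cube_drop m -` cube_boundary m \<union> {s. s m = 0})"
      by (auto simp: open_box_def)
    moreover have "closed (cube_drop m -` cube_boundary m)"
      by (rule closed_vimage[OF closed_cube_boundary]) (auto intro!: continuous_intros)
    ultimately have "closed (open_box m)"
      by (simp add: closed_Int closed_Un closed_cube_set closed_Collect_eq)
    then show "closedin (top_of_set ?S) ({0..1::real} \<times> open_box m)"
      using open_box_subset by (intro closedin_TimesI) auto
    have "F = cube_set (Suc m) \<inter> {s. s m = 1}" by (auto simp: F_def)
    then have "closed F" by (simp add: closed_Int closed_cube_set closed_Collect_eq)
    then show "closedin (top_of_set ?S) ({0..1::real} \<times> F)"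
      by (intro closedin_TimesI) (auto simp: F_def cube_boundary_Suc)
    show "?S \<subseteq> {0..1::real} \<times> open_box m \<union> {0..1::real} \<times> F"
      by (auto simp: F_def open_box_def cube_boundary_Suc)
    show "continuous_map (top_of_set ({0..1::real} \<times> open_box m)) X \<alpha>"
      by (rule continuous_map_eq[OF \<kappa>]) (auto simp: J)
    have "continuous_map (top_of_set ({0..1::real} \<times> F)) X (\<lambda>p. K (fst p, cube_drop m (snd p)))"
      by (rule continuous_map_top_of_set_compose[OF K]) (auto intro!: continuous_intros simp: F_def cube_set_Suc)
    then show "continuous_map (top_of_set ({0..1::real} \<times> F)) X \<alpha>"
      by (rule continuous_map_eq) (auto simp: F F_def)
  qed
qed

text \<open>Until time 1/2 only coordinate \<open>m\<close> shrinks, down to 0, which keeps points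
  of the sides on the sides; afterwards the bottom is contracted to its corner at the origin.
  Shrinking all coordinates at once would leave the box.\<close>

definition box_contract :: "nat \<Rightarrow> real \<Rightarrow> (nat \<Rightarrow> real) \<Rightarrow> nat \<Rightarrow> real" where
  "box_contract m t s = (\<lambda>i. if i < m then (1 - max 0 (2 * t - 1)) * s i
     else if i = m then max 0 (1 - 2 * t) * s i else undefined)"

lemma box_contract_in:
  assumes t: "0 \<le> t" "t \<le> 1" and s: "s \<in> open_box m" shows "box_contract m t s \<in> open_box m"
proof -
  have s': "s \<in> cube_set (Suc m)" using s by (simp add: open_box_def)
  have "0 \<le> c * s i \<and> c * s i \<le> 1" if "0 \<le> c" "c \<le> 1" "i < Suc m" for c i
    using s' that by (simp add: in_cube_set mult_le_one)
  then have in_cube: "box_contract m t s \<in> cube_set (Suc m)"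
    using t by (auto simp: in_cube_set box_contract_def)
  show ?thesis
  proof (cases "s m = 0 \<or> t \<ge> 1/2")
    case True
    then have "box_contract m t s m = 0" by (auto simp: box_contract_def max_def)
    with in_cube show ?thesis by (simp add: open_box_def)
  next
    case False
    then have "cube_drop m (box_contract m t s) = cube_drop m s"
      using s' by (auto simp: box_contract_def cube_drop_def fun_eq_iff in_cube_set)
    with False in_cube s show ?thesis by (simp add: open_box_def)
  qed
qed

lemma box_contract_0: "s \<in> open_box m \<Longrightarrow> box_contract m 0 s = s"
  by (auto simp: box_contract_def open_box_def in_cube_set fun_eq_iff)

lemma box_contract_1: "box_contract m 1 s = (\<lambda>i. if i \<le> m then 0 else undefined)"
  by (auto simp: box_contract_def fun_eq_iff)

lemma continuous_on_box_contract: "continuous_on S (\<lambda>p. box_contract m (fst p) (snd p))"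
proof (rule continuous_on_coordinatewise_then_product)
  fix i
  have *: "continuous_on S (\<lambda>p :: real \<times> (nat \<Rightarrow> real). snd p j)" for j
    by (rule continuous_on_coordinate[OF continuous_on_snd[OF continuous_on_id]])
  show "continuous_on S (\<lambda>p. box_contract m (fst p) (snd p) i)"
    unfolding box_contract_def
    by (cases "i < m"; cases "i = m") (auto intro!: continuous_intros continuous_on_max *)
qed

text \<open>The contraction of the open box deforms \<open>a\<close> on it. Homotopy extension
  carries this deformation first over the top face in \<open>X\<close>, and then over the whole cube
  in \<open>Y\<close>.\<close>

lemma square_contract_box:
  assumes f: "continuous_map X Y f" and sq: "lift_square (Suc m) X Y f a b"
  obtains x a' b' where "x \<in> topspace X" "\<And>s. s \<in> open_box m \<Longrightarrow> a' s = x"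
    "lift_square (Suc m) X Y f a' b'" "homotopic_squares (Suc m) X Y f a b a' b'"
proof -
  have a: "continuous_map (top_of_set (cube_boundary (Suc m))) X a" using sq by (simp add: lift_square_def)
  define \<kappa> where "\<kappa> p = a (box_contract m (fst p) (snd p))" for p
  have \<kappa>: "continuous_map (top_of_set ({0..1::real} \<times> open_box m)) X \<kappa>"
    unfolding \<kappa>_def
    by (rule continuous_map_top_of_set_compose[OF a continuous_on_box_contract])
      (auto intro!: subsetD[OF open_box_subset] box_contract_in)
  have up: "y(m := 1) \<in> cube_boundary (Suc m)" if "y \<in> cube_set m" for y
    using that by (simp add: cube_boundary_Suc cube_upd_in)
  have upJ: "z(m := 1) \<in> open_box m" if "z \<in> cube_boundary m" for z
  proof -
    have "z \<in> cube_set m" using that cube_boundary_subset by blast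
    then show ?thesis using that by (simp add: open_box_def cube_upd_in cube_drop_upd)
  qed
  have b0: "continuous_map (top_of_set (cube_set m)) X (\<lambda>y. a (y(m := 1)))"
    by (rule continuous_map_top_of_set_compose[OF a])
      (auto intro!: continuous_on_fun_upd continuous_intros simp: up)
  have H: "continuous_map (top_of_set ({0..1::real} \<times> cube_boundary m)) X (\<lambda>p. \<kappa> (fst p, (snd p)(m := 1)))"
    by (rule continuous_map_top_of_set_compose[OF \<kappa>])
      (auto intro!: continuous_on_fun_upd continuous_intros simp: upJ)
  obtain K where K: "continuous_map (top_of_set ({0..1::real} \<times> cube_set m)) X K"
    "\<And>y. y \<in> cube_set m \<Longrightarrow> K (0, y) = a (y(m := 1))"
    "\<And>t z. 0 \<le> t \<Longrightarrow> t \<le> 1 \<Longrightarrow> z \<in> cube_boundary m \<Longrightarrow> K (t, z) = \<kappa> (t, z(m := 1))"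
    using homotopy_extension[OF b0 H] upJ box_contract_0 by (auto simp: \<kappa>_def)
  obtain \<alpha> where \<alpha>: "continuous_map (top_of_set ({0..1::real} \<times> cube_boundary (Suc m))) X \<alpha>"
    "\<And>t s. t \<in> {0..1} \<Longrightarrow> s \<in> open_box m \<Longrightarrow> \<alpha> (t, s) = \<kappa> (t, s)"
    "\<And>t s. t \<in> {0..1} \<Longrightarrow> s \<in> cube_set (Suc m) \<Longrightarrow> s m = 1 \<Longrightarrow> \<alpha> (t, s) = K (t, cube_drop m s)"
    using continuous_map_box_paste[OF \<kappa> K(1)] K(3) by auto
  have \<alpha>0: "\<alpha> (0, s) = a s" if s: "s \<in> cube_boundary (Suc m)" for s
  proof (cases "s \<in> open_box m")
    case True
    then show ?thesis by (simp add: \<alpha>(2) \<kappa>_def box_contract_0)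
  next
    case False
    then have s1: "s \<in> cube_set (Suc m)" "s m = 1" using s by (auto simp: cube_boundary_Suc open_box_def)
    then have "\<alpha> (0, s) = a ((cube_drop m s)(m := s m))"
      using \<alpha>(3) K(2) by (simp add: cube_set_Suc)
    then show ?thesis by simp
  qed
  obtain b' where b': "lift_square (Suc m) X Y f (\<lambda>z. \<alpha> (1, z)) b'"
    "homotopic_squares (Suc m) X Y f a b (\<lambda>z. \<alpha> (1, z)) b'"
    using homotopic_squares_extend[OF sq f \<alpha>(1) \<alpha>0] by blast
  let ?p = "\<lambda>i. if i \<le> m then 0 else undefined :: real"
  have "?p \<in> cube_boundary (Suc m)" by (auto simp: cube_boundary_iff in_cube_set)
  then have p: "a ?p \<in> topspace X" using a by (auto simp: continuous_map_def)
  have "\<alpha> (1, s) = a ?p" if "s \<in> open_box m" for s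
    using that by (simp add: \<alpha>(2) \<kappa>_def box_contract_1)
  from that[OF p this b'] show thesis .
qed

text \<open>Once the boundary map is constant on the open box, its top face is an
  \<open>m\<close>-cube at \<open>x\<close>, and the cube in \<open>Y\<close> is a null homotopy of
  the image of this \<open>m\<close>-cube. Injectivity in dimension \<open>m\<close> deforms the
  boundary map to a constant. What remains is a cube of dimension \<open>m + 1\<close> in
  \<open>Y\<close> based at \<open>f x\<close>, which surjectivity in that dimension lifts up to
  homotopy.\<close>

lemma weak_homotopy_equivalence_imp_lifts_cubes:
  assumes W: "weak_homotopy_equivalence X Y f"
  shows "lifts_cubes n X Y f"
proof (cases n)
  case 0
  show ?thesis
    unfolding lifts_cubes_def
  proof (intro allI impI)
    fix a b assume "lift_square n X Y f a b"
    then have "b (\<lambda>_. undefined) \<in> topspace Y"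
      by (auto simp: lift_square_def continuous_map_def 0 cube_set_0)
    then obtain x where x: "x \<in> topspace X" "path_component_of Y (f x) (b (\<lambda>_. undefined))"
      using W unfolding weak_homotopy_equivalence_iff by blast
    obtain L where L: "continuous_map (top_of_set ({0..1::real} \<times> cube_set 0)) Y L"
     "\<forall>s\<in>cube_set 0. L (0, s) = f x \<and> L (1, s) = b (\<lambda>_. undefined)"
      using x(2) unfolding path_component_of_cube_0 by blast
    show "\<exists>A L. continuous_map (top_of_set (cube_set n)) X A \<and>
        continuous_map (top_of_set ({0..1::real} \<times> cube_set n)) Y L \<and>
        (\<forall>z\<in>cube_boundary n. A z = a z) \<and>
        (\<forall>x\<in>cube_set n. L (0, x) = f (A x) \<and> L (1, x) = b x) \<and>
        (\<forall>t\<in>{0..1::real}. \<forall>z\<in>cube_boundary n. L (t, z) = b z)"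
      using L x(1) unfolding 0 by (intro exI[of _ "\<lambda>_. x"] exI[of _ L]) (simp add: cube_set_0)
  qed
next
  case (Suc m)
  have f: "continuous_map X Y f" using W by (simp add: weak_homotopy_equivalence_def)
  show ?thesis
    unfolding Suc
  proof (rule lifts_cubesI)
    fix a b assume "lift_square (Suc m) X Y f a b"
    then obtain x a1 b1 where x: "x \<in> topspace X" and a1: "\<And>s. s \<in> open_box m \<Longrightarrow> a1 s = x"
      and sq1: "lift_square (Suc m) X Y f a1 b1" and hom1: "homotopic_squares (Suc m) X Y f a b a1 b1"
      using square_contract_box[OF f] by metis
    have a1c: "continuous_map (top_of_set (cube_boundary (Suc m))) X a1"
      and b1c: "continuous_map (top_of_set (cube_set (Suc m))) Y b1"
      and fa1: "\<And>z. z \<in> cube_boundary (Suc m) \<Longrightarrow> f (a1 z) = b1 z"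
      using sq1 by (simp_all add: lift_square_def)
    have up: "y(m := 1) \<in> cube_boundary (Suc m)" if "y \<in> cube_set m" for y
      using that by (simp add: cube_boundary_Suc cube_upd_in)
    have upJ: "z(m := t) \<in> open_box m" if "z \<in> cube_boundary m" "0 \<le> t" "t \<le> 1" for z t
    proof -
      have "z \<in> cube_set m" using that cube_boundary_subset by blast
      then show ?thesis using that by (simp add: open_box_def cube_upd_in cube_drop_upd)
    qed
    have b1J: "b1 s = f x" if "s \<in> open_box m" for s
      using a1[OF that] fa1[OF subsetD[OF open_box_subset that]] by simp
    define g where "g y = a1 (y(m := 1))" for y
    have g: "g \<in> based_cubes m X x"
      unfolding based_cubes_iff g_def
    proof
      show "continuous_map (top_of_set (cube_set m)) X (\<lambda>y. a1 (y(m := 1)))"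
        by (rule continuous_map_top_of_set_compose[OF a1c])
          (auto intro!: continuous_on_fun_upd continuous_intros simp: up)
    qed (simp add: a1 upJ)
    have cx: "(\<lambda>_. x) \<in> based_cubes m X x" using x by (simp add: based_cubes_iff)
    \<comment> \<open>The top face is slid down through the cube to the bottom, where
      \<open>b1\<close> is constant.\<close>
    have "(f \<circ> g, f \<circ> (\<lambda>_. x)) \<in> based_homotopy m Y (f x)"
    proof (rule based_homotopyI)
      show "continuous_map (top_of_set ({0..1::real} \<times> cube_set m)) Y (\<lambda>p. b1 ((snd p)(m := 1 - fst p)))"
        by (rule continuous_map_top_of_set_compose[OF b1c])
          (auto intro!: continuous_on_fun_upd continuous_intros cube_upd_in)
      show "b1 ((snd (0, y))(m := 1 - fst (0, y))) = (f \<circ> g) y" if "y \<in> cube_set m" for y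
        using fa1[OF up[OF that]] by (simp add: g_def)
      show "b1 ((snd (1, y))(m := 1 - fst (1, y))) = (f \<circ> (\<lambda>_. x)) y" if "y \<in> cube_set m" for y
        using that by (simp add: b1J open_box_def cube_upd_in)
    qed (use b1J upJ in auto)
    then have "(g, \<lambda>_. x) \<in> based_homotopy m X x"
      using W x g cx unfolding weak_homotopy_equivalence_iff by blast
    then obtain K where K: "continuous_map (top_of_set ({0..1::real} \<times> cube_set m)) X K"
      "\<And>s. s \<in> cube_set m \<Longrightarrow> K (0, s) = g s" "\<And>s. s \<in> cube_set m \<Longrightarrow> K (1, s) = x"
      "\<And>t z. t \<in> {0..1} \<Longrightarrow> z \<in> cube_boundary m \<Longrightarrow> K (t, z) = x"
      by (rule based_homotopyE) blast
    \<comment> \<open>The null homotopy on the top face and the constant on the open box form one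
      homotopy from the boundary map to a constant.\<close>
    have "continuous_map (top_of_set ({0..1::real} \<times> open_box m)) X (\<lambda>_. x)" using x by simp
    then obtain \<alpha> where \<alpha>: "continuous_map (top_of_set ({0..1::real} \<times> cube_boundary (Suc m))) X \<alpha>"
      "\<And>t s. t \<in> {0..1} \<Longrightarrow> s \<in> open_box m \<Longrightarrow> \<alpha> (t, s) = x"
      "\<And>t s. t \<in> {0..1} \<Longrightarrow> s \<in> cube_set (Suc m) \<Longrightarrow> s m = 1 \<Longrightarrow> \<alpha> (t, s) = K (t, cube_drop m s)"
      using continuous_map_box_paste[OF _ K(1) K(4)] by blast
    have top: "s \<in> cube_set (Suc m)" "s m = 1" "cube_drop m s \<in> cube_set m"
      if "s \<in> cube_boundary (Suc m)" "s \<notin> open_box m" for s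
      using that by (auto simp: cube_boundary_Suc open_box_def cube_set_Suc)
    have \<alpha>0: "\<alpha> (0, s) = a1 s" if s: "s \<in> cube_boundary (Suc m)" for s
    proof (cases "s \<in> open_box m")
      case True
      then show ?thesis by (simp add: \<alpha>(2) a1)
    next
      case False
      then have "\<alpha> (0, s) = a1 ((cube_drop m s)(m := s m))"
        using \<alpha>(3) K(2) top[OF s] by (simp add: g_def)
      then show ?thesis by simp
    qed
    have \<alpha>1: "\<alpha> (1, s) = x" if s: "s \<in> cube_boundary (Suc m)" for s
      using \<alpha>(2)[of 1 s] \<alpha>(3)[of 1 s] K(3) top[OF s] by (cases "s \<in> open_box m") auto
    obtain b2 where sq2: "lift_square (Suc m) X Y f (\<lambda>z. \<alpha> (1, z)) b2"
      and hom2: "homotopic_squares (Suc m) X Y f a1 b1 (\<lambda>z. \<alpha> (1, z)) b2"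
      using homotopic_squares_extend[OF sq1 f \<alpha>(1) \<alpha>0] by blast
    have "b2 \<in> based_cubes (Suc m) Y (f x)"
      using sq2 by (auto simp: lift_square_def based_cubes_iff \<alpha>1)
    then obtain h where h: "h \<in> based_cubes (Suc m) X x" "(f \<circ> h, b2) \<in> based_homotopy (Suc m) Y (f x)"
      using W x unfolding weak_homotopy_equivalence_iff by (metis Suc_eq_plus1 le_add2)
    obtain L where L: "continuous_map (top_of_set ({0..1::real} \<times> cube_set (Suc m))) Y L"
      "\<And>s. s \<in> cube_set (Suc m) \<Longrightarrow> L (0, s) = (f \<circ> h) s" "\<And>s. s \<in> cube_set (Suc m) \<Longrightarrow> L (1, s) = b2 s"
      "\<And>t z. t \<in> {0..1} \<Longrightarrow> z \<in> cube_boundary (Suc m) \<Longrightarrow> L (t, z) = f x"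
      using h(2) by (rule based_homotopyE) blast
    \<comment> \<open>The homotopy from \<open>f \<circ> h\<close> to \<open>b2\<close> is run
      backwards; it rests at \<open>f x\<close> on the boundary, so the upper map can rest at
      \<open>x\<close>.\<close>
    have hom3: "homotopic_squares (Suc m) X Y f (\<lambda>z. \<alpha> (1, z)) b2 (\<lambda>_. x) (f \<circ> h)"
      unfolding homotopic_squares_def
    proof (intro exI conjI)
      show "continuous_map (top_of_set ({0..1::real} \<times> cube_boundary (Suc m))) X (\<lambda>_. x)" using x by simp
      show "continuous_map (top_of_set ({0..1::real} \<times> cube_set (Suc m))) Y (\<lambda>p. L (1 - fst p, snd p))"
        by (rule continuous_map_top_of_set_compose[OF L(1)]) (auto intro!: continuous_intros)
    qed (use L(2-4) \<alpha>1 in auto)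
    have "liftable_square (Suc m) X Y f (\<lambda>_. x) (f \<circ> h)"
      using h(1) unfolding liftable_square_def based_cubes_iff by (intro exI[of _ h]) simp
    then show "\<exists>a' b'. homotopic_squares (Suc m) X Y f a b a' b' \<and> liftable_square (Suc m) X Y f a' b'"
      using homotopic_squares_trans[OF hom1 homotopic_squares_trans[OF hom2 hom3]] by blast
  qed
qed

text \<open>A homotopy between \<open>f \<circ> g\<close> and \<open>f \<circ> h\<close> is a cube
  of one dimension more whose boundary is lifted by \<open>g\<close>, \<open>h\<close> and the
  constant \<open>x\<close>; its lift is a homotopy between \<open>g\<close> and \<open>h\<close>.
  Surjectivity comes from 0-cubes for path components and, in dimensions from 1 on, from squares
  with constant boundary map.\<close>

lemma lifts_cubes_imp_weak_homotopy_equivalence: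
  assumes f: "continuous_map X Y f" and lc: "\<And>n. lifts_cubes n X Y f"
  shows "weak_homotopy_equivalence X Y f"
  unfolding weak_homotopy_equivalence_iff
proof (intro conjI f ballI allI impI)
  fix y assume y: "y \<in> topspace Y"
  \<comment> \<open>The boundary of the 0-cube is empty, so any function serves as boundary map,
    even into an empty \<open>X\<close>.\<close>
  have "lift_square 0 X Y f (\<lambda>_. undefined) (\<lambda>_. y)" using y by (simp add: lift_square_def)
  from lifts_cubesD[OF lc this] obtain A L where A: "continuous_map (top_of_set (cube_set 0)) X A"
    "continuous_map (top_of_set ({0..1::real} \<times> cube_set 0)) Y L"
    "\<And>x. x \<in> cube_set 0 \<Longrightarrow> L (0, x) = f (A x)" "\<And>x. x \<in> cube_set 0 \<Longrightarrow> L (1, x) = y"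
    by metis
  have "A (\<lambda>_. undefined) \<in> topspace X" using A(1) by (auto simp: continuous_map_def cube_set_0)
  moreover have "path_component_of Y (f (A (\<lambda>_. undefined))) y"
    unfolding path_component_of_cube_0 using A by (intro exI[of _ L]) (simp add: cube_set_0)
  ultimately show "\<exists>x\<in>topspace X. path_component_of Y (f x) y" by blast
next
  fix m x g h assume x: "x \<in> topspace X" and g: "g \<in> based_cubes m X x" and h: "h \<in> based_cubes m X x"
    and gh: "(f \<circ> g, f \<circ> h) \<in> based_homotopy m Y (f x)"
  obtain L where L: "continuous_map (top_of_set ({0..1::real} \<times> cube_set m)) Y L"
      "\<And>s. s \<in> cube_set m \<Longrightarrow> L (0, s) = (f \<circ> g) s" "\<And>s. s \<in> cube_set m \<Longrightarrow> L (1, s) = (f \<circ> h) s"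
      "\<And>t z. t \<in> {0..1} \<Longrightarrow> z \<in> cube_boundary m \<Longrightarrow> L (t, z) = f x"
    using gh by (rule based_homotopyE) blast
  have gc: "continuous_map (top_of_set (cube_set m)) X g" "\<And>z. z \<in> cube_boundary m \<Longrightarrow> g z = x"
    and hc: "continuous_map (top_of_set (cube_set m)) X h" "\<And>z. z \<in> cube_boundary m \<Longrightarrow> h z = x"
    using g h by (simp_all add: based_cubes_iff)
  \<comment> \<open>Coordinate \<open>m\<close> plays the role of time: \<open>g\<close> at 0,
    \<open>h\<close> at 1 and the base point on the sides, where \<open>g\<close> and
    \<open>h\<close> have that value too.\<close>
  define a where "a s = (if s m = 0 then g (cube_drop m s) else if s m = 1 then h (cube_drop m s) else x)" for s
  define b where "b s = L (s m, cube_drop m s)" for s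
  let ?bot = "{s \<in> cube_set (Suc m). s m = 0}" and ?top = "{s \<in> cube_set (Suc m). s m = 1}"
  let ?side = "{s \<in> cube_set (Suc m). cube_drop m s \<in> cube_boundary m}"
  have bd: "cube_boundary (Suc m) = ?bot \<union> (?top \<union> ?side)" by (auto simp: cube_boundary_Suc)
  have "?bot = cube_set (Suc m) \<inter> {s. s m = 0}" "?top = cube_set (Suc m) \<inter> {s. s m = 1}"
    "?side = cube_set (Suc m) \<inter> cube_drop m -` cube_boundary m" by auto
  moreover have "closed (cube_drop m -` cube_boundary m)"
    by (rule closed_vimage[OF closed_cube_boundary]) (auto intro!: continuous_intros)
  ultimately have cl: "closed ?bot" "closed ?top" "closed ?side"
    by (simp_all add: closed_Int closed_cube_set closed_Collect_eq)
  have ac: "continuous_map (top_of_set (cube_boundary (Suc m))) X a"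
    unfolding bd
  proof (rule continuous_map_top_of_set_paste[OF _ _ order_refl])
    show "closedin (top_of_set (?bot \<union> (?top \<union> ?side))) ?bot"
      "closedin (top_of_set (?bot \<union> (?top \<union> ?side))) (?top \<union> ?side)"
      using cl by (auto intro!: closed_subset)
    have "continuous_map (top_of_set ?bot) X (\<lambda>s. g (cube_drop m s))"
      by (rule continuous_map_top_of_set_compose[OF gc(1)]) (auto intro!: continuous_intros simp: cube_set_Suc)
    then show "continuous_map (top_of_set ?bot) X a" by (rule continuous_map_eq) (simp add: a_def)
    show "continuous_map (top_of_set (?top \<union> ?side)) X a"
    proof (rule continuous_map_top_of_set_paste[OF _ _ order_refl])
      show "closedin (top_of_set (?top \<union> ?side)) ?top" "closedin (top_of_set (?top \<union> ?side)) ?side"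
        using cl by (auto intro!: closed_subset)
      have "continuous_map (top_of_set ?top) X (\<lambda>s. h (cube_drop m s))"
        by (rule continuous_map_top_of_set_compose[OF hc(1)]) (auto intro!: continuous_intros simp: cube_set_Suc)
      then show "continuous_map (top_of_set ?top) X a" by (rule continuous_map_eq) (simp add: a_def)
      have "continuous_map (top_of_set ?side) X (\<lambda>s. x)" using x by simp
      then show "continuous_map (top_of_set ?side) X a"
        by (rule continuous_map_eq) (simp add: a_def gc hc)
    qed
  qed
  have sc: "continuous_on S (\<lambda>s :: nat \<Rightarrow> real. s m)" for S by (rule continuous_on_eval)
  have "lift_square (Suc m) X Y f a b"
    unfolding lift_square_def
  proof (intro conjI ac ballI)
    show "continuous_map (top_of_set (cube_set (Suc m))) Y b"
      unfolding b_def
      by (rule continuous_map_top_of_set_compose[OF L(1)]) (auto intro!: continuous_intros sc simp: cube_set_Suc)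
    show "f (a s) = b s" if "s \<in> cube_boundary (Suc m)" for s
      using that L(2-4) by (auto simp: a_def b_def cube_boundary_Suc cube_set_Suc)
  qed
  from lifts_cubesD[OF lc this] obtain A where A: "continuous_map (top_of_set (cube_set (Suc m))) X A"
    "\<And>z. z \<in> cube_boundary (Suc m) \<Longrightarrow> A z = a z" by metis
  show "(g, h) \<in> based_homotopy m X x"
  proof (rule based_homotopyI)
    show "continuous_map (top_of_set ({0..1::real} \<times> cube_set m)) X (\<lambda>p. A ((snd p)(m := fst p)))"
      by (rule continuous_map_top_of_set_compose[OF A(1)])
        (auto intro!: continuous_on_fun_upd continuous_intros cube_upd_in)
    show "A ((snd (0, s))(m := fst (0, s))) = g s" "A ((snd (1, s))(m := fst (1, s))) = h s" if "s \<in> cube_set m" for s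
      using that by (simp_all add: A(2) cube_boundary_Suc cube_upd_in cube_drop_upd a_def)
    show "A ((snd (t, z))(m := fst (t, z))) = x" if "t \<in> {0..1}" "z \<in> cube_boundary m" for t z
    proof -
      have "z \<in> cube_set m" using that cube_boundary_subset by blast
      then show ?thesis
        using that by (simp add: A(2) cube_boundary_Suc cube_upd_in cube_drop_upd a_def gc hc)
    qed
  qed
next
  fix n x b assume n: "n \<ge> (1::nat)" and x: "x \<in> topspace X" and b: "b \<in> based_cubes n Y (f x)"
  then have "lift_square n X Y f (\<lambda>_. x) b" by (simp add: lift_square_def based_cubes_iff)
  from lifts_cubesD[OF lc this] obtain A L where A: "continuous_map (top_of_set (cube_set n)) X A"
    "continuous_map (top_of_set ({0..1::real} \<times> cube_set n)) Y L"
    "\<And>z. z \<in> cube_boundary n \<Longrightarrow> A z = x"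
    "\<And>x. x \<in> cube_set n \<Longrightarrow> L (0, x) = f (A x)" "\<And>x. x \<in> cube_set n \<Longrightarrow> L (1, x) = b x"
    "\<And>t z. t \<in> {0..1::real} \<Longrightarrow> z \<in> cube_boundary n \<Longrightarrow> L (t, z) = b z"
    by metis
  show "\<exists>g\<in>based_cubes n X x. (f \<circ> g, b) \<in> based_homotopy n Y (f x)"
  proof
    show "A \<in> based_cubes n X x" using A(1,3) by (simp add: based_cubes_iff)
    show "(f \<circ> A, b) \<in> based_homotopy n Y (f x)"
      by (rule based_homotopyI[OF A(2)]) (use A b in \<open>auto simp: based_cubes_iff\<close>)
  qed
qed

section \<open>Products with a compact Hausdorff space\<close>

text \<open>At a point of a k-open set, regularity of \<open>K\<close> gives a closed neighbourhood
  \<open>L\<close> of the second coordinate inside the slice. The points of \<open>X\<close> whose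
  slice contains all of \<open>L\<close> form a k-open set, by the tube lemma over each test space,
  and hence an open one.\<close>

lemma kprod_topology_compact_Hausdorff:
  assumes X: "compactly_generated X" and K: "compact_space K" "Hausdorff_space K"
  shows "kprod_topology X K = prod_topology X K"
  unfolding topology_eq kprod_topology_def openin_cg_coreflection
proof (intro allI iffI)
  fix U assume U: "k_openin (prod_topology X K) U"
  then have UXK: "U \<subseteq> topspace X \<times> topspace K" by (simp add: k_openin_def)
  show "openin (prod_topology X K) U"
    unfolding openin_prod_topology_alt
  proof (intro allI impI)
    fix x0 t0 assume xt: "(x0, t0) \<in> U"
    then have x0: "x0 \<in> topspace X" and t0: "t0 \<in> topspace K" using UXK by auto
    have "continuous_map K (prod_topology X K) (\<lambda>t. (x0, t))"
      using x0 by (simp add: continuous_map_paired)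
    from k_openin_compact_Hausdorff[OF U K this]
    have sl: "openin K {t \<in> topspace K. (x0, t) \<in> U} \<and> t0 \<in> {t \<in> topspace K. (x0, t) \<in> U}"
      using t0 xt by simp
    have "regular_space K" using K by (rule compact_Hausdorff_imp_regular_space)
    then have "\<forall>T z. openin K T \<and> z \<in> T \<longrightarrow>
        (\<exists>W C. openin K W \<and> closedin K C \<and> z \<in> W \<and> W \<subseteq> C \<and> C \<subseteq> T)"
      unfolding neighbourhood_base_of_closedin[symmetric] neighbourhood_base_of .
    from this[rule_format, OF sl]
    obtain W L where W: "openin K W" "closedin K L" "t0 \<in> W" "W \<subseteq> L" "L \<subseteq> {t \<in> topspace K. (x0, t) \<in> U}"
      by (elim exE conjE)
    have LK: "L \<subseteq> topspace K" using W(5) by auto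
    define KL where "KL = subtopology K L"
    have tKL: "topspace KL = L" using LK by (auto simp: KL_def)
    have KL: "compact_space KL" "Hausdorff_space KL"
      unfolding KL_def using K W(2)
      by (auto simp: closedin_compact_space compact_space_subtopology Hausdorff_space_subtopology)
    define V where "V = {x \<in> topspace X. \<forall>t\<in>L. (x, t) \<in> U}"
    have "k_openin X V"
      unfolding k_openin_def
    proof (intro conjI allI impI)
      show "V \<subseteq> topspace X" by (auto simp: V_def)
      fix K' :: "'a list set set topology" and u
      assume *: "compact_space K' \<and> Hausdorff_space K' \<and> continuous_map K' X u"
      define Q where "Q = {p \<in> topspace (prod_topology K' KL). (u (fst p), snd p) \<in> U}"
      have "continuous_map (prod_topology K' KL) (prod_topology X K) (\<lambda>p. (u (fst p), snd p))"
        unfolding continuous_map_paired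
      proof
        show "continuous_map (prod_topology K' KL) X (\<lambda>p. u (fst p))"
          using continuous_map_compose[OF continuous_map_fst, of K' X u KL] * by (simp add: o_def)
        show "continuous_map (prod_topology K' KL) K snd"
          using continuous_map_snd[of K' KL] by (simp add: KL_def continuous_map_in_subtopology)
      qed
      \<comment> \<open>The product of the test space with \<open>KL\<close> is compact Hausdorff
        but lives on another type than the test spaces of the definition;
        \<open>k_openin_compact_Hausdorff\<close> admits it nevertheless.\<close>
      then have Q: "openin (prod_topology K' KL) Q"
        unfolding Q_def using * KL
        by (intro k_openin_compact_Hausdorff[OF U])
          (auto simp: compact_space_prod_topology Hausdorff_space_prod_topology)
      show "openin K' {z \<in> topspace K'. u z \<in> V}"
      proof (subst openin_subopen, intro ballI)
        fix z assume z: "z \<in> {z \<in> topspace K'. u z \<in> V}"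
        have "compactin KL L" using KL(1) tKL by (simp add: compact_space_def)
        moreover have "{z} \<times> L \<subseteq> Q" using z by (auto simp: Q_def V_def tKL)
        ultimately have "\<exists>A B. openin K' A \<and> openin KL B \<and> z \<in> A \<and> L \<subseteq> B \<and> A \<times> B \<subseteq> Q"
          using z by (intro tube_lemma_right[OF Q]) auto
        then obtain A B where AB: "openin K' A" "z \<in> A" "L \<subseteq> B" "A \<times> B \<subseteq> Q" by blast
        have "A \<subseteq> {z \<in> topspace K'. u z \<in> V}"
        proof
          fix y assume y: "y \<in> A"
          then have y': "y \<in> topspace K'" using AB(1) openin_subset by blast
          then have "u y \<in> topspace X" using * by (auto simp: continuous_map_def)
          moreover have "(u y, t) \<in> U" if "t \<in> L" for t
          proof -
            have "(y, t) \<in> Q" using AB(3,4) y that by blast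
            then show ?thesis by (simp add: Q_def)
          qed
          ultimately show "y \<in> {z \<in> topspace K'. u z \<in> V}" using y' by (simp add: V_def)
        qed
        with AB(1,2) show "\<exists>T. openin K' T \<and> z \<in> T \<and> T \<subseteq> {z \<in> topspace K'. u z \<in> V}" by blast
      qed
    qed
    then have "openin X V" using X by (simp add: compactly_generated_def)
    moreover have "x0 \<in> V" using x0 W(5) by (auto simp: V_def)
    moreover have "V \<times> W \<subseteq> U" using W(4) by (auto simp: V_def)
    ultimately show "\<exists>V W. openin X V \<and> openin K W \<and> x0 \<in> V \<and> t0 \<in> W \<and> V \<times> W \<subseteq> U"
      using W(1,3) by blast
  qed
qed (rule openin_imp_k_openin)

lemma simplex_topology_compact_Hausdorff:
  "compact_space (simplex_topology p)" "Hausdorff_space (simplex_topology p)"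
  unfolding simplex_topology_def
  by (simp_all add: compact_space_subtopology compactin_standard_simplex Hausdorff_space_subtopology
      Hausdorff_space_product_topology)

lemma topspace_simplex_topology [simp]: "topspace (simplex_topology p) = standard_simplex p"
  by (simp add: simplex_topology_def)

text \<open>Simplices are compact Hausdorff and the levels are compactly generated, so the
  coreflection changes nothing and continuity can be checked in ordinary products.\<close>

lemma prerealisation_eq:
  assumes "semisimplicial_space X d"
  shows "prerealisation X = sum_topology (\<lambda>p. prod_topology (X p) (simplex_topology p)) UNIV"
  using assms unfolding prerealisation_def semisimplicial_space_def
  by (simp add: kprod_topology_compact_Hausdorff simplex_topology_compact_Hausdorff)

section \<open>Normal forms in the realisation\<close>

definition delete_coord :: "nat \<Rightarrow> (nat \<Rightarrow> real) \<Rightarrow> nat \<Rightarrow> real" where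
  "delete_coord i t = (\<lambda>j. if j < i then t j else t (Suc j))"

lemma delete_coord_face [simp]: "delete_coord i (simplical_face i t) = t"
  by (auto simp: delete_coord_def simplical_face_def)

lemma face_delete_coord: "t i = 0 \<Longrightarrow> simplical_face i (delete_coord i t) = t"
proof
  show "simplical_face i (delete_coord i t) j = t j" if "t i = 0" for j
    using that by (cases j i rule: linorder_cases) (auto simp: delete_coord_def simplical_face_def)
qed

lemma delete_coord_face_less:
  "i < k \<Longrightarrow> delete_coord i (simplical_face k t) = simplical_face (k - 1) (delete_coord i t)"
  by (auto simp: delete_coord_def simplical_face_def fun_eq_iff)

lemma sum_simplical_face:
  fixes s :: "nat \<Rightarrow> real"
  assumes "i \<le> Suc p" shows "(\<Sum>j\<le>Suc p. simplical_face i s j) = (\<Sum>j\<le>p. s j)"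
  using assms
proof (induction p)
  case 0
  then show ?case by (cases i) (auto simp: simplical_face_def)
next
  case (Suc p)
  show ?case
  proof (cases "i = Suc (Suc p)")
    case True
    then show ?thesis by (simp add: simplical_face_def)
  next
    case False
    then have "simplical_face i s (Suc (Suc p)) = s (Suc p)" using Suc.prems by (simp add: simplical_face_def)
    then show ?thesis using Suc False by simp
  qed
qed

lemma delete_coord_in_simplex:
  assumes t: "t \<in> standard_simplex (Suc p)" and i: "i \<le> Suc p" "t i = 0"
  shows "delete_coord i t \<in> standard_simplex p"
proof -
  have "(\<Sum>j\<le>p. delete_coord i t j) = (\<Sum>j\<le>Suc p. t j)"
    using sum_simplical_face[OF i(1), of "delete_coord i t"] face_delete_coord[of t i] i(2) by simp
  then show ?thesis using t i(1) by (auto simp: standard_simplex_def delete_coord_def)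
qed

text \<open>The representative without zero coordinates. Taking the least zero is a mere choice,
  whose irrelevance is \<open>normal_form_face\<close>. Level 0 stops at once, because the only
  coordinate of a point of the 0-simplex is 1.\<close>

fun normal_form :: "(nat \<Rightarrow> nat \<Rightarrow> 'a \<Rightarrow> 'a) \<Rightarrow> nat \<Rightarrow> 'a \<Rightarrow> (nat \<Rightarrow> real) \<Rightarrow> nat \<times> 'a \<times> (nat \<Rightarrow> real)" where
  "normal_form d 0 x t = (0, x, t)"
| "normal_form d (Suc p) x t = (if \<exists>i\<le>Suc p. t i = 0
     then normal_form d p (d (Suc p) (LEAST i. t i = 0) x) (delete_coord (LEAST i. t i = 0) t)
     else (Suc p, x, t))"

lemma Least_zero:
  fixes t :: "nat \<Rightarrow> real"
  assumes "\<exists>i\<le>p. t i = 0" shows "(LEAST i. t i = 0) \<le> p" "t (LEAST i. t i = 0) = 0"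
proof -
  obtain i where i: "i \<le> p" "t i = 0" using assms by blast
  show "t (LEAST i. t i = 0) = 0" using i(2) by (rule LeastI)
  show "(LEAST i. t i = 0) \<le> p" using Least_le[of "\<lambda>i. t i = 0" i] i by simp
qed

lemma semisimplicial_face_in:
  assumes "semisimplicial_space X d" "i \<le> Suc p" "x \<in> topspace (X (Suc p))"
  shows "d (Suc p) i x \<in> topspace (X p)"
  using assms unfolding semisimplicial_space_def by (auto simp: continuous_map_def)

lemma realisation_rel_face:
  assumes "semisimplicial_space X d" "i \<le> Suc p" "x \<in> topspace (X (Suc p))" "t \<in> standard_simplex p"
  shows "((Suc p, x, simplical_face i t), (p, d (Suc p) i x, t)) \<in> realisation_rel X d"
proof -
  have "((Suc p, x, simplical_face i t), (p, d (Suc p) i x, t)) \<in> face_gluing X d"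
    using assms by (auto simp: face_gluing_def)
  then show ?thesis
    using face_gluing_subset[OF assms(1)] unfolding realisation_rel_def by blast
qed

lemma normal_form_rel:
  assumes X: "semisimplicial_space X d"
  shows "x \<in> topspace (X p) \<Longrightarrow> t \<in> standard_simplex p \<Longrightarrow>
    ((p, x, t), normal_form d p x t) \<in> realisation_rel X d"
proof (induction p arbitrary: x t)
  case 0
  then have "(0, x, t) \<in> topspace (prerealisation X)" by (simp add: topspace_prerealisation)
  then show ?case using equiv_realisation_rel[of X d] by (simp add: equiv_def refl_on_def)
next
  case (Suc p)
  show ?case
  proof (cases "\<exists>i\<le>Suc p. t i = 0")
    case True
    define i where "i = (LEAST i. t i = 0)"
    have i: "i \<le> Suc p" "t i = 0" using Least_zero[OF True] by (auto simp: i_def)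
    have del: "delete_coord i t \<in> standard_simplex p"
      using delete_coord_in_simplex[OF Suc.prems(2) i] .
    have "((Suc p, x, t), (p, d (Suc p) i x, delete_coord i t)) \<in> realisation_rel X d"
      using realisation_rel_face[OF X i(1) Suc.prems(1) del] by (simp add: face_delete_coord[of t i] i)
    moreover have "((p, d (Suc p) i x, delete_coord i t),
        normal_form d p (d (Suc p) i x) (delete_coord i t)) \<in> realisation_rel X d"
      using Suc.IH[OF semisimplicial_face_in[OF X i(1) Suc.prems(1)] del] .
    ultimately have "((Suc p, x, t), normal_form d p (d (Suc p) i x) (delete_coord i t)) \<in> realisation_rel X d"
      using equiv_realisation_rel[of X d] by (meson equivE transD)
    then show ?thesis using True by (simp add: i_def)
  next
    case False
    have "(Suc p, x, t) \<in> topspace (prerealisation X)" using Suc.prems by (simp add: topspace_prerealisation)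
    then have "((Suc p, x, t), (Suc p, x, t)) \<in> realisation_rel X d"
      using equiv_realisation_rel[of X d] by (simp add: equiv_def refl_on_def)
    then show ?thesis unfolding normal_form.simps if_not_P[OF False] .
  qed
qed

text \<open>Makes the normal form a function on the points of the realisation. If the least zero of
  the coface is not the inserted one, it is a zero \<open>k < i\<close> of \<open>t\<close>;
  deleting it commutes with the insertion up to a shift of the index, and the simplicial identity
  exchanges the two face maps, which reduces the dimension.\<close>

lemma normal_form_face:
  assumes X: "semisimplicial_space X d"
  shows "i \<le> Suc p \<Longrightarrow> x \<in> topspace (X (Suc p)) \<Longrightarrow> t \<in> standard_simplex p \<Longrightarrow>
    normal_form d (Suc p) x (simplical_face i t) = normal_form d p (d (Suc p) i x) t"
proof (induction p arbitrary: i x t)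
  case (0 i x t)
  \<comment> \<open>With this, no zero of the coface can precede the inserted one.\<close>
  have t: "t 0 = 1" using 0 by (simp add: standard_simplex_0)
  have "simplical_face i t i = 0" by (simp add: simplical_face_def)
  moreover have "i \<le> j" if "simplical_face i t j = 0" for j
  proof (rule ccontr)
    assume "\<not> i \<le> j"
    then have "j = 0" "j < i" using 0 by auto
    then show False using that t by (simp add: simplical_face_def)
  qed
  ultimately have "(LEAST j. simplical_face i t j = 0) = i" by (intro Least_equality)
  moreover have "\<exists>j\<le>Suc 0. simplical_face i t j = 0" using 0 by (intro exI[of _ i]) (simp add: simplical_face_def)
  ultimately show ?case by simp
next
  case (Suc p i x t)
  define k where "k = (LEAST j. simplical_face i t j = 0)"
  have ex: "\<exists>j\<le>Suc (Suc p). simplical_face i t j = 0"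
    using Suc.prems by (intro exI[of _ i]) (simp add: simplical_face_def)
  have k: "simplical_face i t k = 0" "k \<le> i"
    using Least_zero(2)[OF ex] Least_le[of "\<lambda>j. simplical_face i t j = 0" i]
    by (simp_all add: k_def simplical_face_def)
  have nf: "normal_form d (Suc (Suc p)) x (simplical_face i t) =
      normal_form d (Suc p) (d (Suc (Suc p)) k x) (delete_coord k (simplical_face i t))"
    using ex by (simp add: k_def del: normal_form.simps(1))
  show ?case
  proof (cases "k = i")
    case True
    then show ?thesis using nf by simp
  next
    case False
    then have ki: "k < i" using k by simp
    then have tk: "t k = 0" using k by (simp add: simplical_face_def)
    have "k \<le> j" if "t j = 0" for j
    proof (rule ccontr)
      assume "\<not> k \<le> j"
      then have "simplical_face i t j = 0" using that ki by (simp add: simplical_face_def)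
      then have "k \<le> j" unfolding k_def by (rule Least_le)
      with \<open>\<not> k \<le> j\<close> show False by simp
    qed
    then have lk: "(LEAST j. t j = 0) = k" using tk by (intro Least_equality)
    have kp: "k \<le> Suc p" using ki Suc.prems by simp
    have del: "delete_coord k t \<in> standard_simplex p"
      using delete_coord_in_simplex[OF Suc.prems(3) kp tk] .
    have xk: "d (Suc (Suc p)) k x \<in> topspace (X (Suc p))"
      using semisimplicial_face_in[OF X _ Suc.prems(2)] kp by simp
    have "normal_form d (Suc (Suc p)) x (simplical_face i t) =
        normal_form d (Suc p) (d (Suc (Suc p)) k x) (simplical_face (i - 1) (delete_coord k t))"
      using nf delete_coord_face_less[OF ki] by simp
    also have "\<dots> = normal_form d p (d (Suc p) (i - 1) (d (Suc (Suc p)) k x)) (delete_coord k t)"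
      using Suc.IH[OF _ xk del] Suc.prems(1) by simp
    also have "d (Suc p) (i - 1) (d (Suc (Suc p)) k x) = d (Suc p) k (d (Suc (Suc p)) i x)"
      using X ki Suc.prems unfolding semisimplicial_space_def by simp
    also have "normal_form d p (d (Suc p) k (d (Suc (Suc p)) i x)) (delete_coord k t) =
        normal_form d (Suc p) (d (Suc (Suc p)) i x) t"
      using kp tk lk by auto
    finally show ?thesis .
  qed
qed

text \<open>Which coordinates are deleted depends on \<open>t\<close> alone, so the same face maps
  are applied on both sides, and \<open>f\<close> commutes with them.\<close>

lemma normal_form_natural:
  assumes X: "semisimplicial_space X dX" and f: "semisimplicial_map X dX Y dY f"
  shows "x \<in> topspace (X p) \<Longrightarrow> t \<in> standard_simplex p \<Longrightarrow>
    normal_form dY p (f p x) t = (case normal_form dX p x t of (q, y, s) \<Rightarrow> (q, f q y, s))"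
proof (induction p arbitrary: x t)
  case (Suc p)
  show ?case
  proof (cases "\<exists>i\<le>Suc p. t i = 0")
    case True
    define i where "i = (LEAST i. t i = 0)"
    have i: "i \<le> Suc p" "t i = 0" using Least_zero[OF True] by (auto simp: i_def)
    have "normal_form dY (Suc p) (f (Suc p) x) t = normal_form dY p (dY (Suc p) i (f (Suc p) x)) (delete_coord i t)"
      using True by (simp add: i_def)
    also have "dY (Suc p) i (f (Suc p) x) = f p (dX (Suc p) i x)"
      using f i(1) Suc.prems(1) by (simp add: semisimplicial_map_def)
    also have "normal_form dY p (f p (dX (Suc p) i x)) (delete_coord i t) =
        (case normal_form dX p (dX (Suc p) i x) (delete_coord i t) of (q, y, s) \<Rightarrow> (q, f q y, s))"
      using Suc.IH[OF semisimplicial_face_in[OF X i(1) Suc.prems(1)] delete_coord_in_simplex[OF Suc.prems(2) i]] .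
    also have "normal_form dX p (dX (Suc p) i x) (delete_coord i t) = normal_form dX (Suc p) x t"
      using True by (simp add: i_def)
    finally show ?thesis .
  qed auto
qed simp

section \<open>Gaps between the barycentric coordinates\<close>

text \<open>Comparing with all indices, and not only with those up to the level, amounts for a point
  of a simplex to comparing with the largest coordinate, in a form that does not mention the level
  and is stable under cofaces.\<close>

definition kept_coords :: "real \<Rightarrow> (nat \<Rightarrow> real) \<Rightarrow> nat set" where
  "kept_coords c t = {i. \<forall>j. c * t j < t i}"

text \<open>Every coordinate is either above or below \<open>c\<close> times the largest one.\<close>

definition has_gap :: "real \<Rightarrow> (nat \<Rightarrow> real) \<Rightarrow> bool" where
  "has_gap c t \<longleftrightarrow> (\<forall>i. (\<forall>j. c * t j < t i) \<or> (\<exists>j. t i < c * t j))"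

definition truncate_coords :: "real \<Rightarrow> nat \<Rightarrow> (nat \<Rightarrow> real) \<Rightarrow> nat \<Rightarrow> real" where
  "truncate_coords c p t = (\<lambda>i. (if i \<in> kept_coords c t then t i else 0) /
     (\<Sum>j\<le>p. if j \<in> kept_coords c t then t j else 0))"

definition truncate_homotopy :: "real \<Rightarrow> nat \<Rightarrow> real \<Rightarrow> (nat \<Rightarrow> real) \<Rightarrow> nat \<Rightarrow> real" where
  "truncate_homotopy c p u t = (\<lambda>i. (1 - u) * t i + u * truncate_coords c p t i)"

lemma simplex_max_coord:
  assumes "t \<in> standard_simplex p"
  obtains m where "m \<le> p" "t m > 0" "\<And>j. t j \<le> t m"
proof -
  have t: "\<And>i. 0 \<le> t i" "\<And>i. i > p \<Longrightarrow> t i = 0" "(\<Sum>i\<le>p. t i) = 1"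
    using assms by (auto simp: standard_simplex_def)
  have "Max (t ` {..p}) \<in> t ` {..p}" by (intro Max_in) auto
  then obtain m where m: "m \<in> {..p}" "t m = Max (t ` {..p})" by (metis imageE)
  have le: "t j \<le> t m" if "j \<le> p" for j using m(2) that by simp
  have "t m > 0"
  proof (rule ccontr)
    assume "\<not> t m > 0"
    then have "t j = 0" if "j \<le> p" for j using le[OF that] t(1)[of j] by simp
    then show False using t(3) by simp
  qed
  moreover have "t j \<le> t m" for j using le[of j] t(2)[of j] \<open>t m > 0\<close> by (cases "j \<le> p") auto
  ultimately show thesis using that m(1) by auto
qed

lemma kept_coords_pos:
  assumes "0 < c" "t \<in> standard_simplex p" "i \<in> kept_coords c t" shows "0 < t i"
proof -
  have "0 \<le> t 0" using assms by (auto simp: standard_simplex_def)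
  then have "0 \<le> c * t 0" using assms by simp
  also have "\<dots> < t i" using assms by (simp add: kept_coords_def)
  finally show ?thesis .
qed

text \<open>The largest coordinate is always kept because \<open>c < 1\<close>, so the
  renormalisation never divides by 0.\<close>

lemma truncate_sum:
  assumes c: "0 < c" "c < 1" and t: "t \<in> standard_simplex p"
  shows "0 < (\<Sum>j\<le>p. if j \<in> kept_coords c t then t j else 0)"
    "(\<Sum>j\<le>p. if j \<in> kept_coords c t then t j else 0) \<le> 1"
proof -
  have t': "\<And>i. 0 \<le> t i" "(\<Sum>i\<le>p. t i) = 1" using t by (auto simp: standard_simplex_def)
  obtain m where m: "m \<le> p" "t m > 0" "\<And>j. t j \<le> t m" using simplex_max_coord[OF t] by blast
  have "c * t j < t m" for j
  proof -
    have "c * t j \<le> c * t m" using m(3) c by simp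
    also have "\<dots> < t m" using c m(2) by simp
    finally show ?thesis .
  qed
  then have "m \<in> kept_coords c t" by (simp add: kept_coords_def)
  then show "0 < (\<Sum>j\<le>p. if j \<in> kept_coords c t then t j else 0)"
    using m(1,2) t'(1) by (intro sum_pos2[of _ m]) auto
  show "(\<Sum>j\<le>p. if j \<in> kept_coords c t then t j else 0) \<le> 1"
    using t'(1) unfolding t'(2)[symmetric] by (intro sum_mono) auto
qed

lemma truncate_coords_in_simplex:
  assumes c: "0 < c" "c < 1" and t: "t \<in> standard_simplex p"
  shows "truncate_coords c p t \<in> standard_simplex p"
proof -
  define S where "S = (\<Sum>j\<le>p. if j \<in> kept_coords c t then t j else 0)"
  have S: "0 < S" using truncate_sum[OF c t] by (simp add: S_def)
  have t': "\<And>i. 0 \<le> t i" "\<And>i. i > p \<Longrightarrow> t i = 0" using t by (auto simp: standard_simplex_def)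
  have le: "(if i \<in> kept_coords c t then t i else 0) \<le> S" for i
  proof (cases "i \<le> p")
    case True
    then show ?thesis unfolding S_def using t'(1) by (intro member_le_sum) auto
  next
    case False
    then show ?thesis using t'(2)[of i] S by auto
  qed
  have "(\<Sum>i\<le>p. truncate_coords c p t i) = 1"
    using S unfolding truncate_coords_def S_def[symmetric] sum_divide_distrib[symmetric] by simp
  moreover have "0 \<le> truncate_coords c p t i" "truncate_coords c p t i \<le> 1" for i
    using t'(1)[of i] le[of i] S unfolding truncate_coords_def S_def[symmetric] by (auto simp: divide_le_eq_1)
  moreover have "truncate_coords c p t i = 0" if "i > p" for i
    using t'(2)[OF that] by (simp add: truncate_coords_def)
  ultimately show ?thesis by (simp add: standard_simplex_def)
qed

lemma truncate_homotopy_in_simplex: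
  assumes "0 < c" "c < 1" "t \<in> standard_simplex p" "0 \<le> u" "u \<le> 1"
  shows "truncate_homotopy c p u t \<in> standard_simplex p"
  unfolding truncate_homotopy_def
  using assms by (intro convex_standard_simplex truncate_coords_in_simplex)

text \<open>Gap conditions depend on the coordinates only through the set of their values, to which
  a coface just adds 0.\<close>

lemma range_simplical_face:
  fixes t :: "nat \<Rightarrow> real"
  shows "range (simplical_face i t) = insert 0 (range t)"
proof
  show "range (simplical_face i t) \<subseteq> insert 0 (range t)" by (auto simp: simplical_face_def)
  have "t j = simplical_face i t (if j < i then j else Suc j)" for j by (auto simp: simplical_face_def)
  then have "t j \<in> range (simplical_face i t)" for j by (metis rangeI)
  moreover have "0 = simplical_face i t i" by (simp add: simplical_face_def)
  then have "0 \<in> range (simplical_face i t)" by (metis rangeI)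
  ultimately show "insert 0 (range t) \<subseteq> range (simplical_face i t)" by blast
qed

lemma face_all_less:
  assumes t: "t \<in> standard_simplex p" and c: "0 < (c::real)"
  shows "(\<forall>j. c * simplical_face i t j < v) \<longleftrightarrow> (\<forall>j. c * t j < v)"
proof -
  have "(\<forall>j. c * simplical_face i t j < v) \<longleftrightarrow> (\<forall>w\<in>insert 0 (range t). c * w < v)"
    unfolding range_simplical_face[symmetric, of t i] by auto
  moreover have "0 < v" if "\<forall>j. c * t j < v"
  proof -
    have "0 \<le> c * t 0" using t c by (auto simp: standard_simplex_def)
    also have "\<dots> < v" using that by blast
    finally show ?thesis .
  qed
  ultimately show ?thesis by auto
qed

text \<open>The inserted coordinate 0 lies below \<open>c\<close> times a positive coordinate. As a
  value to compare with it decides nothing, since the other coordinates are nonnegative.\<close>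

lemma has_gap_face:
  assumes t: "t \<in> standard_simplex p" and c: "0 < c"
  shows "has_gap c (simplical_face i t) \<longleftrightarrow> has_gap c t"
proof -
  have ex: "(\<exists>j. v < c * simplical_face i t j) \<longleftrightarrow> (\<exists>j. v < c * t j)" if "0 \<le> v" for v
  proof -
    have "(\<exists>j. v < c * simplical_face i t j) \<longleftrightarrow> (\<exists>w\<in>insert 0 (range t). v < c * w)"
      unfolding range_simplical_face[symmetric, of t i] by auto
    then show ?thesis using that by auto
  qed
  have pos: "0 \<le> t j" for j using t by (auto simp: standard_simplex_def)
  obtain m where "0 < t m" using simplex_max_coord[OF t] by blast
  then have 0: "\<exists>j. 0 < c * t j" using c by (auto intro!: exI[of _ m])
  let ?P = "\<lambda>v. (\<forall>j. c * t j < v) \<or> (\<exists>j. v < c * t j)"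
  have "has_gap c (simplical_face i t) \<longleftrightarrow> (\<forall>v\<in>range (simplical_face i t).
      (\<forall>j. c * simplical_face i t j < v) \<or> (\<exists>j. v < c * simplical_face i t j))"
    by (auto simp: has_gap_def)
  also have "\<dots> \<longleftrightarrow> (\<forall>v\<in>insert 0 (range t). ?P v)"
    unfolding range_simplical_face face_all_less[OF t c] using ex pos by (intro ball_cong refl) auto
  also have "\<dots> \<longleftrightarrow> has_gap c t" using 0 by (auto simp: has_gap_def)
  finally show ?thesis .
qed

lemma truncate_coords_face:
  assumes t: "t \<in> standard_simplex p" and c: "0 < c" and i: "i \<le> Suc p"
  shows "truncate_coords c (Suc p) (simplical_face i t) = simplical_face i (truncate_coords c p t)"
proof -
  define k where "k = (\<lambda>j. if j \<in> kept_coords c t then t j else 0)"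
  have *: "(if j \<in> kept_coords c (simplical_face i t) then simplical_face i t j else 0) = simplical_face i k j" for j
    unfolding kept_coords_def mem_Collect_eq face_all_less[OF t c]
    by (auto simp: k_def simplical_face_def kept_coords_def)
  have "truncate_coords c p t = (\<lambda>j. k j / (\<Sum>j\<le>p. k j))"
    by (simp add: truncate_coords_def k_def)
  then show ?thesis
    unfolding truncate_coords_def[of c "Suc p"] * sum_simplical_face[OF i]
    by (auto simp: simplical_face_def fun_eq_iff)
qed

lemma truncate_homotopy_face:
  assumes "t \<in> standard_simplex p" "0 < c" "i \<le> Suc p"
  shows "truncate_homotopy c (Suc p) u (simplical_face i t) = simplical_face i (truncate_homotopy c p u t)"
  unfolding truncate_homotopy_def truncate_coords_face[OF assms]
  by (auto simp: simplical_face_def fun_eq_iff)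

text \<open>All kept coordinates are multiplied by the same factor \<open>\<mu>\<close>, the others
  by \<open>1 - u \<le> \<mu>\<close>. A coordinate above \<open>c'\<close> times the largest is
  kept because \<open>c \<le> c'\<close>, so its ratio to the largest is unchanged; one below can
  only fall further behind. This is the reason for truncating with the least index of an
  intersection.\<close>

lemma truncate_homotopy_has_gap:
  assumes c: "0 < c" "c \<le> c'" "c' < 1" and t: "t \<in> standard_simplex p" and u: "0 \<le> u" "u \<le> 1"
    and gap: "has_gap c' t"
  shows "has_gap c' (truncate_homotopy c p u t)"
proof -
  define S where "S = (\<Sum>j\<le>p. if j \<in> kept_coords c t then t j else 0)"
  have S: "0 < S" "S \<le> 1" using truncate_sum[OF _ _ t, of c] c by (auto simp: S_def)
  define \<mu> where "\<mu> = (1 - u) + u / S"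
  have "u \<le> u / S" using S u by (simp add: le_divide_eq mult_left_le)
  then have l: "1 - u \<le> \<mu>" "0 < \<mu>" using u S by (auto simp: \<mu>_def)
  have t': "0 \<le> t j" for j using t by (auto simp: standard_simplex_def)
  define h where "h = truncate_homotopy c p u t"
  have hk: "h j = \<mu> * t j" if "j \<in> kept_coords c t" for j
    using that unfolding h_def truncate_homotopy_def truncate_coords_def S_def[symmetric] \<mu>_def
    by (simp add: algebra_simps)
  have hle: "h j \<le> \<mu> * t j" for j
  proof (cases "j \<in> kept_coords c t")
    case False
    then have "h j = (1 - u) * t j" by (simp add: h_def truncate_homotopy_def truncate_coords_def)
    also have "\<dots> \<le> \<mu> * t j" using l(1) t' by (rule mult_right_mono)
    finally show ?thesis .
  qed (simp add: hk)
  obtain m where m: "t m > 0" "\<And>j. t j \<le> t m" using simplex_max_coord[OF t] by blast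
  have "c * t j < t m" for j
  proof -
    have "c * t j \<le> c * t m" using m(2) c by simp
    also have "\<dots> < t m" using c m(1) by simp
    finally show ?thesis .
  qed
  then have hm: "h m = \<mu> * t m" by (intro hk) (simp add: kept_coords_def)
  have "(\<forall>j. c' * h j < h i) \<or> (\<exists>j. h i < c' * h j)" for i
  proof -
    from gap consider "\<forall>j. c' * t j < t i" | j where "t i < c' * t j" unfolding has_gap_def by blast
    then show ?thesis
    proof cases
      case 1
      have "c * t j < t i" for j
      proof -
        have "c * t j \<le> c' * t j" using c t' by (intro mult_right_mono) auto
        then show ?thesis using 1 by (metis order_le_less_trans)
      qed
      then have hi: "h i = \<mu> * t i" by (intro hk) (simp add: kept_coords_def)
      have "c' * h j < h i" for j
      proof -
        have "c' * h j \<le> c' * (\<mu> * t j)" using hle c by (intro mult_left_mono) auto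
        also have "\<dots> = \<mu> * (c' * t j)" by simp
        also have "\<dots> < \<mu> * t i" using l(2) 1 by simp
        finally show ?thesis by (simp add: hi)
      qed
      then show ?thesis by blast
    next
      case 2
      have "c' * t j \<le> c' * t m" using m(2) c by (intro mult_left_mono) auto
      with 2 have "t i < c' * t m" by linarith
      then have "\<mu> * t i < \<mu> * (c' * t m)" using l(2) by simp
      then have "h i < c' * h m" using hle[of i] hm by (simp add: mult.left_commute)
      then show ?thesis by blast
    qed
  qed
  then show ?thesis by (simp add: has_gap_def h_def)
qed

lemma truncate_homotopy_0 [simp]: "truncate_homotopy c p 0 t = t"
  and truncate_homotopy_1 [simp]: "truncate_homotopy c p 1 t = truncate_coords c p t"
  by (simp_all add: truncate_homotopy_def)

text \<open>Let \<open>e\<close> be the least positive coordinate. As no coordinate exceeds 1,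
  \<open>e / 2\<close> times any of them is below every positive one, while zeros are below
  \<open>e / 2\<close> times the largest.\<close>

lemma has_gap_exists:
  assumes t: "t \<in> standard_simplex p"
  obtains c where "0 < c" "c < 1" "has_gap c t"
proof -
  have t': "\<And>i. 0 \<le> t i" "\<And>i. t i \<le> 1" "\<And>i. i > p \<Longrightarrow> t i = 0" using t by (auto simp: standard_simplex_def)
  obtain m where m: "m \<le> p" "t m > 0" "\<And>j. t j \<le> t m" using simplex_max_coord[OF t] by blast
  define e where "e = Min (t ` {i. i \<le> p \<and> 0 < t i})"
  have fin: "finite (t ` {i. i \<le> p \<and> 0 < t i})" by simp
  have ne: "t ` {i. i \<le> p \<and> 0 < t i} \<noteq> {}" using m by auto
  have "e \<in> t ` {i. i \<le> p \<and> 0 < t i}" unfolding e_def by (rule Min_in[OF fin ne])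
  then have e: "0 < e" "e \<le> 1" using t'(2) by auto
  have le: "e \<le> t i" if "0 < t i" for i
  proof -
    have "i \<le> p" using that t'(3)[of i] by (cases "i \<le> p") auto
    then show ?thesis unfolding e_def using that fin by (intro Min_le) auto
  qed
  show thesis
  proof
    show "0 < e / 2" "e / 2 < 1" using e by auto
    show "has_gap (e / 2) t"
      unfolding has_gap_def
    proof
      fix i
      show "(\<forall>j. e / 2 * t j < t i) \<or> (\<exists>j. t i < e / 2 * t j)"
      proof (cases "0 < t i")
        case True
        have "e / 2 * t j < t i" for j
        proof -
          have "e / 2 * t j \<le> e / 2" using e t'(2) by (intro mult_left_le) auto
          also have "\<dots> < t i" using le[OF True] e by linarith
          finally show ?thesis .
        qed
        then show ?thesis by blast
      next
        case False
        then have "t i < e / 2 * t m" using t'(1)[of i] e m(2) by (simp add: not_less)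
        then show ?thesis by blast
      qed
    qed
  qed
qed

section \<open>Continuity of truncation and of normal forms\<close>

lemma continuous_map_from_sum:
  assumes "\<And>p. continuous_map (X p) Z (\<lambda>x. g (p, x))"
  shows "continuous_map (sum_topology X UNIV) Z g"
  unfolding continuous_map_def
proof (intro conjI allI impI)
  show "g \<in> topspace (sum_topology X UNIV) \<rightarrow> topspace Z"
  proof
    fix z assume "z \<in> topspace (sum_topology X UNIV)"
    then obtain p x where z: "z = (p, x)" "x \<in> topspace (X p)" by auto
    have "(\<lambda>x. g (p, x)) \<in> topspace (X p) \<rightarrow> topspace Z" using assms[of p] by (simp add: continuous_map_def)
    then show "g z \<in> topspace Z" using z by auto
  qed
  fix U assume U: "openin Z U"
  have "{x. (p, x) \<in> {z \<in> topspace (sum_topology X UNIV). g z \<in> U}} = {x \<in> topspace (X p). g (p, x) \<in> U}" for p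
    by auto
  then show "openin (sum_topology X UNIV) {z \<in> topspace (sum_topology X UNIV). g z \<in> U}"
    using openin_continuous_map_preimage[OF assms U] by (auto simp: openin_sum_topology)
qed

lemma continuous_map_snd_summand:
  "continuous_map (subtopology (sum_topology X UNIV) ({p} \<times> S)) (subtopology (X p) S) snd"
  unfolding continuous_map_in_subtopology
proof
  show "continuous_map (subtopology (sum_topology X UNIV) ({p} \<times> S)) (X p) snd"
    unfolding continuous_map_def
  proof (intro conjI allI impI)
    show "snd \<in> topspace (subtopology (sum_topology X UNIV) ({p} \<times> S)) \<rightarrow> topspace (X p)" by auto
    fix V assume V: "openin (X p) V"
    have "{x. (q, x) \<in> {p} \<times> V} = (if q = p then V else {})" for q by auto
    then have "openin (sum_topology X UNIV) ({p} \<times> V)"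
      using V openin_subset[OF V] by (auto simp: openin_sum_topology)
    moreover have "{z \<in> topspace (subtopology (sum_topology X UNIV) ({p} \<times> S)). snd z \<in> V} = ({p} \<times> V) \<inter> ({p} \<times> S)"
      using openin_subset[OF V] by auto
    ultimately show "openin (subtopology (sum_topology X UNIV) ({p} \<times> S))
        {z \<in> topspace (subtopology (sum_topology X UNIV) ({p} \<times> S)). snd z \<in> V}"
      by (auto simp: openin_subtopology)
  qed
qed auto

lemma continuous_map_into_simplex:
  assumes "\<And>i. continuous_map Z euclideanreal (\<lambda>z. g z i)" "\<And>z. z \<in> topspace Z \<Longrightarrow> g z \<in> standard_simplex p"
  shows "continuous_map Z (simplex_topology p) g"
  unfolding simplex_topology_def continuous_map_in_subtopology continuous_map_componentwise_UNIV
  using assms by auto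

lemma continuous_map_simplex_coord:
  "continuous_map (simplex_topology p) euclideanreal (\<lambda>t. t i)"
  unfolding simplex_topology_def
  by (intro continuous_map_from_subtopology continuous_map_product_projection) simp

text \<open>The points with a gap whose kept coordinates are exactly \<open>K\<close>, written with
  comparisons over the finite set \<open>{..p}\<close> so that openness follows from finitely many
  strict inequalities. For \<open>0 < c\<close> and \<open>K \<subseteq> {..p}\<close> these regions
  partition the points of the simplex that have a gap at \<open>c\<close>.\<close>

definition kept_region :: "real \<Rightarrow> nat \<Rightarrow> nat set \<Rightarrow> (nat \<Rightarrow> real) set" where
  "kept_region c p K = {t \<in> standard_simplex p. (\<forall>i\<in>K. \<forall>j\<in>{..p}. c * t j < t i) \<and>
     (\<forall>i\<in>{..p} - K. \<exists>j\<in>{..p}. t i < c * t j)}"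

lemma openin_kept_region:
  assumes "K \<subseteq> {..p}" shows "openin (simplex_topology p) (kept_region c p K)"
proof -
  let ?T = "simplex_topology p"
  have fin: "finite K" using assms finite_subset by blast
  have lt: "openin ?T {t \<in> topspace ?T. f t < g t}"
    if "continuous_map ?T euclideanreal f" "continuous_map ?T euclideanreal g" for f g
  proof -
    have "continuous_map ?T euclideanreal (\<lambda>t. g t - f t)"
      using that by (intro continuous_map_diff)
    from openin_continuous_map_preimage[OF this, of "{0<..}"] show ?thesis by simp
  qed
  have o: "openin ?T {t \<in> topspace ?T. c * t j < t i}" "openin ?T {t \<in> topspace ?T. t i < c * t j}" for i j
    by (intro lt continuous_map_real_mult_left continuous_map_simplex_coord)+
  have "kept_region c p K = ((\<Inter>i\<in>K. (\<Inter>j\<in>{..p}. {t \<in> topspace ?T. c * t j < t i}) \<inter> topspace ?T) \<inter> topspace ?T) \<inter>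
     ((\<Inter>i\<in>{..p} - K. \<Union>j\<in>{..p}. {t \<in> topspace ?T. t i < c * t j}) \<inter> topspace ?T)"
    by (auto simp: kept_region_def)
  also have "openin ?T \<dots>"
  proof (rule openin_Int)
    have "openin ?T ((\<Inter>j\<in>{..p}. {t \<in> topspace ?T. c * t j < t i}) \<inter> topspace ?T)" for i
      by (rule openin_INT[OF finite_atMost o(1)])
    then show "openin ?T ((\<Inter>i\<in>K. (\<Inter>j\<in>{..p}. {t \<in> topspace ?T. c * t j < t i}) \<inter> topspace ?T) \<inter> topspace ?T)"
      by (rule openin_INT[OF fin])
    have "openin ?T (\<Union>j\<in>{..p}. {t \<in> topspace ?T. t i < c * t j})" for i
      using o(2) by (intro openin_Union) blast
    then show "openin ?T ((\<Inter>i\<in>{..p} - K. \<Union>j\<in>{..p}. {t \<in> topspace ?T. t i < c * t j}) \<inter> topspace ?T)"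
      by (intro openin_INT) simp
  qed
  finally show ?thesis .
qed

lemma kept_coords_region:
  assumes t: "t \<in> kept_region c p K" and c: "0 < c" and K: "K \<subseteq> {..p}"
  shows "kept_coords c t = K"
proof -
  have t': "\<And>i. 0 \<le> t i" "\<And>i. i > p \<Longrightarrow> t i = 0" using t by (auto simp: kept_region_def standard_simplex_def)
  have "i \<in> kept_coords c t" if "i \<in> K" for i
  proof -
    have le: "c * t j < t i" if "j \<le> p" for j using t \<open>i \<in> K\<close> that by (auto simp: kept_region_def)
    have "0 \<le> c * t 0" using t'(1) c by simp
    also have "\<dots> < t i" using le by simp
    finally have "c * t j < t i" if "j > p" for j using t'(2)[OF that] by simp
    then show ?thesis using le unfolding kept_coords_def by (auto simp: not_le[symmetric])
  qed
  moreover have "i \<notin> kept_coords c t" if iK: "i \<notin> K" for i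
  proof (cases "i \<le> p")
    case True
    then obtain j where "t i < c * t j" using t iK unfolding kept_region_def by blast
    then have "\<not> c * t j < t i" by simp
    then show ?thesis by (auto simp: kept_coords_def)
  next
    case False
    have "\<not> c * t 0 < t i" using t'(1)[of 0] t'(2)[of i] False c by (simp add: not_less)
    then show ?thesis by (auto simp: kept_coords_def)
  qed
  ultimately show ?thesis by blast
qed

lemma has_gap_region:
  assumes t: "t \<in> standard_simplex p" and c: "0 < c" and gap: "has_gap c t"
  shows "t \<in> kept_region c p (kept_coords c t)" "kept_coords c t \<subseteq> {..p}"
proof -
  have t': "\<And>i. 0 \<le> t i" "\<And>i. i > p \<Longrightarrow> t i = 0" using t by (auto simp: standard_simplex_def)
  show "kept_coords c t \<subseteq> {..p}"
  proof
    fix i assume "i \<in> kept_coords c t"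
    then have "t i \<noteq> 0" using kept_coords_pos[OF c t] by force
    then show "i \<in> {..p}" using t'(2)[of i] by (cases "i \<le> p") auto
  qed
  have "\<exists>j\<in>{..p}. t i < c * t j" if i: "i \<notin> kept_coords c t" for i
  proof -
    obtain j where j: "t i < c * t j" using gap i unfolding has_gap_def kept_coords_def by blast
    have "j \<le> p"
    proof (rule ccontr)
      assume "\<not> j \<le> p"
      then have "t i < 0" using j t'(2)[of j] by simp
      with t'(1)[of i] show False by simp
    qed
    with j show ?thesis by blast
  qed
  then show "t \<in> kept_region c p (kept_coords c t)"
    using t by (auto simp: kept_region_def kept_coords_def)
qed

lemma kept_region_has_gap:
  assumes t: "t \<in> kept_region c p K" and c: "0 < c" and K: "K \<subseteq> {..p}"
  shows "has_gap c t"
  unfolding has_gap_def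
proof
  fix i
  have t': "t \<in> standard_simplex p" "\<And>i. i > p \<Longrightarrow> t i = 0"
    using t by (auto simp: kept_region_def standard_simplex_def)
  consider "i \<in> K" | "i \<notin> K" "i \<le> p" | "i > p" by linarith
  then show "(\<forall>j. c * t j < t i) \<or> (\<exists>j. t i < c * t j)"
  proof cases
    case 1
    then have "i \<in> kept_coords c t" using kept_coords_region[OF t c K] by simp
    then show ?thesis by (simp add: kept_coords_def)
  next
    case 2
    then show ?thesis using t by (auto simp: kept_region_def)
  next
    case 3
    obtain m where "t m > 0" using simplex_max_coord[OF t'(1)] by blast
    then have "t i < c * t m" using t'(2)[OF 3] c by simp
    then show ?thesis by blast
  qed
qed

text \<open>On a region the set of kept coordinates is constant, so truncation is a rational
  function of the coordinates with positive denominator.\<close>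

lemma continuous_truncate_homotopy:
  assumes c: "0 < c" "c < 1" and K: "K \<subseteq> {..p}"
  shows "continuous_map (prod_topology (top_of_set {0..1}) (subtopology (simplex_topology p) (kept_region c p K)))
    (simplex_topology p) (\<lambda>z. truncate_homotopy c p (fst z) (snd z))"
proof (rule continuous_map_into_simplex)
  let ?Z = "prod_topology (top_of_set {0..1::real}) (subtopology (simplex_topology p) (kept_region c p K))"
  have u: "continuous_map ?Z euclideanreal fst"
    using continuous_map_fst[of "top_of_set {0..1::real}"] by (rule continuous_map_into_fulltopology)
  have t: "continuous_map ?Z euclideanreal (\<lambda>z. snd z i)" for i
    using continuous_map_compose[OF continuous_map_snd continuous_map_from_subtopology[OF continuous_map_simplex_coord]]
    by (fastforce simp: o_def)
  have z: "snd z \<in> standard_simplex p" "kept_coords c (snd z) = K" "0 \<le> fst z" "fst z \<le> 1" if "z \<in> topspace ?Z" for z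
    using that kept_coords_region[OF _ c(1) K, of "snd z"] by auto
  show "truncate_homotopy c p (fst z) (snd z) \<in> standard_simplex p" if "z \<in> topspace ?Z" for z
    using truncate_homotopy_in_simplex[OF c z(1,3,4)[OF that]] .
  show "continuous_map ?Z euclideanreal (\<lambda>z. truncate_homotopy c p (fst z) (snd z) i)" for i
  proof (rule continuous_map_eq)
    let ?k = "\<lambda>j z. if j \<in> K then snd z j else (0::real)"
    have k: "continuous_map ?Z euclideanreal (?k j)" for j using t by (cases "j \<in> K") auto
    show "continuous_map ?Z euclideanreal (\<lambda>z. (1 - fst z) * snd z i + fst z * (?k i z / (\<Sum>j\<le>p. ?k j z)))"
    proof (intro continuous_map_add continuous_map_real_mult continuous_map_diff continuous_map_real_divide
        continuous_map_sum u t k)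
      show "(\<Sum>j\<le>p. ?k j z) \<noteq> 0" if "z \<in> topspace ?Z" for z
        using truncate_sum(1)[OF c z(1)[OF that]] z(2)[OF that] by simp
    qed auto
    show "(1 - fst z) * snd z i + fst z * (?k i z / (\<Sum>j\<le>p. ?k j z)) = truncate_homotopy c p (fst z) (snd z) i"
      if "z \<in> topspace ?Z" for z
      using z(2)[OF that] by (simp add: truncate_homotopy_def truncate_coords_def)
  qed
qed

text \<open>Truncation ends in the open face spanned by \<open>K\<close>; this fixed pattern of
  zeros is what \<open>continuous_normal_form\<close> starts from.\<close>

lemma continuous_truncate_coords:
  assumes c: "0 < c" "c < 1" and K: "K \<subseteq> {..p}"
  shows "continuous_map (subtopology (simplex_topology p) (kept_region c p K))
    (subtopology (simplex_topology p) {t. \<forall>i\<le>p. t i = 0 \<longleftrightarrow> i \<notin> K}) (truncate_coords c p)"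
  unfolding continuous_map_in_subtopology
proof
  let ?T = "subtopology (simplex_topology p) (kept_region c p K)"
  have "continuous_map ?T (prod_topology (top_of_set {0..1::real}) ?T) (\<lambda>t. (1, t))"
    by (simp add: continuous_map_paired)
  from continuous_map_compose[OF this continuous_truncate_homotopy[OF assms]]
  show "continuous_map ?T (simplex_topology p) (truncate_coords c p)" by (simp add: o_def)
  have "truncate_coords c p t i = 0 \<longleftrightarrow> i \<notin> K" if t: "t \<in> kept_region c p K" for t i
  proof -
    have ts: "t \<in> standard_simplex p" using t by (simp add: kept_region_def)
    have "t i \<noteq> 0" if "i \<in> K"
      using kept_coords_pos[OF c(1) ts, of i] kept_coords_region[OF t c(1) K] that by force
    then show ?thesis
      using truncate_sum(1)[OF c ts] kept_coords_region[OF t c(1) K] by (auto simp: truncate_coords_def)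
  qed
  then show "truncate_coords c p \<in> topspace ?T \<rightarrow> {t. \<forall>i\<le>p. t i = 0 \<longleftrightarrow> i \<notin> K}" by auto
qed

text \<open>Once the set \<open>Z\<close> of vanishing coordinates is fixed, all deletions are
  determined in advance, so the normal form is a composite of face maps and coordinate deletions
  followed by the inclusion of a summand.\<close>

lemma continuous_normal_form:
  assumes X: "semisimplicial_space X d"
  shows "continuous_map (subtopology (prod_topology (X p) (simplex_topology p))
      (UNIV \<times> {t. \<forall>i\<le>p. t i = 0 \<longleftrightarrow> i \<in> Z}))
    (sum_topology (\<lambda>p. prod_topology (X p) (simplex_topology p)) UNIV)
    (\<lambda>z. normal_form d p (fst z) (snd z))"
proof (induction p arbitrary: Z)
  case 0
  show ?case
    using continuous_map_component_injection[of 0 UNIV "\<lambda>p. prod_topology (X p) (simplex_topology p)"]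
    by (simp add: continuous_map_from_subtopology)
next
  case (Suc p)
  let ?S = "\<lambda>p. prod_topology (X p) (simplex_topology p)"
  let ?D = "subtopology (?S (Suc p)) (UNIV \<times> {t. \<forall>i\<le>Suc p. t i = 0 \<longleftrightarrow> i \<in> Z})"
  show ?case
  proof (cases "\<exists>i\<le>Suc p. i \<in> Z")
    case False
    have "continuous_map ?D (sum_topology ?S UNIV) (Pair (Suc p))"
      using continuous_map_component_injection[of "Suc p" UNIV ?S]
      by (simp add: continuous_map_from_subtopology)
    then show ?thesis
    proof (rule continuous_map_eq)
      fix z assume "z \<in> topspace ?D"
      then have "\<not> (\<exists>i\<le>Suc p. snd z i = 0)" using False by auto
      then show "(Suc p, z) = normal_form d (Suc p) (fst z) (snd z)"
        unfolding normal_form.simps by (simp only: if_False prod.collapse)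
    qed
  next
    case True
    define k where "k = (LEAST i. i \<in> Z)"
    obtain i where i: "i \<le> Suc p" "i \<in> Z" using True by blast
    have k: "k \<in> Z" "k \<le> Suc p" "\<And>j. j < k \<Longrightarrow> j \<notin> Z"
      using LeastI[of "\<lambda>i. i \<in> Z", OF i(2)] Least_le[of "\<lambda>i. i \<in> Z", OF i(2)] i(1) not_less_Least
      by (auto simp: k_def)
    \<comment> \<open>The pattern of zeros after position \<open>k\<close> has been removed and the
      later indices have moved down by one.\<close>
    define Z' where "Z' = {j. (if j < k then j else Suc j) \<in> Z}"
    let ?D' = "subtopology (?S p) (UNIV \<times> {t. \<forall>i\<le>p. t i = 0 \<longleftrightarrow> i \<in> Z'})"
    have t: "snd z \<in> standard_simplex (Suc p)" "fst z \<in> topspace (X (Suc p))" "snd z k = 0"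
        "(LEAST i. snd z i = 0) = k" "\<And>i. i \<le> Suc p \<Longrightarrow> snd z i = 0 \<longleftrightarrow> i \<in> Z" if "z \<in> topspace ?D" for z
    proof -
      show zi: "snd z i = 0 \<longleftrightarrow> i \<in> Z" if "i \<le> Suc p" for i using \<open>z \<in> topspace ?D\<close> that by auto
      show "snd z \<in> standard_simplex (Suc p)" "fst z \<in> topspace (X (Suc p))" using that by auto
      show zk: "snd z k = 0" using zi k by simp
      show "(LEAST i. snd z i = 0) = k"
      proof (rule Least_equality)
        show "k \<le> j" if "snd z j = 0" for j
          using zi[of j] k(2) k(3)[of j] that by (cases "j \<le> Suc p") force+
      qed (rule zk)
    qed
    have face: "continuous_map (X (Suc p)) (X p) (d (Suc p) k)"
      using X k(2) by (simp add: semisimplicial_space_def)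
    have "continuous_map ?D ?D' (\<lambda>z. (d (Suc p) k (fst z), delete_coord k (snd z)))"
      unfolding continuous_map_in_subtopology continuous_map_paired
    proof (intro conjI)
      show "continuous_map ?D (X p) (\<lambda>z. d (Suc p) k (fst z))"
        using continuous_map_compose[OF continuous_map_from_subtopology[OF continuous_map_fst] face]
        by (simp add: o_def)
      have c: "continuous_map ?D euclideanreal (\<lambda>z. snd z i)" for i
        using continuous_map_compose[OF continuous_map_from_subtopology[OF continuous_map_snd]
            continuous_map_simplex_coord, of "X (Suc p)" "Suc p" _ i]
        by (simp add: o_def)
      show "continuous_map ?D (simplex_topology p) (\<lambda>z. delete_coord k (snd z))"
      proof (rule continuous_map_into_simplex)
        show "continuous_map ?D euclideanreal (\<lambda>z. delete_coord k (snd z) i)" for i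
          using c by (cases "i < k") (simp_all add: delete_coord_def)
        show "delete_coord k (snd z) \<in> standard_simplex p" if "z \<in> topspace ?D" for z
          using delete_coord_in_simplex[OF t(1)[OF that] k(2) t(3)[OF that]] .
      qed
      have "\<forall>i\<le>p. delete_coord k (snd z) i = 0 \<longleftrightarrow> i \<in> Z'" if "z \<in> topspace ?D" for z
        using t(5)[OF that] k(2) by (auto simp: delete_coord_def Z'_def)
      then show "(\<lambda>z. (d (Suc p) k (fst z), delete_coord k (snd z))) \<in>
          topspace ?D \<rightarrow> UNIV \<times> {t. \<forall>i\<le>p. t i = 0 \<longleftrightarrow> i \<in> Z'}" by auto
    qed
    from continuous_map_compose[OF this Suc.IH]
    have "continuous_map ?D (sum_topology ?S UNIV)
        (\<lambda>z. normal_form d p (d (Suc p) k (fst z)) (delete_coord k (snd z)))" by (simp add: o_def)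
    then show ?thesis
    proof (rule continuous_map_eq)
      fix z assume z: "z \<in> topspace ?D"
      then have "\<exists>i\<le>Suc p. snd z i = 0" using t(3) k(2) by blast
      then show "normal_form d p (d (Suc p) k (fst z)) (delete_coord k (snd z)) =
          normal_form d (Suc p) (fst z) (snd z)"
        unfolding normal_form.simps t(4)[OF z] by simp
    qed
  qed
qed

section \<open>The realisation over the open sets with gaps\<close>

definition realisation_class ::
  "(nat \<Rightarrow> 'a topology) \<Rightarrow> (nat \<Rightarrow> nat \<Rightarrow> 'a \<Rightarrow> 'a) \<Rightarrow> nat \<times> 'a \<times> (nat \<Rightarrow> real) \<Rightarrow> (nat \<times> 'a \<times> (nat \<Rightarrow> real)) set" where
  "realisation_class X d z = realisation_rel X d `` {z}"

definition gap_part :: "(nat \<Rightarrow> 'a topology) \<Rightarrow> real set \<Rightarrow> (nat \<times> 'a \<times> (nat \<Rightarrow> real)) set" where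
  "gap_part X C = {z \<in> topspace (prerealisation X). \<forall>c\<in>C. has_gap c (snd (snd z))}"

definition map_coords :: "(nat \<Rightarrow> (nat \<Rightarrow> real) \<Rightarrow> nat \<Rightarrow> real) \<Rightarrow>
    nat \<times> 'a \<times> (nat \<Rightarrow> real) \<Rightarrow> nat \<times> 'a \<times> (nat \<Rightarrow> real)" where
  "map_coords \<phi> = (\<lambda>(p, x, t). (p, x, \<phi> p t))"

definition level_map :: "(nat \<Rightarrow> 'a \<Rightarrow> 'b) \<Rightarrow> nat \<times> 'a \<times> (nat \<Rightarrow> real) \<Rightarrow> nat \<times> 'b \<times> (nat \<Rightarrow> real)" where
  "level_map f = (\<lambda>(p, x, t). (p, f p x, t))"

definition normal_point :: "(nat \<Rightarrow> nat \<Rightarrow> 'a \<Rightarrow> 'a) \<Rightarrow> nat \<times> 'a \<times> (nat \<Rightarrow> real) \<Rightarrow> nat \<times> 'a \<times> (nat \<Rightarrow> real)" where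
  "normal_point d = (\<lambda>(p, x, t). normal_form d p x t)"

lemma quotient_map_realisation_class:
  "quotient_map (prerealisation X) (realisation X d) (realisation_class X d)"
  unfolding realisation_def realisation_class_def
  by (rule quotient_map_quotient_topology[OF equiv_realisation_rel])

lemma realisation_class_eq_iff:
  assumes "z \<in> topspace (prerealisation X)" "w \<in> topspace (prerealisation X)"
  shows "realisation_class X d z = realisation_class X d w \<longleftrightarrow> (z, w) \<in> realisation_rel X d"
  unfolding realisation_class_def using eq_equiv_class_iff[OF equiv_realisation_rel assms] .

lemma realisation_rel_invariant:
  assumes rel: "(z, w) \<in> realisation_rel X d"
    and glue: "\<And>p i x t. i \<le> Suc p \<Longrightarrow> x \<in> topspace (X (Suc p)) \<Longrightarrow> t \<in> standard_simplex p \<Longrightarrow>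
      \<phi> (Suc p, x, simplical_face i t) = \<phi> (p, d (Suc p) i x, t)"
  shows "\<phi> z = \<phi> w"
proof -
  have g: "\<phi> v = \<phi> w" if "(v, w) \<in> face_gluing X d" for v w
    using that glue by (auto simp: face_gluing_def)
  have "(z, w) \<in> (face_gluing X d \<union> (face_gluing X d)\<inverse>)\<^sup>*"
    using rel by (simp add: realisation_rel_def)
  then show ?thesis
  proof (induction rule: rtrancl_induct)
    case (step v w)
    then show ?case using g[of v w] g[of w v] by auto
  qed simp
qed

lemma gap_part_subset: "gap_part X C \<subseteq> topspace (prerealisation X)"
  by (auto simp: gap_part_def)

text \<open>Gap parts are saturated. Together with their openness this makes their images open in
  the quotient and lets the class map restrict to a quotient map over them.\<close>

lemma gap_part_rel:
  assumes X: "semisimplicial_space X d" and C: "C \<subseteq> {0<..}" and rel: "(z, w) \<in> realisation_rel X d"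
  shows "z \<in> gap_part X C \<longleftrightarrow> w \<in> gap_part X C"
proof -
  have "(\<forall>c\<in>C. has_gap c (snd (snd z))) \<longleftrightarrow> (\<forall>c\<in>C. has_gap c (snd (snd w)))"
    using rel
  proof (rule realisation_rel_invariant)
    fix p i x t assume t: "t \<in> standard_simplex p"
    have "has_gap c (simplical_face i t) \<longleftrightarrow> has_gap c t" if "c \<in> C" for c
      using that C by (intro has_gap_face[OF t]) auto
    then show "(\<forall>c\<in>C. has_gap c (snd (snd (Suc p, x, simplical_face i t)))) \<longleftrightarrow>
        (\<forall>c\<in>C. has_gap c (snd (snd (p, d (Suc p) i x, t))))" by simp
  qed
  moreover have "z \<in> topspace (prerealisation X)" "w \<in> topspace (prerealisation X)"
    using rel by (auto simp: realisation_rel_def)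
  ultimately show ?thesis by (simp add: gap_part_def)
qed

definition kept_piece :: "(nat \<Rightarrow> 'a topology) \<Rightarrow> real \<Rightarrow> nat \<times> nat set \<Rightarrow> (nat \<times> 'a \<times> (nat \<Rightarrow> real)) set" where
  "kept_piece X c = (\<lambda>(p, K). {p} \<times> (topspace (X p) \<times> kept_region c p K))"

lemma openin_kept_piece:
  assumes X: "semisimplicial_space X d" and K: "K \<subseteq> {..p}"
  shows "openin (prerealisation X) (kept_piece X c (p, K))"
proof -
  let ?U = "topspace (X p) \<times> kept_region c p K"
  have "kept_region c p K \<subseteq> standard_simplex p" by (auto simp: kept_region_def)
  moreover have "openin (prod_topology (X p) (simplex_topology p)) ?U"
    using openin_kept_region[OF K] by (simp add: openin_prod_Times_iff)
  moreover have "{x. (q, x) \<in> {p} \<times> ?U} = (if q = p then ?U else {})" for q by auto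
  ultimately show ?thesis
    unfolding prerealisation_eq[OF X] kept_piece_def by (auto simp: openin_sum_topology)
qed

lemma gap_part_kept_piece:
  assumes c: "0 < c" and z: "z \<in> gap_part X {c}"
  shows "\<exists>i\<in>{(p, K). K \<subseteq> {..p}}. z \<in> kept_piece X c i"
proof -
  obtain p x t where pxt: "z = (p, x, t)" by (cases z)
  then have t: "t \<in> standard_simplex p" "has_gap c t" "x \<in> topspace (X p)"
    using z by (auto simp: gap_part_def topspace_prerealisation)
  from has_gap_region[OF t(1) c t(2)] t(3) show ?thesis
    by (intro bexI[of _ "(p, kept_coords c t)"]) (auto simp: pxt kept_piece_def)
qed

lemma kept_piece_subset:
  assumes "0 < c" "K \<subseteq> {..p}" shows "kept_piece X c (p, K) \<subseteq> gap_part X {c}"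
  using assms kept_region_has_gap[OF _ assms]
  by (auto simp: kept_piece_def gap_part_def topspace_prerealisation kept_region_def)

lemma openin_gap_part:
  assumes X: "semisimplicial_space X d" and C: "finite C" "C \<subseteq> {0<..}"
  shows "openin (prerealisation X) (gap_part X C)"
proof -
  have "openin (prerealisation X) (gap_part X {c})" if c: "0 < c" for c
  proof -
    have "gap_part X {c} = (\<Union>i\<in>{(p, K). K \<subseteq> {..p}}. kept_piece X c i)"
    proof
      show "gap_part X {c} \<subseteq> (\<Union>i\<in>{(p, K). K \<subseteq> {..p}}. kept_piece X c i)"
        using gap_part_kept_piece[OF c] by (intro subsetI) (simp only: UN_iff)
      show "(\<Union>i\<in>{(p, K). K \<subseteq> {..p}}. kept_piece X c i) \<subseteq> gap_part X {c}"
      proof (rule UN_least)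
        fix i :: "nat \<times> nat set" assume "i \<in> {(p, K). K \<subseteq> {..p}}"
        then show "kept_piece X c i \<subseteq> gap_part X {c}"
          using kept_piece_subset[OF c] by (cases i) simp
      qed
    qed
    also have "openin (prerealisation X) \<dots>"
      using openin_kept_piece[OF X] by (intro openin_Union) auto
    finally show ?thesis .
  qed
  then have "openin (prerealisation X) ((\<Inter>c\<in>C. gap_part X {c}) \<inter> topspace (prerealisation X))"
    using C by (intro openin_INT) auto
  moreover have "(\<Inter>c\<in>C. gap_part X {c}) \<inter> topspace (prerealisation X) = gap_part X C"
    by (auto simp: gap_part_def)
  ultimately show ?thesis by simp
qed

text \<open>Taking normal forms alone is discontinuous where coordinates tend to 0. After truncation
  the pattern of zeros is constant on each of the open pieces that cover the gap part, so the
  composite is continuous on every piece.\<close>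

lemma continuous_normal_truncate:
  assumes X: "semisimplicial_space X d" and c: "0 < c" "c < 1"
  shows "continuous_map (subtopology (prerealisation X) (gap_part X {c})) (prerealisation X)
    (\<lambda>z. normal_point d (map_coords (truncate_coords c) z))"
proof (rule pasting_lemma[where I = "{(p, K). K \<subseteq> {..p}}" and T = "kept_piece X c"
      and f = "\<lambda>_ z. normal_point d (map_coords (truncate_coords c) z)"])
  fix i assume "i \<in> {(p, K). K \<subseteq> {..p :: nat}}"
  then obtain p K where i: "i = (p, K)" "K \<subseteq> {..p}" by auto
  have sub: "gap_part X {c} \<inter> kept_piece X c i = kept_piece X c i"
    using kept_piece_subset[OF c(1) i(2)] i(1) by blast
  show "openin (subtopology (prerealisation X) (gap_part X {c})) (kept_piece X c i)"
    using openin_kept_piece[OF X i(2), of c] sub i(1) by (metis inf_commute openin_subtopology_Int)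
  let ?S = "\<lambda>p. prod_topology (X p) (simplex_topology p)"
  let ?T = "subtopology (prerealisation X) (kept_piece X c i)"
  let ?R = "subtopology (simplex_topology p) (kept_region c p K)"
  let ?Z = "{t. \<forall>i\<le>p. t i = 0 \<longleftrightarrow> i \<in> - K}"
  have 1: "continuous_map ?T (prod_topology (X p) ?R) snd"
    using continuous_map_snd_summand[of ?S p "topspace (X p) \<times> kept_region c p K"]
    unfolding prerealisation_eq[OF X] i(1) kept_piece_def by (simp add: subtopology_Times)
  have "continuous_map ?R (subtopology (simplex_topology p) ?Z) (truncate_coords c p)"
    using continuous_truncate_coords[OF c i(2)] by simp
  then have 2: "continuous_map (prod_topology (X p) ?R)
      (prod_topology (X p) (subtopology (simplex_topology p) ?Z)) (\<lambda>z. (fst z, truncate_coords c p (snd z)))"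
    unfolding continuous_map_paired
    using continuous_map_compose[OF continuous_map_snd, of ?R _ "truncate_coords c p" "X p"]
    by (simp add: o_def continuous_map_fst)
  have 3: "prod_topology (X p) (subtopology (simplex_topology p) ?Z) = subtopology (?S p) (UNIV \<times> ?Z)"
    by (simp add: subtopology_Times)
  have "continuous_map ?T (prerealisation X) (\<lambda>z. normal_form d p (fst (snd z)) (truncate_coords c p (snd (snd z))))"
    using continuous_map_compose[OF continuous_map_compose[OF 1 2[unfolded 3]] continuous_normal_form[OF X]]
    by (simp add: o_def prerealisation_eq[OF X])
  then have "continuous_map ?T (prerealisation X) (\<lambda>z. normal_point d (map_coords (truncate_coords c) z))"
    by (rule continuous_map_eq) (auto simp: i(1) kept_piece_def normal_point_def map_coords_def)
  then show "continuous_map (subtopology (subtopology (prerealisation X) (gap_part X {c})) (kept_piece X c i))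
      (prerealisation X) (\<lambda>z. normal_point d (map_coords (truncate_coords c) z))"
    by (simp add: subtopology_subtopology sub)
next
  show "\<exists>j. j \<in> {(p, K). K \<subseteq> {..p}} \<and> z \<in> kept_piece X c j \<and>
      normal_point d (map_coords (truncate_coords c) z) = normal_point d (map_coords (truncate_coords c) z)"
    if "z \<in> topspace (subtopology (prerealisation X) (gap_part X {c}))" for z
    using gap_part_kept_piece[OF c(1), of z X] that by auto
qed simp

text \<open>The pieces of the gap part times the interval are open in the product and cover it, and
  on each of them the homotopy is the continuous one over a kept region.\<close>

lemma continuous_truncate_part:
  assumes X: "semisimplicial_space X d" and c: "0 < c" "c < 1"
  shows "continuous_map (prod_topology (top_of_set {0..1}) (subtopology (prerealisation X) (gap_part X {c})))
    (prerealisation X) (\<lambda>w. map_coords (\<lambda>p. truncate_homotopy c p (fst w)) (snd w))"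
proof (rule pasting_lemma[where I = "{(p, K). K \<subseteq> {..p}}" and T = "\<lambda>i. {0..1} \<times> kept_piece X c i"
      and f = "\<lambda>_ w. map_coords (\<lambda>p. truncate_homotopy c p (fst w)) (snd w)"])
  let ?I = "top_of_set {0..1::real}"
  fix i assume "i \<in> {(p, K). K \<subseteq> {..p :: nat}}"
  then obtain p K where i: "i = (p, K)" "K \<subseteq> {..p}" by auto
  have sub: "gap_part X {c} \<inter> kept_piece X c i = kept_piece X c i"
    using kept_piece_subset[OF c(1) i(2)] i(1) by blast
  have "openin (subtopology (prerealisation X) (gap_part X {c})) (kept_piece X c i)"
    using openin_kept_piece[OF X i(2), of c] sub i(1) by (metis inf_commute openin_subtopology_Int)
  then show "openin (prod_topology ?I (subtopology (prerealisation X) (gap_part X {c}))) ({0..1} \<times> kept_piece X c i)"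
    by (simp add: openin_prod_Times_iff)
  let ?S = "\<lambda>p. prod_topology (X p) (simplex_topology p)"
  let ?T = "subtopology (prerealisation X) (kept_piece X c i)"
  let ?R = "subtopology (simplex_topology p) (kept_region c p K)"
  have 1: "continuous_map ?T (prod_topology (X p) ?R) snd"
    using continuous_map_snd_summand[of ?S p "topspace (X p) \<times> kept_region c p K"]
    unfolding prerealisation_eq[OF X] i(1) kept_piece_def by (simp add: subtopology_Times)
  have x: "continuous_map ?T (X p) (\<lambda>z. fst (snd z))" and t: "continuous_map ?T ?R (\<lambda>z. snd (snd z))"
    using continuous_map_compose[OF 1 continuous_map_fst] continuous_map_compose[OF 1 continuous_map_snd]
    by (simp_all add: o_def)
  have x': "continuous_map (prod_topology ?I ?T) (X p) (\<lambda>w. fst (snd (snd w)))"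
    using continuous_map_compose[OF continuous_map_snd x] by (simp add: o_def)
  have "continuous_map (prod_topology ?I ?T) (prod_topology ?I ?R) (\<lambda>w. (fst w, snd (snd (snd w))))"
    unfolding continuous_map_paired
    using continuous_map_compose[OF continuous_map_snd t, of ?I] by (simp add: o_def continuous_map_fst)
  from continuous_map_compose[OF this continuous_truncate_homotopy[OF c i(2)]]
  have t': "continuous_map (prod_topology ?I ?T) (simplex_topology p)
      (\<lambda>w. truncate_homotopy c p (fst w) (snd (snd (snd w))))" by (simp add: o_def)
  have inj: "continuous_map (?S p) (prerealisation X) (Pair p)"
    unfolding prerealisation_eq[OF X] using continuous_map_component_injection[of p UNIV ?S] by simp
  have "continuous_map (prod_topology ?I ?T) (?S p)
      (\<lambda>w. (fst (snd (snd w)), truncate_homotopy c p (fst w) (snd (snd (snd w)))))"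
    using x' t' by (simp add: continuous_map_paired)
  from continuous_map_compose[OF this inj]
  have "continuous_map (prod_topology ?I ?T) (prerealisation X)
      (\<lambda>w. (p, fst (snd (snd w)), truncate_homotopy c p (fst w) (snd (snd (snd w)))))" by (simp add: o_def)
  then have "continuous_map (prod_topology ?I ?T) (prerealisation X)
      (\<lambda>w. map_coords (\<lambda>p. truncate_homotopy c p (fst w)) (snd w))"
    by (rule continuous_map_eq) (auto simp: i(1) kept_piece_def map_coords_def)
  moreover have "subtopology (prod_topology ?I (subtopology (prerealisation X) (gap_part X {c})))
      ({0..1} \<times> kept_piece X c i) = prod_topology ?I ?T"
    by (simp add: subtopology_Times subtopology_subtopology sub)
  ultimately show "continuous_map (subtopology (prod_topology ?I (subtopology (prerealisation X) (gap_part X {c})))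
      ({0..1} \<times> kept_piece X c i)) (prerealisation X) (\<lambda>w. map_coords (\<lambda>p. truncate_homotopy c p (fst w)) (snd w))"
    by simp
next
  show "\<exists>j. j \<in> {(p, K). K \<subseteq> {..p}} \<and> w \<in> {0..1} \<times> kept_piece X c j \<and>
      map_coords (\<lambda>p. truncate_homotopy c p (fst w)) (snd w) = map_coords (\<lambda>p. truncate_homotopy c p (fst w)) (snd w)"
    if "w \<in> topspace (prod_topology (top_of_set {0..1}) (subtopology (prerealisation X) (gap_part X {c})))" for w
    using gap_part_kept_piece[OF c(1), of "snd w" X] that by (auto simp: mem_Times_iff)
qed simp

lemma normal_point_rel:
  assumes X: "semisimplicial_space X d" and z: "z \<in> topspace (prerealisation X)"
  shows "(z, normal_point d z) \<in> realisation_rel X d"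
  using normal_form_rel[OF X] z by (auto simp: normal_point_def topspace_prerealisation)

lemma truncate_homotopy_gap_part:
  assumes C: "finite C" "C \<noteq> {}" "C \<subseteq> {0<..<1}" and z: "z \<in> gap_part X C" and u: "0 \<le> u" "u \<le> 1"
  shows "map_coords (\<lambda>p. truncate_homotopy (Min C) p u) z \<in> gap_part X C"
proof -
  obtain p x t where pxt: "z = (p, x, t)" by (cases z)
  have t: "t \<in> standard_simplex p" "x \<in> topspace (X p)" "\<And>c. c \<in> C \<Longrightarrow> has_gap c t"
    using z by (auto simp: gap_part_def topspace_prerealisation pxt)
  have m: "0 < Min C" "Min C < 1" using Min_in[OF C(1,2)] C(3) by auto
  have "has_gap c (truncate_homotopy (Min C) p u t)" if "c \<in> C" for c
    using that C m t u by (intro truncate_homotopy_has_gap) auto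
  then show ?thesis
    using truncate_homotopy_in_simplex[OF m t(1) u] t(2)
    by (auto simp: gap_part_def topspace_prerealisation pxt map_coords_def)
qed

lemma truncate_homotopy_1_fun [simp]: "truncate_homotopy c p 1 = truncate_coords c p"
  by (rule ext) simp

text \<open>\<open>r\<close> takes values in the coproduct, so it has to be constant on classes:
  truncation commutes with cofaces, and the normal form then absorbs the coface. \<open>h\<close>
  takes values in the quotient again, where it is enough that the truncation homotopy respects the
  gluing.\<close>

lemma realisation_gap_retract:
  assumes X: "semisimplicial_space X d" and C: "finite C" "C \<noteq> {}" "C \<subseteq> {0<..<1}"
  defines "W \<equiv> subtopology (realisation X d) (realisation_class X d ` gap_part X C)"
    and "Z \<equiv> subtopology (prerealisation X) (gap_part X C)"
  obtains r h where "quotient_map Z W (realisation_class X d)"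
    "openin (realisation X d) (realisation_class X d ` gap_part X C)"
    "continuous_map W Z r" "continuous_map (prod_topology (top_of_set {0..1::real}) W) W h"
    "\<And>z. z \<in> gap_part X C \<Longrightarrow>
       r (realisation_class X d z) = normal_point d (map_coords (truncate_coords (Min C)) z)"
    "\<And>u z. u \<in> {0..1} \<Longrightarrow> z \<in> gap_part X C \<Longrightarrow>
       h (u, realisation_class X d z) = realisation_class X d (map_coords (\<lambda>p. truncate_homotopy (Min C) p u) z)"
proof -
  let ?q = "realisation_class X d" and ?G = "gap_part X C" and ?c = "Min C" and ?P = "prerealisation X"
  have c: "0 < ?c" "?c < 1" "?c \<in> C" using Min_in[OF C(1,2)] C(3) by auto
  have C0: "C \<subseteq> {0<..}" using C(3) by auto
  have GP: "?G \<subseteq> topspace ?P" by (rule gap_part_subset)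
  have Gc: "?G \<subseteq> gap_part X {?c}" using c(3) by (auto simp: gap_part_def)
  have tZ: "topspace Z = ?G" using GP by (auto simp: Z_def)
  have qG: "{z \<in> topspace ?P. ?q z \<in> ?q ` ?G} = ?G"
  proof
    show "{z \<in> topspace ?P. ?q z \<in> ?q ` ?G} \<subseteq> ?G"
    proof
      fix z assume "z \<in> {z \<in> topspace ?P. ?q z \<in> ?q ` ?G}"
      then obtain w where w: "z \<in> topspace ?P" "w \<in> ?G" "?q z = ?q w" by blast
      then have "(z, w) \<in> realisation_rel X d" using realisation_class_eq_iff[of z X w d] GP by blast
      then show "z \<in> ?G" using gap_part_rel[OF X C0] w(2) by blast
    qed
  qed (use GP in auto)
  have qm: "quotient_map ?P (realisation X d) ?q" by (rule quotient_map_realisation_class)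
  have op: "openin (realisation X d) (?q ` ?G)"
  proof -
    have "?q ` ?G \<subseteq> topspace (realisation X d)"
      using quotient_imp_surjective_map[OF qm] GP by blast
    moreover have "openin ?P {z \<in> topspace ?P. ?q z \<in> ?q ` ?G}"
      unfolding qG by (rule openin_gap_part[OF X C(1) C0])
    ultimately show ?thesis using qm unfolding quotient_map_def by blast
  qed
  have Q: "quotient_map Z W ?q"
    unfolding Z_def W_def by (rule quotient_map_restriction[OF qm qG]) (use op in blast)
  have tW: "topspace W = ?q ` ?G" using quotient_imp_surjective_map[OF Q] tZ by simp
  have rel: "(z, w) \<in> realisation_rel X d" if "z \<in> ?G" "w \<in> ?G" "?q z = ?q w" for z w
    using that realisation_class_eq_iff[of z X w d] GP by blast
  define \<rho> where "\<rho> = (\<lambda>z. normal_point d (map_coords (truncate_coords ?c) z))"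
  have \<rho>G: "\<rho> z \<in> ?G" if z: "z \<in> ?G" for z
  proof -
    have "map_coords (truncate_coords ?c) z \<in> ?G"
      using truncate_homotopy_gap_part[OF C z, of 1] by simp
    moreover from this have "(map_coords (truncate_coords ?c) z, \<rho> z) \<in> realisation_rel X d"
      unfolding \<rho>_def using GP by (intro normal_point_rel[OF X]) blast
    ultimately show ?thesis using gap_part_rel[OF X C0] by blast
  qed
  have \<rho>c: "continuous_map Z Z \<rho>"
  proof -
    have "continuous_map Z ?P \<rho>"
      unfolding Z_def \<rho>_def by (rule continuous_map_from_subtopology_mono[OF continuous_normal_truncate[OF X c(1,2)] Gc])
    then show ?thesis using \<rho>G tZ unfolding Z_def continuous_map_in_subtopology by auto
  qed
  have \<rho>eq: "\<rho> z = \<rho> w" if "(z, w) \<in> realisation_rel X d" for z w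
    using that
  proof (rule realisation_rel_invariant)
    fix p i x t assume *: "i \<le> Suc p" "x \<in> topspace (X (Suc p))" "t \<in> standard_simplex p"
    show "\<rho> (Suc p, x, simplical_face i t) = \<rho> (p, d (Suc p) i x, t)"
      unfolding \<rho>_def normal_point_def map_coords_def prod.case
      using normal_form_face[OF X *(1,2) truncate_coords_in_simplex[OF c(1,2) *(3)]]
      by (simp only: truncate_coords_face[OF *(3) c(1) *(1)])
  qed
  obtain r where r: "continuous_map W Z r" "\<And>z. z \<in> topspace Z \<Longrightarrow> r (?q z) = \<rho> z"
    using quotient_map_lift_exists[OF Q \<rho>c] rel \<rho>eq tZ by metis
  define \<eta> where "\<eta> = (\<lambda>w. ?q (map_coords (\<lambda>p. truncate_homotopy ?c p (fst w)) (snd w)))"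
  let ?I = "top_of_set {0..1::real}"
  have \<eta>c: "continuous_map (prod_topology ?I Z) W \<eta>"
  proof -
    have "continuous_map (prod_topology ?I Z) ?P (\<lambda>w. map_coords (\<lambda>p. truncate_homotopy ?c p (fst w)) (snd w))"
    proof -
      have e: "prod_topology ?I Z = subtopology (prod_topology ?I ?P) ({0..1} \<times> ?G)"
        "prod_topology ?I (subtopology ?P (gap_part X {?c})) =
          subtopology (prod_topology ?I ?P) ({0..1} \<times> gap_part X {?c})"
        by (simp_all add: Z_def subtopology_Times subtopology_subtopology)
      show ?thesis
        unfolding e(1)
        by (rule continuous_map_from_subtopology_mono[OF continuous_truncate_part[OF X c(1,2), unfolded e(2)]])
          (use Gc in auto)
    qed
    then have "continuous_map (prod_topology ?I Z) Z (\<lambda>w. map_coords (\<lambda>p. truncate_homotopy ?c p (fst w)) (snd w))"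
      using truncate_homotopy_gap_part[OF C] tZ
      unfolding Z_def continuous_map_in_subtopology by (auto simp: mem_Times_iff)
    from continuous_map_compose[OF this quotient_imp_continuous_map[OF Q]]
    show ?thesis by (simp add: o_def \<eta>_def)
  qed
  have \<eta>eq: "\<eta> (u, z) = \<eta> (u, w)" if "(z, w) \<in> realisation_rel X d" "u \<in> {0..1}" for u z w
    using that(1)
  proof (rule realisation_rel_invariant)
    fix p i x t assume *: "i \<le> Suc p" "x \<in> topspace (X (Suc p))" "t \<in> standard_simplex p"
    let ?h = "truncate_homotopy ?c p u t"
    have h: "?h \<in> standard_simplex p"
      using truncate_homotopy_in_simplex[OF c(1,2) *(3)] that(2) by simp
    have "((Suc p, x, simplical_face i ?h), (p, d (Suc p) i x, ?h)) \<in> realisation_rel X d"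
      by (rule realisation_rel_face[OF X *(1,2) h])
    then have "?q (Suc p, x, simplical_face i ?h) = ?q (p, d (Suc p) i x, ?h)"
      unfolding realisation_class_def by (rule equiv_class_eq[OF equiv_realisation_rel])
    then show "\<eta> (u, Suc p, x, simplical_face i t) = \<eta> (u, p, d (Suc p) i x, t)"
      unfolding \<eta>_def map_coords_def fst_conv snd_conv prod.case
      by (simp only: truncate_homotopy_face[OF *(3) c(1) *(1)])
  qed
  \<comment> \<open>The product of a quotient map with a locally compact Hausdorff space is again a
    quotient map; this is what lets the homotopy descend from \<open>Z\<close> to
    \<open>W\<close>.\<close>
  have I: "locally_compact_space ?I" "Hausdorff_space ?I"
    by (auto intro!: compact_imp_locally_compact_space compact_space_subtopology Hausdorff_space_subtopology)
  have QI: "quotient_map (prod_topology ?I Z) (prod_topology ?I W) (\<lambda>(u, z). (u, ?q z))"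
    by (rule quotient_map_prod_right[OF I(1) _ Q]) (use I(2) in blast)
  obtain h where h: "continuous_map (prod_topology ?I W) W h"
    "\<And>w. w \<in> topspace (prod_topology ?I Z) \<Longrightarrow> h ((\<lambda>(u, z). (u, ?q z)) w) = \<eta> w"
  proof (rule quotient_map_lift_exists[OF QI \<eta>c])
    fix v w assume v: "v \<in> topspace (prod_topology ?I Z)" and w: "w \<in> topspace (prod_topology ?I Z)"
      and "(\<lambda>(u, z). (u, ?q z)) v = (\<lambda>(u, z). (u, ?q z)) w"
    then obtain u z z' where "v = (u, z)" "w = (u, z')" "?q z = ?q z'" by (cases v, cases w) auto
    then show "\<eta> v = \<eta> w" using v w tZ rel \<eta>eq by auto
  qed blast
  show thesis
  proof (rule that[OF Q op r(1) h(1)])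
    show "r (?q z) = normal_point d (map_coords (truncate_coords ?c) z)" if "z \<in> ?G" for z
      using r(2) that tZ by (simp add: \<rho>_def)
    show "h (u, ?q z) = ?q (map_coords (\<lambda>p. truncate_homotopy ?c p u) z)" if "u \<in> {0..1}" "z \<in> ?G" for u z
      using h(2)[of "(u, z)"] that tZ by (simp add: \<eta>_def)
  qed
qed

section \<open>Lifting in the coproduct and passage to the realisation\<close>

lemma continuous_map_from_level:
  assumes X: "semisimplicial_space X d"
    and "continuous_map Z (X p) a" "continuous_map Z (simplex_topology p) t"
  shows "continuous_map Z (prerealisation X) (\<lambda>z. (p, a z, t z))"
proof -
  let ?S = "\<lambda>p. prod_topology (X p) (simplex_topology p)"
  have "continuous_map Z (?S p) (\<lambda>z. (a z, t z))" using assms by (simp add: continuous_map_paired)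
  moreover have "continuous_map (?S p) (sum_topology ?S UNIV) (Pair p)"
    using continuous_map_component_injection[of p UNIV ?S] by simp
  ultimately show ?thesis
    unfolding prerealisation_eq[OF X] using continuous_map_compose by (fastforce simp: o_def)
qed

lemma continuous_map_into_level:
  assumes X: "semisimplicial_space X d"
    and b: "continuous_map Z (prerealisation X) b" "\<And>z. z \<in> topspace Z \<Longrightarrow> fst (b z) = p"
  shows "continuous_map Z (X p) (\<lambda>z. fst (snd (b z)))"
    "continuous_map Z (simplex_topology p) (\<lambda>z. snd (snd (b z)))"
proof -
  let ?S = "\<lambda>p. prod_topology (X p) (simplex_topology p)"
  have "continuous_map Z (subtopology (sum_topology ?S UNIV) ({p} \<times> UNIV)) b"
    unfolding continuous_map_in_subtopology
    using b by (auto simp: prerealisation_eq[OF X] mem_Times_iff)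
  from continuous_map_compose[OF this continuous_map_snd_summand]
  have "continuous_map Z (?S p) (\<lambda>z. snd (b z))" by (simp add: o_def)
  from continuous_map_compose[OF this continuous_map_fst] continuous_map_compose[OF this continuous_map_snd]
  show "continuous_map Z (X p) (\<lambda>z. fst (snd (b z)))"
    "continuous_map Z (simplex_topology p) (\<lambda>z. snd (snd (b z)))" by (simp_all add: o_def)
qed

lemma connected_cube_set: "connected (cube_set n)"
proof -
  have "connected_space (cube n)"
    unfolding cube_def connected_space_product_topology by (simp add: connected_space_subtopology)
  then show ?thesis by (simp add: cube_eq connectedin_def flip: connectedin_iff_connected)
qed

text \<open>The level is a continuous function into a discrete space, and the cube is
  connected.\<close>

lemma cube_into_level:
  assumes X: "semisimplicial_space X d" and b: "continuous_map (top_of_set (cube_set n)) (prerealisation X) b"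
  obtains p where "\<And>x. x \<in> cube_set n \<Longrightarrow> fst (b x) = p"
proof -
  have "continuous_map (prerealisation X) (discrete_topology UNIV) fst"
    unfolding prerealisation_eq[OF X] by (rule continuous_map_from_sum) simp
  from continuous_map_compose[OF b this]
  have "continuous_map (top_of_set (cube_set n)) (discrete_topology UNIV) (fst \<circ> b)" .
  moreover have "connectedin (top_of_set (cube_set n)) (cube_set n)"
    using connected_cube_set by (simp add: connectedin_subtopology)
  ultimately have "connectedin (discrete_topology UNIV) ((fst \<circ> b) ` cube_set n)"
    by (rule connectedin_continuous_map_image)
  then obtain p where "(fst \<circ> b) ` cube_set n \<subseteq> {p}" by (auto simp: connectedin_discrete_topology)
  then show thesis using that[of p] by auto
qed

text \<open>A cube in the coproduct lies in a single level \<open>p\<close>. Only its component in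
  \<open>Y p\<close> is lifted to \<open>X p\<close>, while the simplex coordinate of
  \<open>b\<close> is kept at all times. The gap condition concerns that coordinate alone, so the
  lift and the homotopy stay in the gap parts.\<close>

lemma lifts_cubes_gap_part:
  assumes X: "semisimplicial_space X dX" and Y: "semisimplicial_space Y dY"
    and lc: "\<And>p. lifts_cubes n (X p) (Y p) (f p)"
  shows "lifts_cubes n (subtopology (prerealisation X) (gap_part X C))
    (subtopology (prerealisation Y) (gap_part Y C)) (level_map f)"
  unfolding lifts_cubes_def
proof (intro allI impI)
  fix a b assume "lift_square n (subtopology (prerealisation X) (gap_part X C))
    (subtopology (prerealisation Y) (gap_part Y C)) (level_map f) a b"
  then have a: "continuous_map (top_of_set (cube_boundary n)) (prerealisation X) a"
    and b: "continuous_map (top_of_set (cube_set n)) (prerealisation Y) b"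
    and bG: "\<And>x. x \<in> cube_set n \<Longrightarrow> b x \<in> gap_part Y C"
    and ab: "\<And>z. z \<in> cube_boundary n \<Longrightarrow> level_map f (a z) = b z"
    by (auto simp: lift_square_def continuous_map_in_subtopology)
  obtain p where p: "\<And>x. x \<in> cube_set n \<Longrightarrow> fst (b x) = p" using cube_into_level[OF Y b] by blast
  have bs: "z \<in> cube_set n" if "z \<in> cube_boundary n" for z using that cube_boundary_subset by blast
  have comps: "fst (a z) = p" "f p (fst (snd (a z))) = fst (snd (b z))" "snd (snd (a z)) = snd (snd (b z))"
    if "z \<in> cube_boundary n" for z
    using p[OF bs[OF that]] unfolding ab[OF that, symmetric]
    by (simp_all add: level_map_def case_prod_unfold)
  note b12 = continuous_map_into_level[OF Y b, of p] and a12 = continuous_map_into_level[OF X a, of p]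
  have "lift_square n (X p) (Y p) (f p) (\<lambda>z. fst (snd (a z))) (\<lambda>x. fst (snd (b x)))"
    unfolding lift_square_def using b12 a12 p comps by simp
  from lifts_cubesD[OF lc this] obtain A L where A: "continuous_map (top_of_set (cube_set n)) (X p) A"
    "continuous_map (top_of_set ({0..1::real} \<times> cube_set n)) (Y p) L"
    "\<And>z. z \<in> cube_boundary n \<Longrightarrow> A z = fst (snd (a z))"
    "\<And>x. x \<in> cube_set n \<Longrightarrow> L (0, x) = f p (A x)" "\<And>x. x \<in> cube_set n \<Longrightarrow> L (1, x) = fst (snd (b x))"
    "\<And>t z. t \<in> {0..1::real} \<Longrightarrow> z \<in> cube_boundary n \<Longrightarrow> L (t, z) = fst (snd (b z))"
    by blast
  have t: "continuous_map (top_of_set (cube_set n)) (simplex_topology p) (\<lambda>x. snd (snd (b x)))"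
    using b12(2) p by simp
  have tC: "snd (snd (b x)) \<in> standard_simplex p" "\<forall>c\<in>C. has_gap c (snd (snd (b x)))" if "x \<in> cube_set n" for x
    using bG[OF that] p[OF that] by (auto simp: gap_part_def topspace_prerealisation)
  define A' where "A' x = (p, A x, snd (snd (b x)))" for x
  define L' where "L' q = (p, L q, snd (snd (b (snd q))))" for q :: "real \<times> (nat \<Rightarrow> real)"
  have A': "continuous_map (top_of_set (cube_set n)) (subtopology (prerealisation X) (gap_part X C)) A'"
  proof -
    have "continuous_map (top_of_set (cube_set n)) (prerealisation X) A'"
      unfolding A'_def by (rule continuous_map_from_level[OF X A(1) t])
    moreover have "A' x \<in> gap_part X C" if "x \<in> cube_set n" for x
    proof -
      have "A x \<in> topspace (X p)" using A(1) that by (auto simp: continuous_map_def)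
      then show ?thesis using tC[OF that] by (simp add: A'_def gap_part_def topspace_prerealisation)
    qed
    ultimately show ?thesis by (simp add: continuous_map_in_subtopology)
  qed
  have L': "continuous_map (top_of_set ({0..1::real} \<times> cube_set n)) (subtopology (prerealisation Y) (gap_part Y C)) L'"
  proof -
    have "continuous_map (top_of_set ({0..1::real} \<times> cube_set n)) (simplex_topology p) (\<lambda>q. snd (snd (b (snd q))))"
      by (rule continuous_map_top_of_set_compose[OF t]) (auto intro!: continuous_intros)
    from continuous_map_from_level[OF Y A(2) this]
    have "continuous_map (top_of_set ({0..1::real} \<times> cube_set n)) (prerealisation Y) L'"
      unfolding L'_def[abs_def] .
    moreover have "L' q \<in> gap_part Y C" if "q \<in> {0..1} \<times> cube_set n" for q
    proof -
      have "L q \<in> topspace (Y p)" using A(2) that by (auto simp: continuous_map_def)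
      moreover have "snd q \<in> cube_set n" using that by auto
      ultimately show ?thesis using tC[of "snd q"] by (simp add: L'_def gap_part_def topspace_prerealisation)
    qed
    ultimately show ?thesis by (simp add: continuous_map_in_subtopology)
  qed
  have beq: "(p, fst (snd (b x)), snd (snd (b x))) = b x" if "x \<in> cube_set n" for x
    using p[OF that] by (simp add: prod_eq_iff)
  have "\<forall>z\<in>cube_boundary n. A' z = a z"
    using A(3) comps by (simp add: A'_def prod_eq_iff)
  moreover have "\<forall>x\<in>cube_set n. L' (0, x) = level_map f (A' x) \<and> L' (1, x) = b x"
    using A(4,5) beq by (simp add: A'_def L'_def level_map_def)
  moreover have "\<forall>t\<in>{0..1::real}. \<forall>z\<in>cube_boundary n. L' (t, z) = b z"
    using A(6) beq bs by (simp add: L'_def)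
  ultimately show "\<exists>A L. continuous_map (top_of_set (cube_set n)) (subtopology (prerealisation X) (gap_part X C)) A \<and>
        continuous_map (top_of_set ({0..1} \<times> cube_set n)) (subtopology (prerealisation Y) (gap_part Y C)) L \<and>
        (\<forall>z\<in>cube_boundary n. A z = a z) \<and>
        (\<forall>x\<in>cube_set n. L (0, x) = level_map f (A x) \<and> L (1, x) = b x) \<and>
        (\<forall>t\<in>{0..1::real}. \<forall>z\<in>cube_boundary n. L (t, z) = b z)"
    using A' L' by blast
qed

lemma level_map_in:
  assumes "semisimplicial_map X dX Y dY f" "z \<in> topspace (prerealisation X)"
  shows "level_map f z \<in> topspace (prerealisation Y)"
  using assms
  by (auto simp: level_map_def topspace_prerealisation semisimplicial_map_def continuous_map_def)

lemma level_map_gap_part: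
  assumes "semisimplicial_map X dX Y dY f" "z \<in> topspace (prerealisation X)"
  shows "level_map f z \<in> gap_part Y C \<longleftrightarrow> z \<in> gap_part X C"
  using level_map_in[OF assms] assms(2) by (auto simp: gap_part_def level_map_def split: prod.splits)

lemma realisation_map_level_map:
  assumes "semisimplicial_space Y dY" "semisimplicial_map X dX Y dY f" "z \<in> topspace (prerealisation X)"
  shows "realisation_map Y dY f (realisation_class X dX z) = realisation_class Y dY (level_map f z)"
proof -
  obtain p x t where "z = (p, x, t)" by (cases z)
  then show ?thesis
    using realisation_map_class[OF assms(1,2), of x p t] assms(3)
    by (simp add: realisation_class_def level_map_def topspace_prerealisation)
qed

lemma continuous_level_map:
  assumes X: "semisimplicial_space X dX" and Y: "semisimplicial_space Y dY"
    and f: "semisimplicial_map X dX Y dY f"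
  shows "continuous_map (prerealisation X) (prerealisation Y) (level_map f)"
  unfolding prerealisation_eq[OF X]
proof (rule continuous_map_from_sum)
  fix p
  have "continuous_map (X p) (Y p) (f p)" using f by (simp add: semisimplicial_map_def)
  from continuous_map_compose[OF continuous_map_fst this]
  have "continuous_map (prod_topology (X p) (simplex_topology p)) (prerealisation Y) (\<lambda>z. (p, f p (fst z), snd z))"
    by (intro continuous_map_from_level[OF Y]) (simp_all add: o_def continuous_map_snd)
  then show "continuous_map (prod_topology (X p) (simplex_topology p)) (prerealisation Y) (\<lambda>z. level_map f (p, z))"
    by (simp add: level_map_def case_prod_unfold)
qed

lemma continuous_realisation_map:
  assumes X: "semisimplicial_space X dX" and Y: "semisimplicial_space Y dY"
    and f: "semisimplicial_map X dX Y dY f"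
  shows "continuous_map (realisation X dX) (realisation Y dY) (realisation_map Y dY f)"
proof (rule continuous_compose_quotient_map[OF quotient_map_realisation_class])
  have "continuous_map (prerealisation X) (realisation Y dY) (realisation_class Y dY \<circ> level_map f)"
    by (rule continuous_map_compose[OF continuous_level_map[OF assms]
          quotient_imp_continuous_map[OF quotient_map_realisation_class]])
  then show "continuous_map (prerealisation X) (realisation Y dY) (realisation_map Y dY f \<circ> realisation_class X dX)"
    by (rule continuous_map_eq) (simp add: realisation_map_level_map[OF Y f])
qed

text \<open>Truncation acts on the simplex coordinates and the level map on the other component, so
  they commute. With the naturality of normal forms this makes the retractions and homotopies of the
  two sides compatible with the map of realisations.\<close>

lemma lifts_cubes_realisation_gap:
  assumes X: "semisimplicial_space X dX" and Y: "semisimplicial_space Y dY"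
    and f: "semisimplicial_map X dX Y dY f" and lc: "\<And>p. lifts_cubes n (X p) (Y p) (f p)"
    and C: "finite C" "C \<noteq> {}" "C \<subseteq> {0<..<1}"
  shows "lifts_cubes n (subtopology (realisation X dX) (realisation_class X dX ` gap_part X C))
    (subtopology (realisation Y dY) (realisation_class Y dY ` gap_part Y C)) (realisation_map Y dY f)"
proof -
  let ?F = "realisation_map Y dY f" and ?g = "level_map f"
  let ?qX = "realisation_class X dX" and ?qY = "realisation_class Y dY"
  let ?W = "subtopology (realisation X dX) (?qX ` gap_part X C)"
  let ?W' = "subtopology (realisation Y dY) (?qY ` gap_part Y C)"
  let ?Z = "subtopology (prerealisation X) (gap_part X C)"
  let ?Z' = "subtopology (prerealisation Y) (gap_part Y C)"
  obtain r h where X1: "quotient_map ?Z ?W ?qX" "openin (realisation X dX) (?qX ` gap_part X C)"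
    "continuous_map ?W ?Z r" "continuous_map (prod_topology (top_of_set {0..1::real}) ?W) ?W h"
    "\<And>z. z \<in> gap_part X C \<Longrightarrow> r (?qX z) = normal_point dX (map_coords (truncate_coords (Min C)) z)"
    "\<And>u z. u \<in> {0..1} \<Longrightarrow> z \<in> gap_part X C \<Longrightarrow>
       h (u, ?qX z) = ?qX (map_coords (\<lambda>p. truncate_homotopy (Min C) p u) z)"
    using realisation_gap_retract[OF X C] by blast
  obtain r' h' where Y1: "quotient_map ?Z' ?W' ?qY" "openin (realisation Y dY) (?qY ` gap_part Y C)"
    "continuous_map ?W' ?Z' r'" "continuous_map (prod_topology (top_of_set {0..1::real}) ?W') ?W' h'"
    "\<And>z. z \<in> gap_part Y C \<Longrightarrow> r' (?qY z) = normal_point dY (map_coords (truncate_coords (Min C)) z)"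
    "\<And>u z. u \<in> {0..1} \<Longrightarrow> z \<in> gap_part Y C \<Longrightarrow>
       h' (u, ?qY z) = ?qY (map_coords (\<lambda>p. truncate_homotopy (Min C) p u) z)"
    using realisation_gap_retract[OF Y C] by blast
  have GX: "z \<in> topspace (prerealisation X)" if "z \<in> gap_part X C" for z using that gap_part_subset by blast
  have GY: "z \<in> topspace (prerealisation Y)" if "z \<in> gap_part Y C" for z using that gap_part_subset by blast
  have gG: "?g z \<in> gap_part Y C" if "z \<in> gap_part X C" for z
    using level_map_gap_part[OF f GX[OF that]] that by blast
  have hX: "map_coords (\<lambda>p. truncate_homotopy (Min C) p u) z \<in> gap_part X C"
    if "z \<in> gap_part X C" "u \<in> {0..1}" for u z
    using truncate_homotopy_gap_part[OF C that(1)] that(2) by simp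
  have hY: "map_coords (\<lambda>p. truncate_homotopy (Min C) p u) z \<in> gap_part Y C"
    if "z \<in> gap_part Y C" "u \<in> {0..1}" for u z
    using truncate_homotopy_gap_part[OF C that(1)] that(2) by simp
  have W: "\<exists>z\<in>gap_part X C. w = ?qX z" if "w \<in> topspace ?W" for w using that by auto
  have W': "\<exists>z\<in>gap_part Y C. w = ?qY z" if "w \<in> topspace ?W'" for w using that by auto
  have Fq: "?F (?qX z) = ?qY (?g z)" if "z \<in> gap_part X C" for z
    by (rule realisation_map_level_map[OF Y f GX[OF that]])
  have gmap: "?g (map_coords \<phi> z) = map_coords \<phi> (?g z)" for \<phi> z
    by (simp add: level_map_def map_coords_def case_prod_unfold)
  \<comment> \<open>The normal form does not change the class, so \<open>?qX \<circ> r\<close> is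
    the end of the truncation homotopy.\<close>
  have normal: "?qX (normal_point dX z) = ?qX z" if "z \<in> gap_part X C" for z
    using equiv_class_eq[OF equiv_realisation_rel normal_point_rel[OF X GX[OF that]]]
    by (simp add: realisation_class_def)
  have normal': "?qY (normal_point dY z) = ?qY z" if "z \<in> gap_part Y C" for z
    using equiv_class_eq[OF equiv_realisation_rel normal_point_rel[OF Y GY[OF that]]]
    by (simp add: realisation_class_def)
  have tX: "map_coords (truncate_coords (Min C)) z \<in> gap_part X C" if "z \<in> gap_part X C" for z
    using hX[OF that, of 1] by simp
  have tY: "map_coords (truncate_coords (Min C)) z \<in> gap_part Y C" if "z \<in> gap_part Y C" for z
    using hY[OF that, of 1] by simp
  have id: "map_coords (\<lambda>p. truncate_homotopy (Min C) p 0) z = z" for z :: "nat \<times> 'c \<times> (nat \<Rightarrow> real)"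
    by (simp add: map_coords_def case_prod_unfold)
  show ?thesis
  proof (rule lifts_cubes_homotopy_retract[OF lifts_cubes_gap_part[OF X Y lc], where C1 = C and r = r and r' = r'
        and h = h and h' = h' and s = ?qX and s' = ?qY])
    show "continuous_map ?W ?W' ?F"
      unfolding continuous_map_in_subtopology
    proof
      show "continuous_map ?W (realisation Y dY) ?F"
        by (rule continuous_map_from_subtopology[OF continuous_realisation_map[OF X Y f]])
      show "?F \<in> topspace ?W \<rightarrow> ?qY ` gap_part Y C" using Fq gG by auto
    qed
    show "continuous_map ?Z ?W ?qX" "continuous_map ?Z' ?W' ?qY"
      using X1(1) Y1(1) by (simp_all add: quotient_imp_continuous_map)
    show "?F (?qX z) = ?qY (?g z)" if "z \<in> topspace ?Z" for z using Fq that by simp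
    show "?g (r w) = r' (?F w)" if w: "w \<in> topspace ?W" for w
    proof -
      obtain z where z: "z \<in> gap_part X C" "w = ?qX z" using W[OF w] by blast
      have "?g (normal_point dX v) = normal_point dY (?g v)" if "v \<in> topspace (prerealisation X)" for v
        using that normal_form_natural[OF X f]
        by (auto simp: level_map_def normal_point_def topspace_prerealisation case_prod_unfold)
      then show ?thesis
        using z gG tX GX by (simp add: X1(5) Y1(5) Fq gmap)
    qed
    show "?F (h (u, w)) = h' (u, ?F w)" if u: "u \<in> {0..1}" and w: "w \<in> topspace ?W" for u w
    proof -
      obtain z where z: "z \<in> gap_part X C" "w = ?qX z" using W[OF w] by blast
      then show ?thesis using u gG hX by (simp add: X1(6) Y1(6) Fq gmap)
    qed
    show "h (0, w) = w" "h (1, w) = ?qX (r w)" if w: "w \<in> topspace ?W" for w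
    proof -
      obtain z where z: "z \<in> gap_part X C" "w = ?qX z" using W[OF w] by blast
      then show "h (0, w) = w" "h (1, w) = ?qX (r w)" using tX by (simp_all add: X1(5,6) id normal)
    qed
    show "h' (0, w) = w" "h' (1, w) = ?qY (r' w)" if w: "w \<in> topspace ?W'" for w
    proof -
      obtain z where z: "z \<in> gap_part Y C" "w = ?qY z" using W'[OF w] by blast
      then show "h' (0, w) = w" "h' (1, w) = ?qY (r' w)" using tY by (simp_all add: Y1(5,6) id normal')
    qed
  qed (use X1 Y1 in auto)
qed

theorem theorem2p2:
  fixes X :: "nat \<Rightarrow> 'a topology" and dX :: "nat \<Rightarrow> nat \<Rightarrow> 'a \<Rightarrow> 'a"
    and Y :: "nat \<Rightarrow> 'b topology" and dY :: "nat \<Rightarrow> nat \<Rightarrow> 'b \<Rightarrow> 'b"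
    and f :: "nat \<Rightarrow> 'a \<Rightarrow> 'b"
  assumes "semisimplicial_space X dX"
    and "semisimplicial_space Y dY"
    and "semisimplicial_map X dX Y dY f"
    and "\<And>p. weak_homotopy_equivalence (X p) (Y p) (f p)"
  shows "weak_homotopy_equivalence (realisation X dX) (realisation Y dY) (realisation_map Y dY f)"
proof (rule lifts_cubes_imp_weak_homotopy_equivalence)
  let ?F = "realisation_map Y dY f"
  let ?qX = "realisation_class X dX" and ?qY = "realisation_class Y dY"
  let ?U = "\<lambda>c. ?qY ` gap_part Y {c}"
  show F: "continuous_map (realisation X dX) (realisation Y dY) ?F"
    by (rule continuous_realisation_map[OF assms(1-3)])
  have lc: "lifts_cubes k (X p) (Y p) (f p)" for k p
    by (rule weak_homotopy_equivalence_imp_lifts_cubes[OF assms(4)])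
  have tX: "topspace (realisation X dX) = ?qX ` topspace (prerealisation X)"
    and tY: "topspace (realisation Y dY) = ?qY ` topspace (prerealisation Y)"
    using quotient_imp_surjective_map[OF quotient_map_realisation_class] by metis+
  have mem: "?qY z \<in> ?qY ` gap_part Y C \<longleftrightarrow> z \<in> gap_part Y C"
    if z: "z \<in> topspace (prerealisation Y)" and C: "C \<subseteq> {0<..<1}" for z C
  proof
    assume "?qY z \<in> ?qY ` gap_part Y C"
    then obtain w where w: "w \<in> gap_part Y C" "?qY z = ?qY w" by blast
    then have "(z, w) \<in> realisation_rel Y dY"
      using realisation_class_eq_iff[OF z, of w dY] gap_part_subset[of Y C] by blast
    moreover have "C \<subseteq> {0<..}" using C by auto
    ultimately show "z \<in> gap_part Y C" using gap_part_rel[OF assms(2)] w(1) by blast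
  qed blast
  fix n
  show "lifts_cubes n (realisation X dX) (realisation Y dY) ?F"
  proof (rule lifts_cubes_open_cover[OF F, where \<U> = "?U ` {0<..<1}"])
    show "openin (realisation Y dY) U" if "U \<in> ?U ` {0<..<1}" for U
    proof -
      obtain c where c: "0 < c" "c < 1" "U = ?U c" using \<open>U \<in> ?U ` {0<..<1}\<close> by auto
      have "openin (realisation Y dY) (?U c)"
        using realisation_gap_retract[OF assms(2), of "{c}"] c by auto
      then show ?thesis using c by simp
    qed
    show "topspace (realisation Y dY) \<subseteq> \<Union>(?U ` {0<..<1})"
    proof
      fix w assume "w \<in> topspace (realisation Y dY)"
      then obtain z where z: "z \<in> topspace (prerealisation Y)" "w = ?qY z" by (auto simp: tY)
      then have "snd (snd z) \<in> standard_simplex (fst z)" by (auto simp: topspace_prerealisation)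
      then obtain c where "0 < c" "c < 1" "has_gap c (snd (snd z))" using has_gap_exists by blast
      then show "w \<in> \<Union>(?U ` {0<..<1})" using z by (auto simp: gap_part_def)
    qed
    fix \<J> k assume J: "finite \<J>" "\<J> \<noteq> {}" "\<J> \<subseteq> ?U ` {0<..<1}"
    \<comment> \<open>A finite subfamily of the cover is named by a finite set \<open>C\<close> of
      ratios. Since gap parts are saturated, taking images commutes with this intersection, which is
      therefore the image of \<open>gap_part Y C\<close>.\<close>
    obtain C where C: "finite C" "C \<subseteq> {0<..<1}" "\<J> = ?U ` C"
      using finite_subset_image[OF J(1,3)] by blast
    have ne: "C \<noteq> {}" using J(2) C(3) by blast
    have all: "gap_part Y C = {z \<in> topspace (prerealisation Y). \<forall>c\<in>C. z \<in> gap_part Y {c}}"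
      by (auto simp: gap_part_def)
    have in_J: "?qY z \<in> \<Inter>\<J> \<longleftrightarrow> z \<in> gap_part Y C" if z: "z \<in> topspace (prerealisation Y)" for z
    proof -
      have "?qY z \<in> ?U c \<longleftrightarrow> z \<in> gap_part Y {c}" if "c \<in> C" for c
        using mem[OF z, of "{c}"] that C(2) by auto
      then show ?thesis unfolding C(3) all using z by simp
    qed
    have "\<Inter>\<J> = ?qY ` gap_part Y C"
    proof
      show "\<Inter>\<J> \<subseteq> ?qY ` gap_part Y C"
      proof
        fix w assume w: "w \<in> \<Inter>\<J>"
        obtain c where "c \<in> C" using ne by blast
        then have "w \<in> ?U c" using w C(3) by blast
        then obtain z where z: "z \<in> gap_part Y {c}" "w = ?qY z" by blast
        then have "z \<in> topspace (prerealisation Y)" using gap_part_subset by blast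
        then show "w \<in> ?qY ` gap_part Y C" using in_J w z(2) by blast
      qed
      show "?qY ` gap_part Y C \<subseteq> \<Inter>\<J>" using in_J gap_part_subset[of Y C] by blast
    qed
    \<comment> \<open>The level map does not touch simplex coordinates, so the preimage of the
      intersection is cut out in the realisation of \<open>X\<close> by the same ratios
      \<open>C\<close>.\<close>
    moreover have "subtopology (realisation X dX) {w. ?F w \<in> \<Inter>\<J>} =
        subtopology (realisation X dX) (?qX ` gap_part X C)"
    proof -
      have "topspace (realisation X dX) \<inter> {w. ?F w \<in> \<Inter>\<J>} = topspace (realisation X dX) \<inter> ?qX ` gap_part X C"
      proof -
        have "?F (?qX z) \<in> \<Inter>\<J> \<longleftrightarrow> z \<in> gap_part X C" if "z \<in> topspace (prerealisation X)" for z
          using in_J[OF level_map_in[OF assms(3) that]] level_map_gap_part[OF assms(3) that]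
          by (simp add: realisation_map_level_map[OF assms(2,3) that])
        moreover have "?qX z \<in> ?qX ` gap_part X C \<longleftrightarrow> z \<in> gap_part X C"
          if z: "z \<in> topspace (prerealisation X)" for z
        proof
          assume "?qX z \<in> ?qX ` gap_part X C"
          then obtain w where w: "w \<in> gap_part X C" "?qX z = ?qX w" by blast
          then have "(z, w) \<in> realisation_rel X dX"
            using realisation_class_eq_iff[OF z, of w dX] gap_part_subset[of X C] by blast
          moreover have "C \<subseteq> {0<..}" using C(2) by auto
          ultimately show "z \<in> gap_part X C" using gap_part_rel[OF assms(1)] w(1) by blast
        qed blast
        ultimately show ?thesis unfolding tX by blast
      qed
      then show ?thesis by (metis subtopology_restrict)
    qed
    ultimately show "lifts_cubes k (subtopology (realisation X dX) {w. ?F w \<in> \<Inter>\<J>})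
        (subtopology (realisation Y dY) (\<Inter>\<J>)) ?F"
      using lifts_cubes_realisation_gap[OF assms(1-3) lc C(1) ne C(2)] by simp
  qed
qed

end
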